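(* Let $V=(M_\psi\otimes K^* )\mathscr V(M_\psi\otimes K)$ with $\nu_0>3$, $0\le\mathscr V\in\mathcal B(\ell^2(\mathbb Z_h,\mathcal G))$ and $K\in\mathfrak S_2(\mathcal G)$. Suppose that $\dim(\mathcal G)<+\infty$. Then $$\sup_{\lambda\in\mathbb R\setminus\mathscr E_Q}|\xi(\lambda;H^\pm,H_Q)|<+\infty.$$
   Context: Let $h>0$, $\mathbb Z_h=\{hn:n\in\mathbb Z\}$, and let $\mathcal G$ be a separable complex Hilbert space. $\ell^2(\mathbb Z_h)=\ell^2(\mathbb Z_h,\mathbb C)$ has scalar product $\langle\varphi,\phi\rangle=\sum_{n\in\mathbb Z}\overline{\varphi(hn)}\phi(hn)$, and $\ell^2(\mathbb Z_h,\mathcal G)$ is identified with $\ell^2(\mathbb Z_h)\otimes\mathcal G$. On $\ell^2(\mathbb Z_h)$, $(-\Delta_h\phi)(hn)=h^{-2}\big(2\phi(hn)-\phi(h(n+1))-\phi(h(n-1))\big)$. $Q$ is a self-adjoint operator on $\mathcal G$ such that either $Q=0$, or $Q\ne0$ and $\mathcal G=\bigoplus_{s=1}^d\mathrm{Ker}(Q-\mu_s)$ with $d<+\infty$ and $\mu_1,\dots,\mu_d$ the distinct eigenvalues of $Q$ (automatic if $\dim\mathcal G<\infty$). $H_Q=-\Delta_h\otimes I_{\mathcal G}+I_{\ell^2(\mathbb Z_h)}\otimes Q$. The threshold set is $\mathscr E_Q=\{0,4/h^2\}$ if $Q=0$ and $\mathscr E_Q=\{\mu_s,\mu_s+4/h^2\}_{s=1}^d$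 if $Q\neq0$. $\mathfrak S_p$ denotes the Schatten class. $\langle n\rangle=(1+n^2)^{1/2}$, $\psi(hn)=\langle n\rangle^{-\nu_0/2}$, $M_\psi$ is multiplication by $\psi$ on $\ell^2(\mathbb Z_h)$. $H^\pm=H_Q\pm V$. Spectral shift function: put $\mathscr M=\mathscr V^{1/2}(M_\psi\otimes K)\in\mathfrak S_2$ (so $V=\mathscr M^*\mathscr M$) and $T(z)=\mathscr M(H_Q-z)^{-1}\mathscr M^*$. For each $\lambda\in\mathbb R\setminus\mathscr E_Q$ the limit $T(\lambda+i0)=\lim_{\varepsilon\searrow0}T(\lambda+i\varepsilon)$ exists in $\mathfrak S_2$; $A(\lambda+i0)$ and $B(\lambda+i0)$ are its real and imaginary (self-adjoint) parts, $0\le B(\lambda+i0)\in\mathfrak S_1$. For compact self-adjoint $S$ and $r>0$, $\mathscr N_\pm(r,S)=\mathrm{Rank}\,\mathbf 1_{(r,\infty)}(\pm S)$. The SSF is identified with its representative $\xi(\lambda;H^\pm,H_Q)=\pm\frac1\pi\int_{\mathbb R}\mathscr N_\mp(1,A(\lambda+i0)+tB(\lambda+i0))\frac{dt}{1+t^2}$, $\lambda\in\mathbb R\setminus\mathscr E_Q$. *)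

theory Defs
  imports "HOL-Analysis.Analysis" "HOL-Library.Extended_Nat" "HOL-Library.Nonpos_Ints"
begin

section \<open>Complex Hilbert spaces\<close>

text \<open>The complex scalar product is antilinear in its first argument.  The norm, the metric and the
  topology are those of the underlying real inner product space, whose inner product is the real
  part of the complex one.\<close>

class complex_inner = real_inner +
  fixes scaleC :: "complex \<Rightarrow> 'a \<Rightarrow> 'a" (infixr \<open>*\<^sub>C\<close> 75)
    and cinner :: "'a \<Rightarrow> 'a \<Rightarrow> complex"
  assumes scaleC_add_right: "a *\<^sub>C (x + y) = a *\<^sub>C x + a *\<^sub>C y"
    and scaleC_add_left: "(a + b) *\<^sub>C x = a *\<^sub>C x + b *\<^sub>C x"
    and scaleC_scaleC: "a *\<^sub>C b *\<^sub>C x = (a * b) *\<^sub>C x"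
    and scaleR_scaleC: "r *\<^sub>R x = complex_of_real r *\<^sub>C x"
    and cinner_commute: "cinner x y = cnj (cinner y x)"
    and cinner_add_right: "cinner x (y + z) = cinner x y + cinner x z"
    and cinner_scaleC_right: "cinner x (a *\<^sub>C y) = a * cinner x y"
    and inner_eq_Re_cinner: "inner x y = Re (cinner x y)"

class complex_hilbert = complex_inner + complete_space

interpretation complex_vector: vector_space "scaleC :: complex \<Rightarrow> 'a \<Rightarrow> 'a::complex_inner"
proof
  show "1 *\<^sub>C x = x" for x :: 'a
    using scaleR_scaleC[of 1 x] by simp
qed (auto simp: scaleC_add_right scaleC_add_left scaleC_scaleC)

lemma scaleC_2: "2 *\<^sub>C x = 2 *\<^sub>R (x::'a::complex_inner)"
  by (simp add: scaleR_scaleC)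

instantiation complex :: complex_hilbert
begin

definition scaleC_complex :: "complex \<Rightarrow> complex \<Rightarrow> complex" where "scaleC_complex = (*)"

definition cinner_complex :: "complex \<Rightarrow> complex \<Rightarrow> complex" where "cinner_complex x y = cnj x * y"

instance
  by standard
    (auto simp: scaleC_complex_def cinner_complex_def inner_complex_def algebra_simps scaleR_conv_of_real)

end

lemma cinner_self: "cinner x x = complex_of_real ((norm (x::'a::complex_inner))\<^sup>2)"
proof -
  have "Im (cinner x x) = 0"
    using arg_cong[OF cinner_commute[of x x], of Im] by simp
  moreover have "Re (cinner x x) = (norm x)\<^sup>2"
    by (simp add: inner_eq_Re_cinner[symmetric] power2_norm_eq_inner)
  ultimately show ?thesis by (simp add: complex_eq_iff)
qed

lemma cinner_scaleC_left: "cinner (a *\<^sub>C x) y = cnj a * cinner (x::'a::complex_inner) y"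
  by (metis cinner_commute cinner_scaleC_right complex_cnj_mult complex_cnj_cnj)

lemma norm_scaleC: "norm (a *\<^sub>C x) = cmod a * norm (x::'a::complex_inner)"
proof -
  have "complex_of_real ((norm (a *\<^sub>C x))\<^sup>2) = a * cnj a * cinner x x"
    by (simp only: cinner_self[symmetric] cinner_scaleC_left cinner_scaleC_right mult_ac)
  also have "\<dots> = complex_of_real ((cmod a * norm x)\<^sup>2)"
    by (simp only: cinner_self complex_norm_square power_mult_distrib of_real_mult)
  finally have "complex_of_real ((norm (a *\<^sub>C x))\<^sup>2) = complex_of_real ((cmod a * norm x)\<^sup>2)" .
  then have "(norm (a *\<^sub>C x))\<^sup>2 = (cmod a * norm x)\<^sup>2" using of_real_eq_iff by blast
  then show ?thesis by (simp add: power2_eq_iff_nonneg)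
qed

lemma cmod_cinner_le: "cmod (cinner x y) \<le> norm x * norm (y::'a::complex_inner)"
proof (cases "cinner x y = 0")
  case False
  define u where "u = cnj (cinner x y) / cmod (cinner x y)"
  have u: "cmod u = 1" using False by (simp add: u_def norm_divide)
  have "u * cinner x y = cmod (cinner x y)"
    using False unfolding u_def
    by (simp add: complex_norm_square[symmetric] mult.commute power2_eq_square)
  then have "cmod (cinner x y) = inner x (u *\<^sub>C y)"
    by (simp add: inner_eq_Re_cinner cinner_scaleC_right)
  also have "\<dots> \<le> norm x * norm (u *\<^sub>C y)" by (rule norm_cauchy_schwarz)
  finally show ?thesis by (simp add: norm_scaleC u)
qed auto


section \<open>The spaces of square summable functions on the lattice\<close>

text \<open>The point \<open>h * n\<close> of the lattice is represented by the integer \<open>n\<close>, so that \<open>complex l2\<close> and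
  \<open>'g l2\<close> are the spaces of square summable functions on the lattice with values in the complex
  numbers and in \<open>'g\<close>.\<close>

typedef (overloaded) 'a l2 = "{f :: int \<Rightarrow> 'a::complex_inner. (\<lambda>n. (norm (f n))\<^sup>2) summable_on UNIV}"
  morphisms l2_apply to_l2
  by (rule exI[of _ "\<lambda>_. 0"]) auto

setup_lifting type_definition_l2

lemma summable_on_square_add:
  fixes f g :: "'b \<Rightarrow> 'a::real_normed_vector"
  assumes "(\<lambda>n. (norm (f n))\<^sup>2) summable_on A" "(\<lambda>n. (norm (g n))\<^sup>2) summable_on A"
  shows "(\<lambda>n. (norm (f n + g n))\<^sup>2) summable_on A"
proof (rule summable_on_comparison_test)
  show "(\<lambda>n. 2 * (norm (f n))\<^sup>2 + 2 * (norm (g n))\<^sup>2) summable_on A"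
    by (intro summable_on_add summable_on_cmult_right assms)
  show "(norm (f n + g n))\<^sup>2 \<le> 2 * (norm (f n))\<^sup>2 + 2 * (norm (g n))\<^sup>2" for n
  proof -
    have "(norm (f n + g n))\<^sup>2 \<le> (norm (f n) + norm (g n))\<^sup>2"
      by (intro power_mono norm_triangle_ineq) auto
    also have "\<dots> \<le> 2 * (norm (f n))\<^sup>2 + 2 * (norm (g n))\<^sup>2"
      using sum_squares_bound[of "norm (f n)" "norm (g n)"] by (simp add: power2_sum)
    finally show ?thesis .
  qed
qed auto

lemma summable_on_square_scaleC:
  fixes f :: "'b \<Rightarrow> 'a::complex_inner"
  assumes "(\<lambda>n. (norm (f n))\<^sup>2) summable_on A"
  shows "(\<lambda>n. (norm (a *\<^sub>C f n))\<^sup>2) summable_on A"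
  using summable_on_cmult_right[OF assms, of "(cmod a)\<^sup>2"]
  by (simp add: norm_scaleC power_mult_distrib)

lemma abs_summable_on_cinner:
  fixes f g :: "'b \<Rightarrow> 'a::complex_inner"
  assumes "(\<lambda>n. (norm (f n))\<^sup>2) summable_on A" "(\<lambda>n. (norm (g n))\<^sup>2) summable_on A"
  shows "(\<lambda>n. norm (cinner (f n) (g n))) summable_on A"
proof (rule summable_on_comparison_test)
  show "(\<lambda>n. (norm (f n))\<^sup>2 + (norm (g n))\<^sup>2) summable_on A"
    by (intro summable_on_add assms)
  show "cmod (cinner (f n) (g n)) \<le> (norm (f n))\<^sup>2 + (norm (g n))\<^sup>2" for n
  proof -
    have "2 * (norm (f n) * norm (g n)) \<le> (norm (f n))\<^sup>2 + (norm (g n))\<^sup>2"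
      using sum_squares_bound[of "norm (f n)" "norm (g n)"] by simp
    moreover have "0 \<le> norm (f n) * norm (g n)" by simp
    ultimately show ?thesis using cmod_cinner_le[of "f n" "g n"] by linarith
  qed
qed auto

lemmas summable_on_cinner = abs_summable_summable[OF abs_summable_on_cinner]

instantiation l2 :: (complex_inner) complex_inner
begin

lift_definition zero_l2 :: "'a l2" is "\<lambda>_. 0" by auto

lift_definition plus_l2 :: "'a l2 \<Rightarrow> 'a l2 \<Rightarrow> 'a l2" is "\<lambda>f g n. f n + g n"
  by (rule summable_on_square_add)

lift_definition uminus_l2 :: "'a l2 \<Rightarrow> 'a l2" is "\<lambda>f n. - f n" by simp

lift_definition minus_l2 :: "'a l2 \<Rightarrow> 'a l2 \<Rightarrow> 'a l2" is "\<lambda>f g n. f n - g n"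
  using summable_on_square_add[where g = "\<lambda>n. - (_ n)"] by fastforce

lift_definition scaleC_l2 :: "complex \<Rightarrow> 'a l2 \<Rightarrow> 'a l2" is "\<lambda>a f n. a *\<^sub>C f n"
  by (rule summable_on_square_scaleC)

lift_definition scaleR_l2 :: "real \<Rightarrow> 'a l2 \<Rightarrow> 'a l2" is "\<lambda>a f n. a *\<^sub>R f n"
  by (simp add: scaleR_scaleC summable_on_square_scaleC)

lift_definition cinner_l2 :: "'a l2 \<Rightarrow> 'a l2 \<Rightarrow> complex"
  is "\<lambda>f g. \<Sum>\<^sub>\<infinity>n. cinner (f n) (g n)" .

definition inner_l2 :: "'a l2 \<Rightarrow> 'a l2 \<Rightarrow> real" where "inner_l2 f g = Re (cinner f g)"

definition norm_l2 :: "'a l2 \<Rightarrow> real" where "norm_l2 f = sqrt (inner f f)"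

definition dist_l2 :: "'a l2 \<Rightarrow> 'a l2 \<Rightarrow> real" where "dist_l2 f g = norm (f - g)"

definition sgn_l2 :: "'a l2 \<Rightarrow> 'a l2" where "sgn_l2 f = inverse (norm f) *\<^sub>R f"

definition uniformity_l2 :: "('a l2 \<times> 'a l2) filter"
  where "uniformity_l2 = (INF e\<in>{0<..}. principal {(f, g). dist f g < e})"

definition open_l2 :: "'a l2 set \<Rightarrow> bool"
  where "open_l2 U \<longleftrightarrow> (\<forall>f\<in>U. eventually (\<lambda>(f', g). f' = f \<longrightarrow> g \<in> U) uniformity)"

instance
proof
  fix f g k :: "'a l2" and a b :: real and c d :: complex
  have self: "inner f f = (\<Sum>\<^sub>\<infinity>n. (norm (l2_apply f n))\<^sup>2)" for f :: "'a l2"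
  proof -
    have "inner f f = Re (\<Sum>\<^sub>\<infinity>n. complex_of_real ((norm (l2_apply f n))\<^sup>2))"
      unfolding inner_l2_def by transfer (simp only: cinner_self)
    also have "\<dots> = (\<Sum>\<^sub>\<infinity>n. (norm (l2_apply f n))\<^sup>2)"
      using summable_on_of_real[where 'a = complex, of "\<lambda>n. (norm (l2_apply f n))\<^sup>2" UNIV]
        l2_apply[of f]
      by (subst infsum_Re[symmetric]) auto
    finally show ?thesis .
  qed
  show "f + g + k = f + (g + k)" by transfer (auto simp: add.assoc)
  show "f + g = g + f" by transfer (auto simp: add.commute)
  show "0 + f = f" "- f + f = 0" "f - g = f + - g" by (transfer, auto)+
  show "a *\<^sub>R (f + g) = a *\<^sub>R f + a *\<^sub>R g" "(a + b) *\<^sub>R f = a *\<^sub>R f + b *\<^sub>R f"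
    "a *\<^sub>R b *\<^sub>R f = (a * b) *\<^sub>R f" "1 *\<^sub>R f = f"
    by (transfer, auto simp: algebra_simps)+
  show "c *\<^sub>C (f + g) = c *\<^sub>C f + c *\<^sub>C g" "(c + d) *\<^sub>C f = c *\<^sub>C f + d *\<^sub>C f"
    "c *\<^sub>C d *\<^sub>C f = (c * d) *\<^sub>C f"
    by (transfer, auto simp: scaleC_add_left scaleC_add_right scaleC_scaleC)+
  show "a *\<^sub>R f = complex_of_real a *\<^sub>C f" by transfer (auto simp: scaleR_scaleC)
  show com: "cinner f g = cnj (cinner g f)" for f g :: "'a l2"
    by transfer (subst infsum_cnj[symmetric], subst cinner_commute, simp)
  show add: "cinner f (g + k) = cinner f g + cinner f k" for f g k :: "'a l2"
    by transfer (simp add: cinner_add_right infsum_add summable_on_cinner)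
  show sc: "cinner f (c *\<^sub>C g) = c * cinner f g" for f g :: "'a l2" and c
    by transfer (simp add: cinner_scaleC_right infsum_cmult_right')
  show "inner f g = Re (cinner f g)" by (rule inner_l2_def)
  show inc: "inner f g = inner g f" for f g :: "'a l2"
    unfolding inner_l2_def by (subst com) simp
  have ia: "inner f (g + k) = inner f g + inner f k" for f g k :: "'a l2"
    unfolding inner_l2_def by (simp add: add)
  show "inner (f + g) k = inner f k + inner g k"
    using ia inc by metis
  have sr: "a *\<^sub>R f = complex_of_real a *\<^sub>C f" for f :: "'a l2" by transfer (auto simp: scaleR_scaleC)
  show "inner (a *\<^sub>R f) g = a * inner f g"
    by (subst (1 2) inc) (simp add: inner_l2_def sr sc)
  show "0 \<le> inner f f" by (simp add: self infsum_nonneg)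
  show "inner f f = 0 \<longleftrightarrow> f = 0"
  proof
    assume "inner f f = 0"
    then have "(norm (l2_apply f n))\<^sup>2 = 0" for n
      using nonneg_infsum_le_0D[of "\<lambda>n. (norm (l2_apply f n))\<^sup>2" UNIV n] l2_apply[of f]
      by (auto simp: self)
    then show "f = 0" by (intro l2_apply_inject[THEN iffD1]) (auto simp: zero_l2.rep_eq)
  qed (simp add: self zero_l2.rep_eq)
  show "norm f = sqrt (inner f f)" by (rule norm_l2_def)
  show "dist f g = norm (f - g)" by (rule dist_l2_def)
  show "sgn f = inverse (norm f) *\<^sub>R f" by (rule sgn_l2_def)
  show "uniformity = (INF e\<in>{0<..}. principal {(f, g :: 'a l2). dist f g < e})"
    by (rule uniformity_l2_def)
  show "open U \<longleftrightarrow> (\<forall>f\<in>U. eventually (\<lambda>(f', g). f' = f \<longrightarrow> g \<in> U) uniformity)"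
    for U :: "'a l2 set"
    by (rule open_l2_def)
qed

end

lemma l2_eqI: "(\<And>n. l2_apply f n = l2_apply g n) \<Longrightarrow> f = g"
  by (metis ext l2_apply_inject)

lemma norm_l2_squared: "(norm f)\<^sup>2 = (\<Sum>\<^sub>\<infinity>n. (norm (l2_apply f n))\<^sup>2)"
proof -
  have "complex_of_real ((norm f)\<^sup>2) = (\<Sum>\<^sub>\<infinity>n. complex_of_real ((norm (l2_apply f n))\<^sup>2))"
    unfolding cinner_self[symmetric] by (simp add: cinner_l2.rep_eq)
  then have "(norm f)\<^sup>2 = Re (\<Sum>\<^sub>\<infinity>n. complex_of_real ((norm (l2_apply f n))\<^sup>2))"
    by (metis Re_complex_of_real)
  also have "\<dots> = (\<Sum>\<^sub>\<infinity>n. (norm (l2_apply f n))\<^sup>2)"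
    using summable_on_of_real[where 'a = complex, of "\<lambda>n. (norm (l2_apply f n))\<^sup>2" UNIV]
      l2_apply[of f]
    by (subst infsum_Re[symmetric]) auto
  finally show ?thesis .
qed

lemma sum_le_norm_l2_squared:
  assumes "finite F"
  shows "(\<Sum>n\<in>F. (norm (l2_apply f n))\<^sup>2) \<le> (norm f)\<^sup>2"
  unfolding norm_l2_squared using assms l2_apply[of f] by (intro finite_sum_le_infsum) auto

lemma norm_l2_apply_le: "norm (l2_apply f n) \<le> norm f"
  using sum_le_norm_l2_squared[of "{n}" f] by (simp add: power2_le_iff_abs_le)

lemma in_l2_bounded_sums:
  assumes "\<And>F. finite F \<Longrightarrow> (\<Sum>n\<in>F. (norm (f n))\<^sup>2) \<le> b\<^sup>2" "0 \<le> b"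
  shows "(\<lambda>n. (norm (f n))\<^sup>2) summable_on UNIV" "norm (to_l2 f) \<le> b"
proof -
  show *: "(\<lambda>n. (norm (f n))\<^sup>2) summable_on UNIV"
    using assms by (intro nonneg_bdd_above_summable_on) (auto intro!: bdd_aboveI2)
  have "(norm (to_l2 f))\<^sup>2 \<le> b\<^sup>2"
    unfolding norm_l2_squared using * assms
    by (intro infsum_le_finite_sums) (auto simp: to_l2_inverse)
  then show "norm (to_l2 f) \<le> b" using assms(2) power2_le_imp_le by blast
qed

instance l2 :: (complex_hilbert) complex_hilbert
proof
  fix X :: "nat \<Rightarrow> 'a l2"
  assume X: "Cauchy X"
  have "Cauchy (\<lambda>k. l2_apply (X k) n)" for n
  proof (rule metric_CauchyI)
    fix e :: real assume "0 < e"
    then obtain N where N: "\<And>j k. j \<ge> N \<Longrightarrow> k \<ge> N \<Longrightarrow> dist (X j) (X k) < e"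
      using X unfolding Cauchy_def by blast
    have "dist (l2_apply (X j) n) (l2_apply (X k) n) \<le> dist (X j) (X k)" for j k
      using norm_l2_apply_le[of "X j - X k" n] by (simp add: dist_norm minus_l2.rep_eq)
    with N show "\<exists>N. \<forall>j\<ge>N. \<forall>k\<ge>N. dist (l2_apply (X j) n) (l2_apply (X k) n) < e"
      by (meson le_less_trans)
  qed
  then have g': "(\<lambda>k. l2_apply (X k) n) \<longlonglongrightarrow> lim (\<lambda>k. l2_apply (X k) n)" for n
    using Cauchy_convergent convergent_LIMSEQ_iff by blast
  define g where "g n = lim (\<lambda>k. l2_apply (X k) n)" for n
  have g: "(\<lambda>k. l2_apply (X k) n) \<longlonglongrightarrow> g n" for n
    unfolding g_def by (rule g')
  have sums: "(\<Sum>n\<in>F. (norm (l2_apply (X j) n - g n))\<^sup>2) \<le> e\<^sup>2"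
    if "\<And>k. k \<ge> N \<Longrightarrow> dist (X j) (X k) < e" "finite F" for e N j F
  proof (rule tendsto_upperbound)
    show "(\<lambda>k. \<Sum>n\<in>F. (norm (l2_apply (X j) n - l2_apply (X k) n))\<^sup>2)
        \<longlonglongrightarrow> (\<Sum>n\<in>F. (norm (l2_apply (X j) n - g n))\<^sup>2)"
      by (intro tendsto_intros g)
    have "(\<Sum>n\<in>F. (norm (l2_apply (X j) n - l2_apply (X k) n))\<^sup>2) \<le> e\<^sup>2" if "k \<ge> N" for k
    proof -
      have "(\<Sum>n\<in>F. (norm (l2_apply (X j - X k) n))\<^sup>2) \<le> (norm (X j - X k))\<^sup>2"
        by (rule sum_le_norm_l2_squared) fact
      also have "\<dots> \<le> e\<^sup>2"
        using \<open>k \<ge> N\<close> \<open>\<And>k. k \<ge> N \<Longrightarrow> dist (X j) (X k) < e\<close>[of k]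
        by (intro power_mono) (auto simp: dist_norm)
      finally show ?thesis by (simp add: minus_l2.rep_eq)
    qed
    then show "\<forall>\<^sub>F k in sequentially.
        (\<Sum>n\<in>F. (norm (l2_apply (X j) n - l2_apply (X k) n))\<^sup>2) \<le> e\<^sup>2"
      by (auto simp: eventually_sequentially)
  qed simp
  obtain N1 where N1: "\<And>j k. j \<ge> N1 \<Longrightarrow> k \<ge> N1 \<Longrightarrow> dist (X j) (X k) < 1"
    using X unfolding Cauchy_def using zero_less_one by blast
  have "(\<lambda>n. (norm (l2_apply (X N1) n - g n))\<^sup>2) summable_on UNIV"
    by (rule in_l2_bounded_sums(1)[of _ 1]) (use sums[of N1 N1 1] N1 in auto)
  then have "(\<lambda>n. (norm (l2_apply (X N1) n + - (l2_apply (X N1) n - g n)))\<^sup>2) summable_on UNIV"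
    using l2_apply[of "X N1"] by (intro summable_on_square_add) (auto simp: norm_minus_commute)
  then have g_l2: "(\<lambda>n. (norm (g n))\<^sup>2) summable_on UNIV" by simp
  have "X \<longlonglongrightarrow> to_l2 g"
  proof (rule metric_LIMSEQ_I)
    fix e :: real assume "0 < e"
    then have "0 < e / 2" by simp
    then obtain N where N: "\<And>j k. j \<ge> N \<Longrightarrow> k \<ge> N \<Longrightarrow> dist (X j) (X k) < e / 2"
      using X unfolding Cauchy_def by blast
    have "dist (X j) (to_l2 g) < e" if "j \<ge> N" for j
    proof -
      have "norm (to_l2 (\<lambda>n. l2_apply (X j) n - g n)) \<le> e / 2"
        by (rule in_l2_bounded_sums(2)) (use sums[of N j "e / 2"] N that \<open>0 < e\<close> in auto)
      moreover have "X j - to_l2 g = to_l2 (\<lambda>n. l2_apply (X j) n - g n)"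
        using g_l2 by (simp add: minus_l2_def to_l2_inverse)
      ultimately show ?thesis using \<open>0 < e\<close> by (simp add: dist_norm)
    qed
    then show "\<exists>N. \<forall>j\<ge>N. dist (X j) (to_l2 g) < e" by blast
  qed
  then show "convergent X" unfolding convergent_def by blast
qed


section \<open>Operators\<close>

definition bounded_clinear :: "('a::complex_inner \<Rightarrow> 'b::complex_inner) \<Rightarrow> bool"
  where "bounded_clinear T \<longleftrightarrow> bounded_linear T \<and> (\<forall>a x. T (a *\<^sub>C x) = a *\<^sub>C T x)"

definition cadjoint :: "('a::complex_inner \<Rightarrow> 'b::complex_inner) \<Rightarrow> 'b \<Rightarrow> 'a"
  where "cadjoint T = (THE S. \<forall>x y. cinner (S y) x = cinner y (T x))"

definition selfadjoint :: "('a::complex_inner \<Rightarrow> 'a) \<Rightarrow> bool"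
  where "selfadjoint T \<longleftrightarrow> bounded_clinear T \<and> (\<forall>x y. cinner (T y) x = cinner y (T x))"

definition positive_op :: "('a::complex_inner \<Rightarrow> 'a) \<Rightarrow> bool"
  where "positive_op T \<longleftrightarrow> bounded_clinear T \<and> (\<forall>x. cinner x (T x) \<in> \<real>\<^sub>\<ge>\<^sub>0)"

definition sqrt_op :: "('a::complex_inner \<Rightarrow> 'a) \<Rightarrow> 'a \<Rightarrow> 'a"
  where "sqrt_op T = (THE S. positive_op S \<and> S \<circ> S = T)"

definition re_part :: "('a::complex_inner \<Rightarrow> 'a) \<Rightarrow> 'a \<Rightarrow> 'a"
  where "re_part T x = (1 / 2) *\<^sub>C (T x + cadjoint T x)"

definition im_part :: "('a::complex_inner \<Rightarrow> 'a) \<Rightarrow> 'a \<Rightarrow> 'a"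
  where "im_part T x = (1 / (2 * \<i>)) *\<^sub>C (T x - cadjoint T x)"

definition resolvent :: "('a::complex_inner \<Rightarrow> 'a) \<Rightarrow> complex \<Rightarrow> 'a \<Rightarrow> 'a"
  where "resolvent H z = inv (\<lambda>x. H x - z *\<^sub>C x)"

definition eigenspace :: "('a::complex_inner \<Rightarrow> 'a) \<Rightarrow> real \<Rightarrow> 'a set"
  where "eigenspace T \<mu> = {x. T x = complex_of_real \<mu> *\<^sub>C x}"

definition eigenvalues :: "('a::complex_inner \<Rightarrow> 'a) \<Rightarrow> real set"
  where "eigenvalues T = {\<mu>. \<exists>x\<in>eigenspace T \<mu>. x \<noteq> 0}"

text \<open>Eigenspaces of a self-adjoint operator for distinct eigenvalues are orthogonal, so the span below
  is an orthogonal direct sum; it is finite, hence the operator is automatically bounded.\<close>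

definition finite_eigendecomposition :: "('a::complex_inner \<Rightarrow> 'a) \<Rightarrow> bool"
  where "finite_eigendecomposition T \<longleftrightarrow> finite (eigenvalues T) \<and>
    complex_vector.span (\<Union>\<mu>\<in>eigenvalues T. eigenspace T \<mu>) = UNIV"


subsection \<open>Hilbert--Schmidt operators\<close>

definition orthonormal_basis :: "'a::complex_inner set \<Rightarrow> bool"
  where "orthonormal_basis E \<longleftrightarrow>
    (\<forall>e\<in>E. \<forall>f\<in>E. cinner e f = (if e = f then 1 else 0)) \<and> closure (complex_vector.span E) = UNIV"

definition hilbert_schmidt :: "('a::complex_inner \<Rightarrow> 'b::complex_inner) \<Rightarrow> bool"
  where "hilbert_schmidt T \<longleftrightarrow>
    bounded_clinear T \<and> (\<exists>E. orthonormal_basis E \<and> (\<lambda>e. (norm (T e))\<^sup>2) summable_on E)"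

text \<open>The value does not depend on the choice of the orthonormal basis.\<close>

definition hs_norm :: "('a::complex_inner \<Rightarrow> 'b::complex_inner) \<Rightarrow> real"
  where "hs_norm T = sqrt (\<Sum>\<^sub>\<infinity>e\<in>(SOME E. orthonormal_basis E). (norm (T e))\<^sup>2)"

definition hs_tendsto ::
    "('c \<Rightarrow> 'a::complex_inner \<Rightarrow> 'b::complex_inner) \<Rightarrow> ('a \<Rightarrow> 'b) \<Rightarrow> 'c filter \<Rightarrow> bool"
  where "hs_tendsto T L F \<longleftrightarrow> hilbert_schmidt L \<and> (\<forall>\<^sub>F c in F. hilbert_schmidt (T c)) \<and>
    ((\<lambda>c. hs_norm (\<lambda>x. T c x - L x)) \<longlongrightarrow> 0) F"


subsection \<open>The counting functions of compact self-adjoint operators\<close>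

definition orthogonal_projection :: "'a::complex_inner set \<Rightarrow> 'a \<Rightarrow> 'a"
  where "orthogonal_projection W x = (THE p. p \<in> W \<and> (\<forall>w\<in>W. cinner w (x - p) = 0))"

text \<open>For a compact self-adjoint operator \<open>S\<close> the spectral theorem gives an orthonormal basis of
  eigenvectors, and \<open>spectral_projection S I\<close> is the operator \<open>1\<^sub>I(S)\<close> of the functional calculus.
  This is not so for self-adjoint operators with continuous spectrum.\<close>

definition spectral_projection :: "('a::complex_inner \<Rightarrow> 'a) \<Rightarrow> real set \<Rightarrow> 'a \<Rightarrow> 'a"
  where "spectral_projection S I =
    orthogonal_projection (closure (complex_vector.span (\<Union>\<mu>\<in>I. eigenspace S \<mu>)))"

text \<open>The library dimension of an infinite-dimensional space is \<open>0\<close>, hence the case distinction.\<close>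

definition rank_op :: "('a::complex_inner \<Rightarrow> 'b::complex_inner) \<Rightarrow> enat"
  where "rank_op T = (if \<exists>B. finite B \<and> range T \<subseteq> complex_vector.span B
    then enat (complex_vector.dim (range T)) else \<infinity>)"

definition N_plus :: "real \<Rightarrow> ('a::complex_inner \<Rightarrow> 'a) \<Rightarrow> enat"
  where "N_plus r S = rank_op (spectral_projection S {r<..})"

definition N_minus :: "real \<Rightarrow> ('a::complex_inner \<Rightarrow> 'a) \<Rightarrow> enat"
  where "N_minus r S = rank_op (spectral_projection (\<lambda>x. - S x) {r<..})"


section \<open>Tensor products\<close>

text \<open>Under the identification of \<open>'g l2\<close> with the tensor product of \<open>complex l2\<close> and \<open>'g\<close>, the
  elementary tensor of \<open>\<phi>\<close> and \<open>x\<close> is \<open>n \<mapsto> \<phi>(n) x\<close>; an operator is determined by its values on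
  elementary tensors (\<open>bounded_clinear_l2_eqI\<close>).\<close>

lift_definition tensor_l2 :: "complex l2 \<Rightarrow> 'g::complex_inner \<Rightarrow> 'g l2" (infixr \<open>\<otimes>\<^sub>v\<close> 70)
  is "\<lambda>\<phi> x n. \<phi> n *\<^sub>C x"
  by (auto simp: norm_scaleC power_mult_distrib intro: summable_on_cmult_left)

definition tensor_op ::
    "(complex l2 \<Rightarrow> complex l2) \<Rightarrow> ('g::complex_inner \<Rightarrow> 'g) \<Rightarrow> 'g l2 \<Rightarrow> 'g l2" (infixr \<open>\<otimes>\<^sub>o\<close> 70)
  where "A \<otimes>\<^sub>o B = (THE T. bounded_clinear T \<and> (\<forall>\<phi> x. T (\<phi> \<otimes>\<^sub>v x) = A \<phi> \<otimes>\<^sub>v B x))"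

lemma summable_on_square_int_shift:
  fixes f :: "int \<Rightarrow> 'a::real_normed_vector"
  assumes "(\<lambda>n. (norm (f n))\<^sup>2) summable_on UNIV"
  shows "(\<lambda>n. (norm (f (n + k)))\<^sup>2) summable_on UNIV"
proof -
  have "bij_betw (\<lambda>n. n + k) UNIV UNIV"
    by (rule bij_betwI[where g = "\<lambda>n. n - k"]) auto
  from summable_on_reindex_bij_betw[OF this, of "\<lambda>n. (norm (f n))\<^sup>2"] assms show ?thesis by simp
qed

lift_definition l2_shift :: "int \<Rightarrow> 'a::complex_inner l2 \<Rightarrow> 'a l2" is "\<lambda>k f n. f (n + k)"
  by (rule summable_on_square_int_shift)

lemma bounded_clinear_l2_shift: "bounded_clinear (l2_shift k)"
  unfolding bounded_clinear_def
proof (intro conjI allI bounded_linear_intro[where K = 1])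
  show "l2_shift k (f + g) = l2_shift k f + l2_shift k g" for f g :: "'a l2" by transfer simp
  show "l2_shift k (r *\<^sub>R f) = r *\<^sub>R l2_shift k f" for r and f :: "'a l2" by transfer simp
  show "l2_shift k (a *\<^sub>C f) = a *\<^sub>C l2_shift k f" for a and f :: "'a l2" by transfer simp
  show "norm (l2_shift k f) \<le> norm f * 1" for f :: "'a l2"
  proof -
    have "bij_betw (\<lambda>n. n + k) UNIV UNIV"
      by (rule bij_betwI[where g = "\<lambda>n. n - k"]) auto
    from infsum_reindex_bij_betw[OF this, of "\<lambda>n. (norm (l2_apply f n))\<^sup>2"]
    have "(norm (l2_shift k f))\<^sup>2 = (norm f)\<^sup>2" by (simp add: norm_l2_squared l2_shift.rep_eq)
    then show ?thesis by simp
  qed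
qed

lemma summable_on_square_laplacian:
  fixes f :: "int \<Rightarrow> 'a::complex_inner"
  assumes "(\<lambda>n. (norm (f n))\<^sup>2) summable_on UNIV"
  shows "(\<lambda>n. (norm (a *\<^sub>C (2 *\<^sub>C f n - f (n + 1) - f (n - 1))))\<^sup>2) summable_on UNIV"
proof (rule summable_on_square_scaleC)
  have "(\<lambda>n. (norm (2 *\<^sub>C f n + - f (n + 1) + - f (n + (- 1))))\<^sup>2) summable_on UNIV"
    using summable_on_square_int_shift[OF assms, of 1] summable_on_square_int_shift[OF assms, of "- 1"]
    by (intro summable_on_square_add summable_on_square_scaleC assms) auto
  then show "(\<lambda>n. (norm (2 *\<^sub>C f n - f (n + 1) - f (n - 1)))\<^sup>2) summable_on UNIV" by simp
qed

lemma bounded_clinear_l2_eqI: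
  fixes T U :: "'g::complex_inner l2 \<Rightarrow> 'b::complex_inner"
  assumes "bounded_clinear T" "bounded_clinear U" "\<And>\<phi> x. T (\<phi> \<otimes>\<^sub>v x) = U (\<phi> \<otimes>\<^sub>v x)"
  shows "T = U"
proof
  fix f :: "'g l2"
  define D where "D f = T f - U f" for f
  have D: "bounded_linear D"
    using assms(1,2) unfolding D_def bounded_clinear_def by (intro bounded_linear_sub) auto
  interpret D: bounded_linear D by (rule D)
  obtain C where C: "\<And>f. norm (D f) \<le> norm f * C" "C > 0" using D.pos_bounded by blast
  define \<delta> where "\<delta> n = to_l2 (\<lambda>m. if m = n then 1 else 0 :: complex)" for n :: int
  have \<delta>: "l2_apply (\<delta> n) = (\<lambda>m. if m = n then 1 else 0)" for n
  proof -
    have "(\<lambda>m. (cmod (if m = n then 1 else 0))\<^sup>2) summable_on UNIV"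
      by (rule finite_nonzero_values_imp_summable_on)
        (auto intro: finite_subset[of _ "{n}"])
    then show ?thesis by (simp add: \<delta>_def to_l2_inverse)
  qed
  define R where "R F = (\<Sum>n\<in>F. \<delta> n \<otimes>\<^sub>v l2_apply f n)" for F
  have DR: "D (R F) = 0" for F
    unfolding R_def by (simp add: D.sum) (simp add: D_def assms(3))
  have R: "l2_apply (R F) m = (if m \<in> F then l2_apply f m else 0)" if "finite F" for F m
    unfolding R_def using that
    by (induction F) (auto simp: zero_l2.rep_eq plus_l2.rep_eq tensor_l2.rep_eq \<delta>)
  have le: "norm (D f) \<le> C * e" if "e > 0" for e
  proof -
    obtain F where F: "finite F" and
      Fe: "dist (\<Sum>n\<in>F. (norm (l2_apply f n))\<^sup>2) (\<Sum>\<^sub>\<infinity>n. (norm (l2_apply f n))\<^sup>2) \<le> e\<^sup>2"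
      using infsum_finite_approximation[of "\<lambda>n. (norm (l2_apply f n))\<^sup>2" UNIV "e\<^sup>2"] l2_apply[of f]
        \<open>e > 0\<close> by auto
    have "(norm (f - R F))\<^sup>2 \<le> e\<^sup>2"
      unfolding norm_l2_squared[of "f - R F"]
    proof (rule infsum_le_finite_sums)
      show "(\<lambda>n. (norm (l2_apply (f - R F) n))\<^sup>2) summable_on UNIV" using l2_apply by blast
      fix G :: "int set" assume G: "finite G"
      have "(\<Sum>n\<in>G. (norm (l2_apply (f - R F) n))\<^sup>2)
          = (\<Sum>n\<in>G - F. (norm (l2_apply f n))\<^sup>2)"
        using G F by (intro sum.mono_neutral_cong_right) (auto simp: minus_l2.rep_eq R)
      also have "\<dots> = (\<Sum>n\<in>G \<union> F. (norm (l2_apply f n))\<^sup>2) - (\<Sum>n\<in>F. (norm (l2_apply f n))\<^sup>2)"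
        using G F sum_diff[of "G \<union> F" F "\<lambda>n. (norm (l2_apply f n))\<^sup>2"]
        by (simp add: Un_Diff)
      also have "\<dots> \<le> (norm f)\<^sup>2 - (\<Sum>n\<in>F. (norm (l2_apply f n))\<^sup>2)"
        using sum_le_norm_l2_squared[of "G \<union> F" f] F G by simp
      also have "\<dots> \<le> e\<^sup>2"
        using Fe by (simp add: norm_l2_squared dist_real_def abs_le_iff)
      finally show "(\<Sum>n\<in>G. (norm (l2_apply (f - R F) n))\<^sup>2) \<le> e\<^sup>2" .
    qed
    then have "norm (f - R F) \<le> e" using \<open>e > 0\<close> power2_le_imp_le by fastforce
    then have "norm (D (f - R F)) \<le> e * C"
      using C by (meson order_trans mult_right_mono less_imp_le)
    then show ?thesis by (simp add: D.diff DR mult.commute)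
  qed
  have "norm (D f) \<le> 0"
  proof (rule field_le_epsilon)
    fix e :: real assume "0 < e"
    with le[of "e / C"] C(2) show "norm (D f) \<le> 0 + e" by simp
  qed
  then show "T f = U f" by (simp add: D_def)
qed

lemma tensor_op_eqI:
  assumes "bounded_clinear T" "\<And>\<phi> x. T (\<phi> \<otimes>\<^sub>v x) = A \<phi> \<otimes>\<^sub>v B x"
  shows "A \<otimes>\<^sub>o B = T"
  unfolding tensor_op_def
proof (rule the_equality)
  show "bounded_clinear T \<and> (\<forall>\<phi> x. T (\<phi> \<otimes>\<^sub>v x) = A \<phi> \<otimes>\<^sub>v B x)"
    using assms by blast
  show "U = T" if "bounded_clinear U \<and> (\<forall>\<phi> x. U (\<phi> \<otimes>\<^sub>v x) = A \<phi> \<otimes>\<^sub>v B x)" for U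
    using that assms by (intro bounded_clinear_l2_eqI) simp_all
qed

lemma bounded_clinear_pointwise:
  fixes a :: "int \<Rightarrow> real"
  assumes B: "bounded_clinear B" and a: "\<And>n. \<bar>a n\<bar> \<le> b"
  shows "(\<lambda>n. (norm (complex_of_real (a n) *\<^sub>C B (l2_apply f n)))\<^sup>2) summable_on UNIV" (is ?S)
    and "bounded_clinear (\<lambda>f. to_l2 (\<lambda>n. complex_of_real (a n) *\<^sub>C B (l2_apply f n)))"
proof -
  let ?g = "\<lambda>f n. complex_of_real (a n) *\<^sub>C B (l2_apply f n)"
  interpret B: bounded_linear B using B by (simp add: bounded_clinear_def)
  obtain C where C: "\<And>x. norm (B x) \<le> norm x * C" "C > 0" using B.pos_bounded by blast
  have b: "0 \<le> b" using a[of 0] by linarith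
  have pt: "norm (?g f n) \<le> b * C * norm (l2_apply f n)" for f n
    using mult_mono[OF a[of n] C(1)[of "l2_apply f n"]] b by (simp add: norm_scaleC mult_ac)
  have sums: "(\<Sum>n\<in>F. (norm (?g f n))\<^sup>2) \<le> (b * C * norm f)\<^sup>2" if "finite F" for F f
  proof -
    have "(\<Sum>n\<in>F. (norm (?g f n))\<^sup>2) \<le> (\<Sum>n\<in>F. (b * C * norm (l2_apply f n))\<^sup>2)"
      by (intro sum_mono power_mono pt) auto
    also have "\<dots> \<le> (b * C * norm f)\<^sup>2"
      using sum_le_norm_l2_squared[OF that, of f]
      by (simp add: power_mult_distrib sum_distrib_left[symmetric] mult_left_mono)
    finally show ?thesis .
  qed
  have nn: "0 \<le> b * C * norm f" for f :: "'a l2" using b C(2) by simp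
  have mem: "(\<lambda>n. (norm (?g f n))\<^sup>2) summable_on UNIV" for f
    by (rule in_l2_bounded_sums(1)[OF sums nn])
  then show ?S .
  show "bounded_clinear (\<lambda>f. to_l2 (?g f))"
    unfolding bounded_clinear_def
  proof (intro conjI allI bounded_linear_intro[where K = "b * C"])
    show sc: "to_l2 (?g (c *\<^sub>C f)) = c *\<^sub>C to_l2 (?g f)" for c f
    proof (rule l2_apply_inject[THEN iffD1])
      have "l2_apply (to_l2 (?g (c *\<^sub>C f))) = ?g (c *\<^sub>C f)"
        by (rule to_l2_inverse) (use mem in simp)
      also have "\<dots> = (\<lambda>n. c *\<^sub>C ?g f n)"
        using B by (simp add: scaleC_l2.rep_eq bounded_clinear_def scaleC_scaleC mult.commute)
      also have "\<dots> = l2_apply (c *\<^sub>C to_l2 (?g f))"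
        using mem[of f] by (simp only: to_l2_inverse mem_Collect_eq scaleC_l2.rep_eq)
      finally show "l2_apply (to_l2 (?g (c *\<^sub>C f))) = l2_apply (c *\<^sub>C to_l2 (?g f))" .
    qed
    show "to_l2 (?g (r *\<^sub>R f)) = r *\<^sub>R to_l2 (?g f)" for r f
      unfolding scaleR_scaleC by (rule sc)
    show "to_l2 (?g (f + k)) = to_l2 (?g f) + to_l2 (?g k)" for f k
    proof (rule l2_apply_inject[THEN iffD1])
      have "l2_apply (to_l2 (?g (f + k))) = ?g (f + k)"
        by (rule to_l2_inverse) (use mem in simp)
      also have "\<dots> = (\<lambda>n. ?g f n + ?g k n)"
        by (simp add: plus_l2.rep_eq B.add scaleC_add_right)
      also have "\<dots> = l2_apply (to_l2 (?g f) + to_l2 (?g k))"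
        using mem[of f] mem[of k] by (simp only: to_l2_inverse mem_Collect_eq plus_l2.rep_eq)
      finally show "l2_apply (to_l2 (?g (f + k))) = l2_apply (to_l2 (?g f) + to_l2 (?g k))" .
    qed
    show "norm (to_l2 (?g f)) \<le> norm f * (b * C)" for f
      using in_l2_bounded_sums(2)[OF sums nn] by (simp add: mult_ac)
  qed
qed

section \<open>The Hamiltonian, the perturbation and the spectral shift function\<close>

lift_definition neg_laplacian :: "real \<Rightarrow> complex l2 \<Rightarrow> complex l2"
  is "\<lambda>h \<phi> n. complex_of_real (1 / h\<^sup>2) * (2 * \<phi> n - \<phi> (n + 1) - \<phi> (n - 1))"
  by (rule summable_on_square_laplacian[where 'a = complex, unfolded scaleC_complex_def])

definition H_Q :: "real \<Rightarrow> ('g::complex_inner \<Rightarrow> 'g) \<Rightarrow> 'g l2 \<Rightarrow> 'g l2"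
  where "H_Q h Q f = (neg_laplacian h \<otimes>\<^sub>o id) f + (id \<otimes>\<^sub>o Q) f"

definition thresholds :: "real \<Rightarrow> ('g::complex_inner \<Rightarrow> 'g) \<Rightarrow> real set"
  where "thresholds h Q = (if Q = (\<lambda>_. 0) then {0, 4 / h\<^sup>2}
    else (\<Union>\<mu>\<in>eigenvalues Q. {\<mu>, \<mu> + 4 / h\<^sup>2}))"

definition japanese_bracket :: "int \<Rightarrow> real"
  where "japanese_bracket n = (1 + (real_of_int n)\<^sup>2) powr (1 / 2)"

definition M_psi :: "real \<Rightarrow> complex l2 \<Rightarrow> complex l2"
  where "M_psi \<nu>\<^sub>0 \<phi> =
    to_l2 (\<lambda>n. complex_of_real (japanese_bracket n powr (- \<nu>\<^sub>0 / 2)) * l2_apply \<phi> n)"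

lemma tensor_op_multiplication:
  fixes B :: "'g::complex_inner \<Rightarrow> 'g"
  assumes B: "bounded_clinear B" and a: "\<And>n. \<bar>a n\<bar> \<le> b"
  shows "l2_apply (((\<lambda>\<phi>. to_l2 (\<lambda>n. complex_of_real (a n) * l2_apply \<phi> n)) \<otimes>\<^sub>o B) f) n
    = a n *\<^sub>R B (l2_apply f n)"
proof -
  have id: "bounded_clinear (id :: complex \<Rightarrow> complex)"
    by (simp add: bounded_clinear_def id_def)
  have "((\<lambda>\<phi>. to_l2 (\<lambda>n. complex_of_real (a n) * l2_apply \<phi> n)) \<otimes>\<^sub>o B)
      = (\<lambda>f. to_l2 (\<lambda>n. complex_of_real (a n) *\<^sub>C B (l2_apply f n)))"
  proof (rule tensor_op_eqI)
    fix \<phi> :: "complex l2" and x :: 'g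
    have "l2_apply (to_l2 (\<lambda>n. complex_of_real (a n) * l2_apply \<phi> n))
        = (\<lambda>n. complex_of_real (a n) * l2_apply \<phi> n)"
      by (rule to_l2_inverse)
        (use bounded_clinear_pointwise(1)[OF id a, where f = \<phi>] in \<open>simp add: scaleC_complex_def\<close>)
    moreover have "l2_apply (to_l2 (\<lambda>n. complex_of_real (a n) *\<^sub>C B (l2_apply (\<phi> \<otimes>\<^sub>v x) n)))
        = (\<lambda>n. complex_of_real (a n) *\<^sub>C B (l2_apply (\<phi> \<otimes>\<^sub>v x) n))"
      by (rule to_l2_inverse) (use bounded_clinear_pointwise(1)[OF B a] in simp)
    ultimately show "to_l2 (\<lambda>n. complex_of_real (a n) *\<^sub>C B (l2_apply (\<phi> \<otimes>\<^sub>v x) n))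
        = to_l2 (\<lambda>n. complex_of_real (a n) * l2_apply \<phi> n) \<otimes>\<^sub>v B x"
      using B by (intro l2_apply_inject[THEN iffD1])
        (auto simp: tensor_l2.rep_eq bounded_clinear_def scaleC_scaleC)
  qed (rule bounded_clinear_pointwise(2)[OF B a])
  then show ?thesis
    using bounded_clinear_pointwise(1)[OF B a, where f = f]
    by (simp add: to_l2_inverse scaleR_scaleC)
qed

lemma M_psi_tensor_apply:
  assumes "bounded_clinear B" "0 \<le> \<nu>\<^sub>0"
  shows "l2_apply ((M_psi \<nu>\<^sub>0 \<otimes>\<^sub>o B) f) n = japanese_bracket n powr (- \<nu>\<^sub>0 / 2) *\<^sub>R B (l2_apply f n)"
proof -
  have "\<bar>japanese_bracket n powr (- \<nu>\<^sub>0 / 2)\<bar> \<le> 1" for n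
  proof -
    have "1 \<le> japanese_bracket n"
      unfolding japanese_bracket_def by (rule ge_one_powr_ge_zero) auto
    then have "japanese_bracket n powr (- \<nu>\<^sub>0 / 2) \<le> japanese_bracket n powr 0"
      using assms(2) by (intro powr_mono) auto
    with \<open>1 \<le> japanese_bracket n\<close> show ?thesis by simp
  qed
  from tensor_op_multiplication[OF assms(1) this] show ?thesis
    by (simp add: M_psi_def[abs_def])
qed

lemma H_Q_apply:
  fixes f :: "'g::complex_inner l2"
  assumes Q: "bounded_clinear Q"
  shows "l2_apply (H_Q h Q f) n =
    (1 / h\<^sup>2) *\<^sub>R (2 *\<^sub>R l2_apply f n - l2_apply f (n + 1) - l2_apply f (n - 1)) + Q (l2_apply f n)"
proof -
  define L where "L f = complex_of_real (1 / h\<^sup>2) *\<^sub>C (2 *\<^sub>C f - l2_shift 1 f - l2_shift (- 1) f)"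
    for f :: "'g l2"
  have L: "l2_apply (L f) n = complex_of_real (1 / h\<^sup>2) *\<^sub>C
      (2 *\<^sub>C l2_apply f n - l2_apply f (n + 1) - l2_apply f (n - 1))" for n and f :: "'g l2"
    by (simp add: L_def l2_shift.rep_eq minus_l2.rep_eq scaleC_l2.rep_eq)
  have "neg_laplacian h \<otimes>\<^sub>o id = L"
  proof (rule tensor_op_eqI)
    have "bounded_linear L"
      using bounded_clinear_l2_shift[of 1, where 'a = 'g] bounded_clinear_l2_shift[of "- 1", where 'a = 'g]
      unfolding bounded_clinear_def L_def scaleC_2 scaleR_scaleC[symmetric]
      by (intro bounded_linear_compose[OF bounded_linear_scaleR_right] bounded_linear_sub
          bounded_linear_scaleR_right) auto
    moreover have "L (a *\<^sub>C f) = a *\<^sub>C L f" for a f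
      by (rule l2_eqI)
        (simp add: L scaleC_l2.rep_eq scaleC_scaleC mult.commute mult.left_commute
          complex_vector.scale_right_diff_distrib)
    ultimately show "bounded_clinear L" by (simp add: bounded_clinear_def)
    show "L (\<phi> \<otimes>\<^sub>v x) = neg_laplacian h \<phi> \<otimes>\<^sub>v id x" for \<phi> x
      by (rule l2_eqI)
        (simp only: L tensor_l2.rep_eq neg_laplacian.rep_eq scaleC_scaleC id_apply
          complex_vector.scale_left_diff_distrib complex_vector.scale_right_diff_distrib
          right_diff_distrib)
  qed
  moreover have "l2_apply ((id \<otimes>\<^sub>o Q) f) n = Q (l2_apply f n)"
  proof -
    have id: "(\<lambda>\<phi>. to_l2 (\<lambda>n. complex_of_real 1 * l2_apply \<phi> n)) = id"
      by (simp add: l2_apply_inverse fun_eq_iff)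
    have "\<bar>1\<bar> \<le> (1 :: real)" by simp
    from tensor_op_multiplication[OF Q this, of f n] show ?thesis unfolding id by simp
  qed
  ultimately show ?thesis
    unfolding H_Q_def plus_l2.rep_eq
    by (simp only: L scaleC_2 scaleR_scaleC[of "1 / h\<^sup>2"])
qed

text \<open>The weighted resolvent \<open>T(z)\<close> and its boundary value \<open>T(E + i0)\<close> in the Hilbert--Schmidt norm.\<close>

definition weighted_resolvent ::
    "('a::complex_inner \<Rightarrow> 'a) \<Rightarrow> ('a \<Rightarrow> 'a) \<Rightarrow> complex \<Rightarrow> 'a \<Rightarrow> 'a"
  where "weighted_resolvent H\<^sub>0 M z = M \<circ> resolvent H\<^sub>0 z \<circ> cadjoint M"

definition boundary_resolvent ::
    "('a::complex_inner \<Rightarrow> 'a) \<Rightarrow> ('a \<Rightarrow> 'a) \<Rightarrow> real \<Rightarrow> 'a \<Rightarrow> 'a"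
  where "boundary_resolvent H\<^sub>0 M E =
    (THE L. hs_tendsto (\<lambda>\<epsilon>. weighted_resolvent H\<^sub>0 M (Complex E \<epsilon>)) L (at_right 0))"

definition pencil :: "('a::complex_inner \<Rightarrow> 'a) \<Rightarrow> ('a \<Rightarrow> 'a) \<Rightarrow> real \<Rightarrow> real \<Rightarrow> 'a \<Rightarrow> 'a"
  where "pencil H\<^sub>0 M E t x = re_part (boundary_resolvent H\<^sub>0 M E) x
    + complex_of_real t *\<^sub>C im_part (boundary_resolvent H\<^sub>0 M E) x"

definition poisson_mean :: "(real \<Rightarrow> enat) \<Rightarrow> ereal"
  where "poisson_mean N =
    ereal (1 / pi) * enn2ereal (\<integral>\<^sup>+t. ennreal_of_enat (N t) * ennreal (1 / (1 + t\<^sup>2)) \<partial>lborel)"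

text \<open>The spectral shift function \<open>\<xi>(E; H, H\<^sub>0)\<close> for \<open>H = H\<^sub>0 \<plusminus> M\<^sup>* M\<close>, as its representative defined
  for each \<open>E\<close>; it takes extended real values, so that its finiteness is not presupposed.
  The two cases overlap only for \<open>M = 0\<close>.\<close>

definition ssf ::
    "('a::complex_inner \<Rightarrow> 'a) \<Rightarrow> ('a \<Rightarrow> 'a) \<Rightarrow> ('a \<Rightarrow> 'a) \<Rightarrow> real \<Rightarrow> ereal"
  where "ssf M H H\<^sub>0 E =
    (if H = (\<lambda>x. H\<^sub>0 x + cadjoint M (M x)) then poisson_mean (\<lambda>t. N_minus 1 (pencil H\<^sub>0 M E t))
     else if H = (\<lambda>x. H\<^sub>0 x - cadjoint M (M x)) then - poisson_mean (\<lambda>t. N_plus 1 (pencil H\<^sub>0 M E t))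
     else undefined)"

end

theory Submission
  imports Defs
begin

text \<open>
  In an orthonormal eigenbasis of \<open>Q\<close> the free resolvent is convolution by
  \<open>h\<^sup>2 u u^\<bar>n - m\<bar> / (1 - u\<^sup>2)\<close>, where \<open>u\<close> is the root in the unit disc of
  \<open>u + 1 / u = 2 - h\<^sup>2 (z - \<mu>)\<close>.  So \<open>T(z)\<close> is an absolutely convergent sum of rank one operators,
  and the boundary value \<open>T(E + i0)\<close> is obtained by inserting a root with \<open>\<bar>u\<bar> \<le> 1\<close>.

  Two observations give a bound that is uniform up to the thresholds \<open>u = \<plusminus> 1\<close>.  First,
  \<open>u (u^\<bar>n - m\<bar> - u^\<bar>n\<bar> u^\<bar>m\<bar>) / (1 - u\<^sup>2)\<close> is a geometric sum of modulus at most
  \<open>min \<bar>n\<bar> \<bar>m\<bar> \<le> sqrt (1 + \<bar>n\<bar>) sqrt (1 + \<bar>m\<bar>)\<close>, and these weights are summable against \<open>\<psi>\<close>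
  because \<open>\<nu>\<^sub>0 > 3\<close>; hence up to one rank per channel \<open>T(E + i0)\<close> has uniformly bounded trace norm.
  Second, the imaginary part has at most two ranks per channel.

  On the common kernel of these at most \<open>3 dim \<G>\<close> functionals the form of \<open>A + t B\<close> does not depend on
  \<open>t\<close> and its traces are bounded.  Orthonormal eigenvectors of \<open>\<plusminus> (A + t B)\<close> with eigenvalue above \<open>1\<close>
  can therefore not be more numerous than \<open>3 dim \<G>\<close> plus the trace bound, for all \<open>t\<close> and \<open>E\<close>.
\<close>

section \<open>Complex inner product spaces\<close>

text \<open>The obstacle is the factor \<open>1 / (1 - u\<^sup>2)\<close> of the resolvent kernel:
  it blows up as the energy approaches a threshold, so direct norm estimates of
  \<open>T(E + i0)\<close> are not uniform. A counting function changes only by an additive constant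
  under perturbations of bounded rank, which is why the singular part is confined to a fixed number
  of ranks and only the remainder is estimated. The hypothesis \<open>\<nu>\<^sub>0 > 3\<close> is
  the budget for kernel growth: each of the two lattice points may carry a weight growing like the
  square root of its modulus, and \<open>\<nu>\<^sub>0 / 2 - 1 / 2 > 1\<close> makes the weighted
  sums converge. The existence of \<open>T(E + i0)\<close> is arranged to fit the same budget, by
  estimating differences of powers of roots by the square root of the exponent instead of the
  exponent. Adjoints, square roots, projections and boundary values are definite descriptions and
  the resolvent is an \<open>inv\<close>, so each has to be identified through existence and
  uniqueness before an estimate can be applied to it.\<close>

instance complex_hilbert \<subseteq> banach ..

lemma cinner_add_left: "cinner (x + y) z = cinner x z + cinner (y::'a::complex_inner) z"
  by (metis cinner_commute cinner_add_right complex_cnj_add)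

lemma cinner_zero_right [simp]: "cinner x (0::'a::complex_inner) = 0"
  using cinner_add_right[of x 0 0] by simp

lemma cinner_zero_left [simp]: "cinner 0 (x::'a::complex_inner) = 0"
  by (metis cinner_commute cinner_zero_right complex_cnj_zero)

lemma cinner_minus_right [simp]: "cinner x (- (y::'a::complex_inner)) = - cinner x y"
  using cinner_add_right[of x y "- y"] by (simp add: add_eq_0_iff)

lemma cinner_diff_right: "cinner x (y - z) = cinner x y - cinner x (z::'a::complex_inner)"
  using cinner_add_right[of x y "- z"] by simp

lemma cinner_diff_left: "cinner (x - y) z = cinner x z - cinner (y::'a::complex_inner) z"
  using cinner_add_left[of "x - y" y z] by simp

lemma cinner_scaleR_right: "cinner x (r *\<^sub>R y) = r * cinner x (y::'a::complex_inner)"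
  by (simp add: scaleR_scaleC cinner_scaleC_right)

lemma cinner_scaleR_left: "cinner (r *\<^sub>R x) y = r * cinner x (y::'a::complex_inner)"
  by (simp add: scaleR_scaleC cinner_scaleC_left)

lemma cinner_sum_right: "cinner x (\<Sum>i\<in>F. f i) = (\<Sum>i\<in>F. cinner x (f i :: 'a::complex_inner))"
  by (induction F rule: infinite_finite_induct) (auto simp: cinner_add_right)

lemma cinner_sum_left: "cinner (\<Sum>i\<in>F. f i) x = (\<Sum>i\<in>F. cinner (f i) (x :: 'a::complex_inner))"
  by (induction F rule: infinite_finite_induct) (auto simp: cinner_add_left)

lemma cinner_self_eq_0 [simp]: "cinner x x = 0 \<longleftrightarrow> x = (0::'a::complex_inner)"
  by (simp add: cinner_self)

lemma cinner_eqI: "(\<And>y. cinner y x = cinner y z) \<Longrightarrow> x = (z::'a::complex_inner)"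
  by (metis cinner_diff_right cinner_self_eq_0 eq_iff_diff_eq_0)

lemma cmod_cinner_commute: "cmod (cinner x y) = cmod (cinner y (x::'a::complex_inner))"
  by (subst cinner_commute) simp

lemma cinner_bounded_clinear: "bounded_clinear (cinner (x::'a::complex_inner))"
  unfolding bounded_clinear_def
  by (auto intro!: bounded_linear_intro[where K = "norm x"] simp: cinner_add_right cinner_scaleR_right
      cinner_scaleC_right cmod_cinner_le scaleR_conv_of_real scaleC_complex_def mult.commute[of "norm _" "norm x"])

lemma bounded_linear_cinner_left: "bounded_linear (\<lambda>x. cinner x (y::'a::complex_inner))"
  by (auto intro!: bounded_linear_intro[where K = "norm y"] simp: cinner_add_left cinner_scaleR_left
      cmod_cinner_le scaleR_conv_of_real)

lemma bounded_linear_scaleC_right: "bounded_linear (scaleC a :: 'a::complex_inner \<Rightarrow> 'a)"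
  by (rule bounded_linear_intro[where K = "cmod a"])
    (auto simp: scaleC_add_right norm_scaleC scaleR_scaleC scaleC_scaleC mult.commute)

lemma bounded_clinearD:
  assumes "bounded_clinear T"
  shows "bounded_linear T" "T (a *\<^sub>C x) = a *\<^sub>C T x" "T (x + y) = T x + T y" "T (x - y) = T x - T y"
    "T 0 = 0" "T (- x) = - T x" "T (\<Sum>i\<in>F. f i) = (\<Sum>i\<in>F. T (f i))"
proof -
  show T: "bounded_linear T" using assms by (simp add: bounded_clinear_def)
  interpret bounded_linear T by (rule T)
  show "T (x + y) = T x + T y" "T (x - y) = T x - T y" "T 0 = 0" "T (- x) = - T x"
    "T (\<Sum>i\<in>F. f i) = (\<Sum>i\<in>F. T (f i))"
    by (simp_all add: add diff neg sum zero)
  show "T (a *\<^sub>C x) = a *\<^sub>C T x" using assms by (simp add: bounded_clinear_def)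
qed

lemma bounded_clinear_bound:
  assumes "bounded_clinear T"
  obtains C where "C > 0" "\<And>x. norm (T x) \<le> C * norm x"
  using bounded_linear.pos_bounded[OF bounded_clinearD(1)[OF assms]] by (auto simp: mult.commute)

lemma bounded_clinearI:
  assumes "\<And>x y. T (x + y) = T x + T y" "\<And>a x. T (a *\<^sub>C x) = a *\<^sub>C T x" "\<And>x. norm (T x) \<le> C * norm x"
  shows "bounded_clinear T"
  unfolding bounded_clinear_def
  by (auto intro!: bounded_linear_intro[where K = C] assms simp: scaleR_scaleC mult.commute[of "norm _" C])

lemma bounded_clinear_compose:
  "bounded_clinear S \<Longrightarrow> bounded_clinear T \<Longrightarrow> bounded_clinear (S \<circ> T)"
  unfolding bounded_clinear_def by (auto simp: o_def intro: bounded_linear_compose)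

lemma bounded_clinear_add:
  "bounded_clinear S \<Longrightarrow> bounded_clinear T \<Longrightarrow> bounded_clinear (\<lambda>x. S x + T x)"
  unfolding bounded_clinear_def by (auto simp: scaleC_add_right intro: bounded_linear_add)

lemma bounded_clinear_diff:
  "bounded_clinear S \<Longrightarrow> bounded_clinear T \<Longrightarrow> bounded_clinear (\<lambda>x. S x - T x)"
  unfolding bounded_clinear_def
  by (auto simp: complex_vector.scale_right_diff_distrib intro: bounded_linear_sub)

lemma bounded_clinear_scaleC: "bounded_clinear T \<Longrightarrow> bounded_clinear (\<lambda>x. a *\<^sub>C T x)"
  unfolding bounded_clinear_def
  by (auto simp: scaleC_scaleC mult.commute intro: bounded_linear_compose[OF bounded_linear_scaleC_right])

lemma bounded_clinear_id: "bounded_clinear (\<lambda>x. x)"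
  by (simp add: bounded_clinear_def)

section \<open>Formal adjoints and the Riesz representation theorem\<close>

lemma cadjoint_eqI:
  fixes T :: "'a::complex_inner \<Rightarrow> 'b::complex_inner"
  assumes "\<And>x y. cinner (S y) x = cinner y (T x)"
  shows "cadjoint T = S"
  unfolding cadjoint_def
proof (rule the_equality)
  fix U assume U: "\<forall>x y. cinner (U y) x = cinner y (T x)"
  show "U = S"
  proof
    fix y
    show "U y = S y"
      by (rule cinner_eqI) (metis U assms cinner_commute)
  qed
qed (use assms in blast)

text \<open>Testing the adjoint relation at \<open>x = S y\<close> bounds the square of
  \<open>norm (S y)\<close> by \<open>norm y * (C * norm (S y))\<close>, and one factor
  cancels.\<close>

lemma norm_adjoint_le:
  fixes T :: "'a::complex_inner \<Rightarrow> 'b::complex_inner"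
  assumes "\<And>x y. cinner (S y) x = cinner y (T x)" "\<And>x. norm (T x) \<le> C * norm x" "0 \<le> C"
  shows "norm (S y) \<le> C * norm y"
proof -
  have "(norm (S y))\<^sup>2 = cmod (cinner (S y) (S y))" by (simp add: cinner_self norm_power)
  also have "\<dots> = cmod (cinner y (T (S y)))" by (simp add: assms(1))
  also have "\<dots> \<le> norm y * (C * norm (S y))"
    using cmod_cinner_le[of y "T (S y)"] assms(2)[of "S y"] by (meson mult_left_mono norm_ge_zero order_trans)
  finally have "norm (S y) * norm (S y) \<le> (C * norm y) * norm (S y)"
    by (simp add: power2_eq_square mult_ac)
  then show ?thesis using assms(3)
    by (cases "S y = 0") (auto intro: mult_right_le_imp_le[of _ "norm (S y)"])
qed

text \<open>If \<open>\<phi>\<close> is \<open>cinner y\<close>, then \<open>J x\<close> is the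
  squared distance from \<open>x\<close> to \<open>y\<close> minus a constant. The representing
  vector is therefore sought as a minimiser of \<open>J\<close>; completeness supplies the limit of
  a minimising sequence.\<close>

lemma riesz_representation:
  fixes \<phi> :: "'a::complex_hilbert \<Rightarrow> complex"
  assumes \<phi>: "bounded_clinear \<phi>"
  obtains y where "\<And>x. \<phi> x = cinner y x"
proof -
  note lin = bounded_clinearD[OF \<phi>]
  obtain C where C: "C > 0" "\<And>x. norm (\<phi> x) \<le> C * norm x" using bounded_clinear_bound[OF \<phi>] by blast
  define J where "J x = (norm x)\<^sup>2 - 2 * Re (\<phi> x)" for x
  have J_ge: "- C\<^sup>2 \<le> J x" for x
  proof -
    have "Re (\<phi> x) \<le> C * norm x" using C(2)[of x] complex_Re_le_cmod[of "\<phi> x"] by linarith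
    moreover have "0 \<le> (norm x - C)\<^sup>2" by simp
    ultimately show ?thesis unfolding J_def by (simp add: power2_diff mult_ac)
  qed
  define m where "m = Inf (range J)"
  have bdd: "bdd_below (range J)" using J_ge by (intro bdd_belowI2)
  have m_le: "m \<le> J x" for x unfolding m_def using bdd by (intro cInf_lower) auto
  have "\<exists>x. J x < m + inverse (real (Suc n))" for n
    using cInf_lessD[of "range J" "m + inverse (real (Suc n))"] by (auto simp: m_def)
  then obtain X where X: "\<And>n. J (X n) < m + inverse (real (Suc n))" by metis
  \<comment> \<open>The value of \<open>J\<close> at the midpoint is at least \<open>m\<close>; with
    the parallelogram law, the distance of two near-minimisers is bounded by their excess over
    \<open>m\<close>.\<close>
  have par: "(norm (x - y))\<^sup>2 \<le> 2 * (J x - m) + 2 * (J y - m)" for x y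
  proof -
    have "m \<le> J ((1/2) *\<^sub>R (x + y))" by (rule m_le)
    also have "J ((1/2) *\<^sub>R (x + y)) = (norm (x + y))\<^sup>2 / 4 - Re (\<phi> x) - Re (\<phi> y)"
    proof -
      have "\<phi> ((1/2) *\<^sub>R (x + y)) = (\<phi> x + \<phi> y) / 2"
        unfolding scaleR_scaleC lin(2) scaleC_complex_def lin(3) by simp
      then show ?thesis by (simp only: J_def norm_scaleR) (simp add: power_mult_distrib power_divide add_divide_distrib)
    qed
    finally have "m \<le> (norm (x + y))\<^sup>2 / 4 - Re (\<phi> x) - Re (\<phi> y)" .
    moreover have "(norm (x - y))\<^sup>2 + (norm (x + y))\<^sup>2 = 2 * (norm x)\<^sup>2 + 2 * (norm y)\<^sup>2"
      by (simp add: power2_norm_eq_inner algebra_simps inner_commute)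
    ultimately show ?thesis unfolding J_def by argo
  qed
  have "Cauchy X"
  proof (rule metric_CauchyI)
    fix e :: real assume e: "0 < e"
    obtain N where N: "inverse (real (Suc N)) < e\<^sup>2 / 4"
      using reals_Archimedean[of "e\<^sup>2 / 4"] e by auto
    have "dist (X i) (X j) < e" if "i \<ge> N" "j \<ge> N" for i j
    proof -
      have le: "J (X k) - m < e\<^sup>2 / 4" if "k \<ge> N" for k
      proof -
        have "inverse (real (Suc k)) \<le> inverse (real (Suc N))" using that by (simp add: field_simps)
        then show ?thesis using X[of k] N by linarith
      qed
      have "(norm (X i - X j))\<^sup>2 < e\<^sup>2"
        using par[of "X i" "X j"] le[OF that(1)] le[OF that(2)] by argo
      then show ?thesis using e by (simp add: dist_norm power2_less_imp_less)
    qed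
    then show "\<exists>N. \<forall>i\<ge>N. \<forall>j\<ge>N. dist (X i) (X j) < e" by blast
  qed
  then obtain y where y: "X \<longlonglongrightarrow> y" using Cauchy_convergent convergent_def by blast
  have "(\<lambda>n. J (X n)) \<longlonglongrightarrow> J y"
    unfolding J_def by (intro tendsto_intros y bounded_linear.tendsto[OF lin(1)])
  moreover have "(\<lambda>n. m + inverse (real (Suc n))) \<longlonglongrightarrow> m + 0"
    by (intro tendsto_intros LIMSEQ_inverse_real_of_nat)
  ultimately have "J y \<le> m"
    using X by (intro LIMSEQ_le[of "\<lambda>n. J (X n)" _ "\<lambda>n. m + inverse (real (Suc n))"]) (auto intro!: exI[of _ 0] less_imp_le)
  then have min: "J y \<le> J x" for x using m_le[of x] by linarith
  have Re: "Re (cinner y x) = Re (\<phi> x)" for x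
  proof (rule ccontr)
    assume ne: "Re (cinner y x) \<noteq> Re (\<phi> x)"
    define d where "d = Re (cinner y x) - Re (\<phi> x)"
    have d: "0 \<le> t\<^sup>2 * (norm x)\<^sup>2 + 2 * t * d" for t
    proof -
      have "(norm (y + t *\<^sub>R x))\<^sup>2 = (norm y)\<^sup>2 + 2 * t * Re (cinner y x) + t\<^sup>2 * (norm x)\<^sup>2"
        unfolding inner_eq_Re_cinner[symmetric] power2_norm_eq_inner
        by (simp add: algebra_simps inner_commute power2_eq_square)
      moreover have "Re (\<phi> (y + t *\<^sub>R x)) = Re (\<phi> y) + t * Re (\<phi> x)"
        by (simp add: lin scaleR_scaleC scaleC_complex_def)
      ultimately have "J (y + t *\<^sub>R x) = J y + t\<^sup>2 * (norm x)\<^sup>2 + 2 * t * d"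
        by (simp add: J_def d_def algebra_simps)
      then show ?thesis using min[of "y + t *\<^sub>R x"] by linarith
    qed
    have "0 < d\<^sup>2" using ne by (simp add: d_def)
    \<comment> \<open>At \<open>t = - d / N\<close> the linear term \<open>- 2 * d^2 / N\<close>
      beats the quadratic term, which is at most \<open>d^2 / N\<close>. The summand 1 keeps
      \<open>N\<close> positive when \<open>x = 0\<close>.\<close>
    define N where "N = (norm x)\<^sup>2 + 1"
    have N: "N \<ge> 1" "(norm x)\<^sup>2 < N" by (auto simp: N_def)
    have "(d / N)\<^sup>2 * (norm x)\<^sup>2 \<le> (d / N)\<^sup>2 * N" using N by (intro mult_left_mono) auto
    also have "(d / N)\<^sup>2 * N = d\<^sup>2 / N" using N by (simp add: power2_eq_square)
    finally have "0 \<le> d\<^sup>2 / N - 2 * (d\<^sup>2 / N)"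
      using d[of "- d / N"] by (simp add: power2_eq_square)
    moreover have "0 < d\<^sup>2 / N" using \<open>0 < d\<^sup>2\<close> N by simp
    ultimately show False by linarith
  qed
  \<comment> \<open>Complex linearity turns the real part at \<open>(- \<i>) *\<^sub>C x\<close>
    into the imaginary part at \<open>x\<close>.\<close>
  have "\<phi> x = cinner y x" for x
    using Re[of x] Re[of "(- \<i>) *\<^sub>C x"]
    by (simp only: lin cinner_scaleC_right scaleC_complex_def) (auto simp: complex_eq_iff)
  then show ?thesis by (rule that)
qed

lemma cadjoint_ex:
  fixes T :: "'a::complex_hilbert \<Rightarrow> 'b::complex_inner"
  assumes T: "bounded_clinear T"
  shows cinner_cadjoint_left: "cinner (cadjoint T y) x = cinner y (T x)"
    and bounded_clinear_cadjoint: "bounded_clinear (cadjoint T)"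
proof -
  have "\<exists>z. \<forall>x. cinner y (T x) = cinner z x" for y
    using riesz_representation[OF bounded_clinear_compose[OF cinner_bounded_clinear[of y] T]]
    by (metis comp_apply)
  then obtain S where S: "\<And>x y. cinner (S y) x = cinner y (T x)" by metis
  have eq: "cadjoint T = S" by (rule cadjoint_eqI) (rule S)
  show "cinner (cadjoint T y) x = cinner y (T x)" by (simp add: eq S)
  obtain C where C: "C > 0" "\<And>x. norm (T x) \<le> C * norm x" using bounded_clinear_bound[OF T] by blast
  show "bounded_clinear (cadjoint T)" unfolding eq
  proof (rule bounded_clinearI)
    show "S (x + y) = S x + S y" for x y
      by (rule cinner_eqI, subst (1 2) cinner_commute) (simp add: S cinner_add_left cinner_add_right)
    show "S (a *\<^sub>C x) = a *\<^sub>C S x" for a x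
      by (rule cinner_eqI, subst (1 2) cinner_commute) (simp add: S cinner_scaleC_left)
    show "norm (S x) \<le> C * norm x" for x by (rule norm_adjoint_le[OF S C(2)]) (use C in auto)
  qed
qed

lemma cinner_cadjoint_right:
  fixes T :: "'a::complex_hilbert \<Rightarrow> 'b::complex_inner"
  assumes "bounded_clinear T"
  shows "cinner x (cadjoint T y) = cinner (T x) y"
  by (metis assms cinner_cadjoint_left cinner_commute)

section \<open>Orthonormal sets\<close>

definition orthonormal :: "'a::complex_inner set \<Rightarrow> bool"
  where "orthonormal E \<longleftrightarrow> (\<forall>e\<in>E. \<forall>f\<in>E. cinner e f = (if e = f then 1 else 0))"

text \<open>For finite orthonormal \<open>F\<close> this is the orthogonal projection onto the span
  of \<open>F\<close>; for infinite \<open>F\<close> the sum has the default value 0.\<close>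

definition fourier_sum :: "'a::complex_inner set \<Rightarrow> 'a \<Rightarrow> 'a"
  where "fourier_sum F x = (\<Sum>e\<in>F. cinner e x *\<^sub>C e)"

lemma orthonormal_subset: "orthonormal E \<Longrightarrow> F \<subseteq> E \<Longrightarrow> orthonormal F"
  unfolding orthonormal_def by (meson subsetD)

lemma orthonormal_norm:
  assumes "orthonormal E" "e \<in> E"
  shows "norm e = 1"
proof -
  have "(norm e)\<^sup>2 = 1\<^sup>2"
    using cinner_self[of e] assms by (simp add: orthonormal_def del: of_real_power)
  then show ?thesis by (metis abs_norm_cancel abs_1 power2_eq_iff_nonneg norm_ge_zero zero_le_one)
qed

lemma fourier_sum_in_span: "fourier_sum F x \<in> complex_vector.span F"
  unfolding fourier_sum_def
  by (intro complex_vector.span_sum complex_vector.span_scale complex_vector.span_base)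

lemma cinner_fourier_sum_orthonormal:
  assumes "finite F" "orthonormal F" "e \<in> F"
  shows "cinner e (\<Sum>f\<in>F. c f *\<^sub>C f) = c e"
proof -
  have "cinner e (\<Sum>f\<in>F. c f *\<^sub>C f) = (\<Sum>f\<in>F. if f = e then c e else 0)"
    unfolding cinner_sum_right cinner_scaleC_right using assms
    by (intro sum.cong) (auto simp: orthonormal_def)
  then show ?thesis using assms by simp
qed

lemma fourier_residual_orthogonal:
  assumes "finite F" "orthonormal F"
  shows "e \<in> F \<Longrightarrow> cinner e (x - fourier_sum F x) = 0"
    and "w \<in> complex_vector.span F \<Longrightarrow> cinner w (x - fourier_sum F x) = 0"
proof -
  show *: "cinner e (x - fourier_sum F x) = 0" if "e \<in> F" for e
    using cinner_fourier_sum_orthonormal[OF assms that, of "\<lambda>e. cinner e x"]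
    by (simp add: cinner_diff_right fourier_sum_def)
  show "cinner w (x - fourier_sum F x) = 0" if "w \<in> complex_vector.span F"
    using that
    by (induction rule: complex_vector.span_induct_alt)
      (auto simp: cinner_add_left cinner_scaleC_left *)
qed

lemma norm_sum_orthonormal:
  assumes "finite F" "orthonormal F"
  shows "(norm (\<Sum>f\<in>F. c f *\<^sub>C f))\<^sup>2 = (\<Sum>f\<in>F. (cmod (c f))\<^sup>2)"
proof -
  have "complex_of_real ((norm (\<Sum>f\<in>F. c f *\<^sub>C f))\<^sup>2) = (\<Sum>e\<in>F. cnj (c e) * c e)"
    unfolding cinner_self[symmetric]
    by (subst cinner_sum_left) (simp add: cinner_scaleC_left cinner_fourier_sum_orthonormal[OF assms])
  also have "\<dots> = complex_of_real (\<Sum>f\<in>F. (cmod (c f))\<^sup>2)"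
    by (simp add: mult.commute[of "cnj _"] complex_norm_square del: of_real_power)
  finally show ?thesis using of_real_eq_iff by blast
qed

text \<open>Pythagoras: the residual is orthogonal to the span, in which
  \<open>fourier_sum F x - w\<close> lies. This makes the Fourier sum the best approximation from
  the span, and \<open>w = 0\<close> leads to Bessel's inequality.\<close>

lemma norm_fourier_decomposition:
  assumes "finite F" "orthonormal F" "w \<in> complex_vector.span F"
  shows "(norm (x - w))\<^sup>2 = (norm (x - fourier_sum F x))\<^sup>2 + (norm (fourier_sum F x - w))\<^sup>2"
proof -
  let ?p = "fourier_sum F x"
  have "?p - w \<in> complex_vector.span F"
    by (intro complex_vector.span_diff fourier_sum_in_span assms)
  then have 0: "inner (?p - w) (x - ?p) = 0"
    by (simp add: inner_eq_Re_cinner fourier_residual_orthogonal(2)[OF assms(1,2)])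
  have "x - w = (x - ?p) + (?p - w)" by simp
  then show ?thesis
    unfolding power2_norm_eq_inner \<open>x - w = (x - ?p) + (?p - w)\<close>
    using 0 by (simp only: inner_add_left inner_add_right inner_commute[of "x - ?p" "?p - w"])
qed

lemma fourier_sum_eq_self:
  assumes "finite F" "orthonormal F" "x \<in> complex_vector.span F"
  shows "fourier_sum F x = x"
  using norm_fourier_decomposition[OF assms, of x]
  by (simp add: add_nonneg_eq_0_iff)

lemma bessel_inequality:
  assumes "finite F" "orthonormal F"
  shows "(\<Sum>e\<in>F. (cmod (cinner e x))\<^sup>2) \<le> (norm x)\<^sup>2"
proof -
  have "(norm x)\<^sup>2 = (norm (x - fourier_sum F x))\<^sup>2 + (norm (fourier_sum F x))\<^sup>2"
    using norm_fourier_decomposition[OF assms, of 0 x] by (simp add: complex_vector.span_zero)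
  then show ?thesis
    using norm_sum_orthonormal[OF assms, of "\<lambda>e. cinner e x"] by (simp add: fourier_sum_def)
qed

section \<open>Maximal orthonormal sets and codimension counts\<close>

lemma orthonormal_independent:
  assumes "orthonormal E"
  shows "complex_vector.independent E"
  unfolding complex_vector.independent_explicit_module
proof (intro allI impI)
  fix t u v
  assume t: "finite t" "t \<subseteq> E" "(\<Sum>v\<in>t. u v *\<^sub>C v) = 0" "v \<in> t"
  from cinner_fourier_sum_orthonormal[OF t(1) orthonormal_subset[OF assms t(2)] t(4), of u] t(3)
  show "u v = 0" by simp
qed

lemma orthonormal_insert:
  assumes "orthonormal C" "\<And>e. e \<in> C \<Longrightarrow> cinner e y = 0" "y \<noteq> 0"
  shows "orthonormal (insert (complex_of_real (1 / norm y) *\<^sub>C y) C)"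
    and "complex_of_real (1 / norm y) *\<^sub>C y \<notin> C"
proof -
  let ?y = "complex_of_real (1 / norm y) *\<^sub>C y"
  have 1: "cinner ?y ?y = 1"
    using assms(3) by (simp add: cinner_self norm_scaleC norm_divide)
  have 0: "cinner e ?y = 0" "cinner ?y e = 0" if "e \<in> C" for e
  proof -
    show "cinner e ?y = 0" using assms(2)[OF that] by (simp add: cinner_scaleC_right)
    then show "cinner ?y e = 0" by (metis cinner_commute complex_cnj_zero)
  qed
  show "?y \<notin> C" using 0 1 by force
  with 0 1 assms(1) show "orthonormal (insert ?y C)" unfolding orthonormal_def by auto
qed

text \<open>Gram-Schmidt for sets such as a union of eigenspaces, which is not closed under addition
  but is closed under residuals and scaling. For a \<open>C\<close> of greatest cardinality a
  nonzero residual could be normalised and adjoined, so all residuals vanish.\<close>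

lemma maximal_orthonormal:
  fixes X :: "'a::complex_inner set"
  assumes bound: "\<And>C. finite C \<Longrightarrow> orthonormal C \<Longrightarrow> C \<subseteq> X \<Longrightarrow> card C \<le> N"
    and residual: "\<And>C x. finite C \<Longrightarrow> orthonormal C \<Longrightarrow> C \<subseteq> X \<Longrightarrow> x \<in> X \<Longrightarrow> x - fourier_sum C x \<in> X"
    and scale: "\<And>a x. x \<in> X \<Longrightarrow> a *\<^sub>C x \<in> X"
  obtains C where "finite C" "orthonormal C" "C \<subseteq> X" "card C \<le> N" "X \<subseteq> complex_vector.span C"
proof -
  define P where "P k \<longleftrightarrow> (\<exists>C. finite C \<and> orthonormal C \<and> C \<subseteq> X \<and> card C = k)" for k
  have "P 0" unfolding P_def by (rule exI[of _ "{}"]) (auto simp: orthonormal_def)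
  define k where "k = Greatest P"
  have le: "\<And>j. P j \<Longrightarrow> j \<le> N" using bound unfolding P_def by auto
  have k: "P k" "\<And>j. P j \<Longrightarrow> j \<le> k"
    using GreatestI_nat[of P 0 N] Greatest_le_nat[of P _ N] \<open>P 0\<close> le unfolding k_def by auto
  from k(1) obtain C where C: "finite C" "orthonormal C" "C \<subseteq> X" "card C = k" unfolding P_def by blast
  have "X \<subseteq> complex_vector.span C"
  proof
    fix x assume x: "x \<in> X"
    define y where "y = x - fourier_sum C x"
    have "y = 0"
    proof (rule ccontr)
      assume "y \<noteq> 0"
      have y: "y \<in> X" unfolding y_def by (rule residual[OF C(1-3) x])
      have "cinner e y = 0" if "e \<in> C" for e
        unfolding y_def using fourier_residual_orthogonal(1)[OF C(1,2) that] .
      note ins = orthonormal_insert[OF C(2) this \<open>y \<noteq> 0\<close>]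
      have "card (insert (complex_of_real (1 / norm y) *\<^sub>C y) C) = Suc k"
        using ins(2) C(1,4) by simp
      moreover have "insert (complex_of_real (1 / norm y) *\<^sub>C y) C \<subseteq> X"
        using C(3) scale[OF y] by blast
      ultimately have "P (Suc k)" unfolding P_def using ins(1) C(1) by blast
      then show False using k(2) by fastforce
    qed
    then have "x = fourier_sum C x" by (simp add: y_def)
    then show "x \<in> complex_vector.span C" using fourier_sum_in_span[of C x] by simp
  qed
  with C show ?thesis using that bound by blast
qed

lemma orthonormal_basis_of_subspace:
  assumes W: "complex_vector.subspace W" and T: "finite T" "W \<subseteq> complex_vector.span T"
  obtains C where "finite C" "orthonormal C" "C \<subseteq> W" "complex_vector.span C = W"
proof -
  have a: "card C \<le> card T" if "finite C" "orthonormal C" "C \<subseteq> W" for C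
    using complex_vector.independent_span_bound[OF T(1) orthonormal_independent[OF that(2)]] that T by blast
  have b: "x - fourier_sum C x \<in> W" if "finite C" "orthonormal C" "C \<subseteq> W" "x \<in> W" for C x
    using complex_vector.span_minimal[OF that(3) W] fourier_sum_in_span[of C x]
      complex_vector.subspace_diff[OF W that(4)] by blast
  have c: "a *\<^sub>C x \<in> W" if "x \<in> W" for a x by (rule complex_vector.subspace_scale[OF W that])
  obtain C where C: "finite C" "orthonormal C" "C \<subseteq> W" "W \<subseteq> complex_vector.span C"
    by (rule maximal_orthonormal[of W "card T", OF a b c])
  then have "complex_vector.span C = W" using complex_vector.span_minimal[OF C(3) W] by auto
  with C show ?thesis using that by blast
qed

text \<open>Each functional lowers the dimension by at most one. An orthonormal family of
  eigenvectors can thus be traded for one on which finitely many functionals vanish, at the cost of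
  \<open>card I\<close> members.\<close>

lemma orthonormal_in_kernel:
  fixes l :: "'i \<Rightarrow> 'a::complex_inner \<Rightarrow> complex"
  assumes B: "finite B" "orthonormal B"
    and l: "finite I" "\<And>i x y. i \<in> I \<Longrightarrow> l i (x + y) = l i x + l i y" "\<And>i a x. i \<in> I \<Longrightarrow> l i (a *\<^sub>C x) = a * l i x"
  obtains C where "finite C" "orthonormal C" "C \<subseteq> complex_vector.span B"
    "\<forall>x\<in>C. \<forall>i\<in>I. l i x = 0" "card B \<le> card C + card I"
proof -
  have "\<exists>C. finite C \<and> orthonormal C \<and> C \<subseteq> complex_vector.span B \<and>
    (\<forall>x\<in>C. \<forall>i\<in>I. l i x = 0) \<and> card B \<le> card C + card I"
    using l
  proof (induction I rule: finite_induct)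
    case empty
    then show ?case using B complex_vector.span_superset by (intro exI[of _ B]) auto
  next
    case (insert j I)
    then obtain C where C: "finite C" "orthonormal C" "C \<subseteq> complex_vector.span B"
      "\<And>x i. x \<in> C \<Longrightarrow> i \<in> I \<Longrightarrow> l i x = 0" "card B \<le> card C + card I" by auto
    have add: "l i (x + y) = l i x + l i y" and sc: "l i (a *\<^sub>C x) = a * l i x"
      if "i \<in> insert j I" for i a x y using insert.prems that by auto
    have zero: "l i 0 = 0" if "i \<in> insert j I" for i using sc[OF that, of 0 0] by simp
    define W where "W = {x \<in> complex_vector.span C. l j x = 0}"
    have W: "complex_vector.subspace W"
      unfolding W_def
      by (rule complex_vector.subspaceI)
        (auto simp: add sc zero complex_vector.span_zero complex_vector.span_add complex_vector.span_scale)
    obtain D where D: "finite D" "orthonormal D" "D \<subseteq> W" "complex_vector.span D = W"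
      using orthonormal_basis_of_subspace[OF W C(1)] unfolding W_def by blast
    have I0: "l i x = 0" if "x \<in> complex_vector.span C" "i \<in> I" for x i
      using that(1) by (induction rule: complex_vector.span_induct_alt) (use that(2) C(4) in \<open>auto simp: add sc zero\<close>)
    have "card C \<le> card D + 1"
    proof (cases "\<forall>x\<in>complex_vector.span C. l j x = 0")
      case True
      then have "C \<subseteq> complex_vector.span D"
        unfolding D(4) W_def using complex_vector.span_superset by auto
      from complex_vector.independent_span_bound[OF D(1) orthonormal_independent[OF C(2)] this]
      show ?thesis by simp
    next
      case False
      then obtain x0 where x0: "x0 \<in> complex_vector.span C" "l j x0 \<noteq> 0" by blast
      \<comment> \<open>A single vector \<open>x0\<close> off the kernel complements it: subtracting
        the multiple of \<open>x0\<close> with the same value of \<open>l j\<close> moves any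
        \<open>x\<close> into \<open>W\<close>.\<close>
      have "C \<subseteq> complex_vector.span (insert x0 D)"
      proof
        fix x assume x: "x \<in> C"
        define c where "c = l j x / l j x0"
        have "x + (- c) *\<^sub>C x0 \<in> W"
          unfolding W_def using x x0
          by (auto simp del: complex_vector.scale_minus_left simp: add sc c_def complex_vector.span_base intro!: complex_vector.span_add complex_vector.span_scale)
        then show "x \<in> complex_vector.span (insert x0 D)"
          unfolding complex_vector.span_insert D(4) by (auto intro!: exI[of _ c])
      qed
      from complex_vector.independent_span_bound[OF _ orthonormal_independent[OF C(2)] this] D(1)
      have "card C \<le> card (insert x0 D)" by simp
      also have "\<dots> \<le> card D + 1" using card_insert_le_m1 D(1) by (simp add: card_insert_if)
      finally show ?thesis .
    qed
    moreover have "D \<subseteq> complex_vector.span B"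
      using D(3) C(3) complex_vector.span_minimal[OF C(3)] unfolding W_def by auto
    moreover have "\<forall>x\<in>D. \<forall>i\<in>insert j I. l i x = 0" using D(3) I0 unfolding W_def by auto
    ultimately show ?case using D C insert.hyps by (intro exI[of _ D]) auto
  qed
  then show ?thesis using that by blast
qed

section \<open>Infinite sums\<close>

lemma has_sum_sum:
  fixes f :: "'i \<Rightarrow> 'b \<Rightarrow> 'c::topological_ab_group_add"
  assumes "\<And>i. i \<in> F \<Longrightarrow> (f i has_sum s i) A"
  shows "((\<lambda>x. \<Sum>i\<in>F. f i x) has_sum (\<Sum>i\<in>F. s i)) A"
  using assms by (induction F rule: infinite_finite_induct) (auto intro: has_sum_add)

lemma infsum_bounded_linear:
  assumes "bounded_linear h" "f summable_on A"
  shows "infsum (\<lambda>x. h (f x)) A = h (infsum f A)"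
  by (rule infsumI[OF has_sum_bounded_linear[OF assms(1) has_sum_infsum[OF assms(2)]]])

lemma has_sum_nonneg_product:
  fixes f :: "'a \<Rightarrow> real" and g :: "'b \<Rightarrow> real"
  assumes f: "(f has_sum s) A" "\<And>x. x \<in> A \<Longrightarrow> 0 \<le> f x" and g: "(g has_sum t) B" "\<And>y. y \<in> B \<Longrightarrow> 0 \<le> g y"
  shows "((\<lambda>(x, y). f x * g y) has_sum (s * t)) (A \<times> B)"
proof (rule has_sum_SigmaI)
  show inner: "((\<lambda>y. case (x, y) of (x, y) \<Rightarrow> f x * g y) has_sum f x * t) B" for x
    using has_sum_cmult_right[OF g(1), of "f x"] by simp
  show outer: "((\<lambda>x. f x * t) has_sum s * t) A" by (rule has_sum_cmult_left[OF f(1)])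
  show "(\<lambda>(x, y). f x * g y) summable_on A \<times> B"
    by (rule summable_on_SigmaI[OF inner has_sum_imp_summable[OF outer]]) (auto simp: f g)
qed

lemma infsum_single:
  fixes f :: "'a \<Rightarrow> 'b::{comm_monoid_add, t2_space}"
  assumes "\<And>x. x \<noteq> a \<Longrightarrow> f x = 0"
  shows "infsum f UNIV = f a"
proof -
  have "infsum f UNIV = infsum f {a}" by (rule infsum_cong_neutral) (auto simp: assms)
  then show ?thesis by simp
qed

section \<open>Hilbert--Schmidt operators\<close>

text \<open>Bessel's inequality is one half. For the other, a point of the dense span close to
  \<open>x\<close> involves finitely many basis vectors, and the Fourier sum over these is at least
  as close.\<close>

lemma parseval:
  fixes x :: "'a::complex_inner"
  assumes E: "orthonormal_basis E"
  shows "((\<lambda>e. (cmod (cinner e x))\<^sup>2) has_sum (norm x)\<^sup>2) E"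
proof -
  have on: "orthonormal E" and dense: "closure (complex_vector.span E) = UNIV"
    using E by (auto simp: orthonormal_basis_def orthonormal_def)
  have bessel: "(\<Sum>e\<in>F. (cmod (cinner e x))\<^sup>2) \<le> (norm x)\<^sup>2" if "finite F" "F \<subseteq> E" for F
    by (rule bessel_inequality[OF that(1) orthonormal_subset[OF on that(2)]])
  have sm: "(\<lambda>e. (cmod (cinner e x))\<^sup>2) summable_on E"
    by (rule nonneg_bdd_above_summable_on) (auto intro!: bdd_aboveI2 bessel)
  have "(norm x)\<^sup>2 \<le> (\<Sum>\<^sub>\<infinity>e\<in>E. (cmod (cinner e x))\<^sup>2)"
  proof (rule field_le_epsilon)
    fix \<epsilon> :: real assume \<epsilon>: "0 < \<epsilon>"
    have "x \<in> closure (complex_vector.span E)" using dense by simp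
    then obtain w where w: "w \<in> complex_vector.span E" "dist w x < sqrt \<epsilon>"
      using \<epsilon> unfolding closure_approachable by (meson real_sqrt_gt_zero)
    then obtain F where F: "finite F" "F \<subseteq> E" "w \<in> complex_vector.span F"
      unfolding complex_vector.span_explicit by blast
    note onF = orthonormal_subset[OF on F(2)]
    have "(norm x)\<^sup>2 = (norm (x - fourier_sum F x))\<^sup>2 + (norm (fourier_sum F x))\<^sup>2"
      using norm_fourier_decomposition[OF F(1) onF complex_vector.span_zero, of x] by simp
    also have "(norm (fourier_sum F x))\<^sup>2 = (\<Sum>e\<in>F. (cmod (cinner e x))\<^sup>2)"
      unfolding fourier_sum_def by (rule norm_sum_orthonormal[OF F(1) onF])
    also have "\<dots> \<le> (\<Sum>\<^sub>\<infinity>e\<in>E. (cmod (cinner e x))\<^sup>2)"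
      using F by (intro finite_sum_le_infsum sm) auto
    also have "(norm (x - fourier_sum F x))\<^sup>2 \<le> (norm (x - w))\<^sup>2"
      using norm_fourier_decomposition[OF F(1) onF F(3), of x] by simp
    also have "\<dots> \<le> (sqrt \<epsilon>)\<^sup>2"
      using w(2) by (intro power_mono) (auto simp: dist_norm norm_minus_commute)
    finally show "(norm x)\<^sup>2 \<le> (\<Sum>\<^sub>\<infinity>e\<in>E. (cmod (cinner e x))\<^sup>2) + \<epsilon>" using \<epsilon> by simp
  qed
  moreover have "(\<Sum>\<^sub>\<infinity>e\<in>E. (cmod (cinner e x))\<^sup>2) \<le> (norm x)\<^sup>2"
    by (rule infsum_le_finite_sums[OF sm bessel])
  ultimately show ?thesis using has_sum_infsum[OF sm] by simp
qed

text \<open>Parseval over \<open>E\<close> expands each \<open>S f\<close> into the entries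
  \<open>cinner f (T e)\<close>; summing over \<open>F\<close> inside, Bessel's inequality bounds
  them by the norm of \<open>T e\<close>.\<close>

lemma hilbert_schmidt_adjoint_bound:
  fixes T :: "'a::complex_inner \<Rightarrow> 'b::complex_inner"
  assumes adj: "\<And>x y. cinner (S y) x = cinner y (T x)"
    and E: "orthonormal_basis E" and sm: "(\<lambda>e. (norm (T e))\<^sup>2) summable_on E"
    and F: "finite F" "orthonormal F"
  shows "(\<Sum>f\<in>F. (norm (S f))\<^sup>2) \<le> (\<Sum>\<^sub>\<infinity>e\<in>E. (norm (T e))\<^sup>2)"
proof -
  have hs: "((\<lambda>e. (cmod (cinner f (T e)))\<^sup>2) has_sum (norm (S f))\<^sup>2) E" for f
    using parseval[OF E, of "S f"] unfolding cmod_cinner_commute[of _ "S f"] adj .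
  have "((\<lambda>e. \<Sum>f\<in>F. (cmod (cinner f (T e)))\<^sup>2) has_sum (\<Sum>f\<in>F. (norm (S f))\<^sup>2)) E"
    by (intro has_sum_sum hs)
  then show ?thesis
    by (rule has_sum_mono[OF _ has_sum_infsum[OF sm]]) (rule bessel_inequality[OF F])
qed

text \<open>The adjoint bound is used twice: from \<open>T\<close> on \<open>E'\<close> to its
  adjoint on \<open>E'\<close>, and back to \<open>T\<close> on the given basis
  \<open>E\<close>.\<close>

lemma hilbert_schmidt_basis_independent:
  fixes T :: "'a::complex_hilbert \<Rightarrow> 'a"
  assumes T: "hilbert_schmidt T" and E: "orthonormal_basis E"
  shows "(\<lambda>e. (norm (T e))\<^sup>2) summable_on E"
proof -
  obtain E' where E': "orthonormal_basis E'" "(\<lambda>e. (norm (T e))\<^sup>2) summable_on E'"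
    and bT: "bounded_clinear T" using T by (auto simp: hilbert_schmidt_def)
  have on: "orthonormal E" "orthonormal E'" using E E' by (auto simp: orthonormal_basis_def orthonormal_def)
  note bound = hilbert_schmidt_adjoint_bound[OF cinner_cadjoint_left[OF bT] E']
  have "(\<lambda>e. (norm (cadjoint T e))\<^sup>2) summable_on E'"
    by (rule nonneg_bdd_above_summable_on) (auto intro!: bdd_aboveI2 bound orthonormal_subset[OF on(2)])
  note bound' = hilbert_schmidt_adjoint_bound[OF cinner_cadjoint_right[OF bT, symmetric] E'(1) this]
  show ?thesis
    by (rule nonneg_bdd_above_summable_on) (auto intro!: bdd_aboveI2 bound' orthonormal_subset[OF on(1)])
qed

lemma hilbert_schmidt_diff:
  fixes S T :: "'a::complex_hilbert \<Rightarrow> 'a"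
  assumes S: "hilbert_schmidt S" and T: "hilbert_schmidt T"
  shows "hilbert_schmidt (\<lambda>x. S x - T x)"
proof -
  have bS: "bounded_clinear S" and bT: "bounded_clinear T"
    using S T by (auto simp: hilbert_schmidt_def)
  obtain E where E: "orthonormal_basis (E :: 'a set)" using S unfolding hilbert_schmidt_def by blast
  have "(\<lambda>e. (norm (S e + - T e))\<^sup>2) summable_on E"
    using hilbert_schmidt_basis_independent[OF S E] hilbert_schmidt_basis_independent[OF T E]
    by (intro summable_on_square_add) simp_all
  then show ?thesis
    unfolding hilbert_schmidt_def using E bounded_clinear_diff[OF bS bT] by auto
qed

lemma hs_norm_nonneg: "0 \<le> hs_norm T"
  unfolding hs_norm_def by (intro real_sqrt_ge_zero infsum_nonneg) simp

text \<open>\<open>hs_norm\<close> sums over one chosen basis, so the members of that basis are what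
  it controls directly; they suffice to determine a bounded operator.\<close>

lemma norm_le_hs_norm:
  fixes T :: "'a::complex_hilbert \<Rightarrow> 'a"
  assumes T: "hilbert_schmidt T" and e: "e \<in> (SOME E. orthonormal_basis E)"
  shows "norm (T e) \<le> hs_norm T"
proof -
  let ?E = "SOME E. orthonormal_basis (E :: 'a set)"
  have "\<exists>E. orthonormal_basis (E :: 'a set)" using T by (auto simp: hilbert_schmidt_def)
  then have "orthonormal_basis ?E" by (rule someI_ex)
  then have "(\<lambda>e. (norm (T e))\<^sup>2) summable_on ?E" by (rule hilbert_schmidt_basis_independent[OF T])
  then have "(\<Sum>e\<in>{e}. (norm (T e))\<^sup>2) \<le> (\<Sum>\<^sub>\<infinity>e\<in>?E. (norm (T e))\<^sup>2)"
    using e by (intro finite_sum_le_infsum) auto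
  then show ?thesis unfolding hs_norm_def by (simp add: real_le_rsqrt)
qed

lemma bounded_clinear_eq_on_basis:
  fixes S T :: "'a::complex_inner \<Rightarrow> 'b::complex_inner"
  assumes S: "bounded_clinear S" and T: "bounded_clinear T" and E: "orthonormal_basis E"
    and eq: "\<And>e. e \<in> E \<Longrightarrow> S e = T e"
  shows "S = T"
proof
  fix x
  have span: "S x = T x" if "x \<in> complex_vector.span E" for x
    using that by (induction rule: complex_vector.span_induct_alt)
      (simp_all add: bounded_clinearD[OF S] bounded_clinearD[OF T] eq)
  have "closed {x. S x = T x}"
    by (intro closed_Collect_eq linear_continuous_on bounded_clinearD(1) S T)
  then have "closure (complex_vector.span E) \<subseteq> {x. S x = T x}"
    by (intro closure_minimal) (auto simp: span)
  then show "S x = T x" using E by (auto simp: orthonormal_basis_def)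
qed

text \<open>Convergence in this sense forces pointwise convergence on the chosen basis, and bounded
  operators that agree there are equal. This is the uniqueness demanded by the definite description
  in \<open>boundary_resolvent\<close>.\<close>

lemma hs_tendsto_unique:
  fixes T :: "'c \<Rightarrow> 'a::complex_hilbert \<Rightarrow> 'a"
  assumes "hs_tendsto T L F" "hs_tendsto T L' F" "F \<noteq> bot"
  shows "L = L'"
proof -
  let ?E = "SOME E. orthonormal_basis (E :: 'a set)"
  have lim: "((\<lambda>c. T c e) \<longlongrightarrow> L e) F" if L: "hs_tendsto T L F" and e: "e \<in> ?E" for L e
  proof -
    have hs: "\<forall>\<^sub>F c in F. hilbert_schmidt (T c)" "hilbert_schmidt L" and
      0: "((\<lambda>c. hs_norm (\<lambda>x. T c x - L x)) \<longlongrightarrow> 0) F"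
      using L by (auto simp: hs_tendsto_def)
    have "\<forall>\<^sub>F c in F. norm (L e - T c e) \<le> hs_norm (\<lambda>x. T c x - L x)"
      using hs(1)
    proof eventually_elim
      case (elim c)
      from norm_le_hs_norm[OF hilbert_schmidt_diff[OF elim hs(2)] e] show ?case
        by (simp add: norm_minus_commute)
    qed
    then have "((\<lambda>c. L e - T c e) \<longlongrightarrow> 0) F" by (rule Lim_null_comparison[OF _ 0])
    from tendsto_diff[OF tendsto_const[of "L e"] this] show ?thesis by simp
  qed
  have L: "hilbert_schmidt L" "hilbert_schmidt L'" using assms by (auto simp: hs_tendsto_def)
  then have "\<exists>E. orthonormal_basis (E :: 'a set)" by (auto simp: hilbert_schmidt_def)
  then have "orthonormal_basis ?E" by (rule someI_ex)
  with L show ?thesis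
    using tendsto_unique[OF assms(3) lim[OF assms(1)] lim[OF assms(2)]]
    by (intro bounded_clinear_eq_on_basis[of L L' ?E]) (auto simp: hilbert_schmidt_def)
qed

text \<open>The bound ranges over all finite orthonormal sets, hence covers whichever basis the
  choice operator in \<open>hs_norm\<close> selects; \<open>E\<close> witnesses that there is
  one.\<close>

lemma hilbert_schmidtI:
  fixes T :: "'a::complex_inner \<Rightarrow> 'a"
  assumes T: "bounded_clinear T" and E: "orthonormal_basis (E :: 'a set)" and C: "0 \<le> C"
    and bound: "\<And>F. finite F \<Longrightarrow> orthonormal F \<Longrightarrow> (\<Sum>e\<in>F. (norm (T e))\<^sup>2) \<le> C\<^sup>2"
  shows "hilbert_schmidt T" and "hs_norm T \<le> C"
proof -
  have sm: "(\<lambda>e. (norm (T e))\<^sup>2) summable_on E" "(\<Sum>\<^sub>\<infinity>e\<in>E. (norm (T e))\<^sup>2) \<le> C\<^sup>2"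
    if "orthonormal_basis E" for E
  proof -
    have on: "orthonormal E" using that by (auto simp: orthonormal_basis_def orthonormal_def)
    show sm: "(\<lambda>e. (norm (T e))\<^sup>2) summable_on E"
      by (rule nonneg_bdd_above_summable_on) (auto intro!: bdd_aboveI2 bound orthonormal_subset[OF on])
    show "(\<Sum>\<^sub>\<infinity>e\<in>E. (norm (T e))\<^sup>2) \<le> C\<^sup>2"
      by (rule infsum_le_finite_sums[OF sm]) (auto intro!: bound orthonormal_subset[OF on])
  qed
  show "hilbert_schmidt T" unfolding hilbert_schmidt_def using T E sm(1) by blast
  show "hs_norm T \<le> C" unfolding hs_norm_def
    using sm(2)[OF someI[of orthonormal_basis, OF E]] C by (metis real_le_lsqrt real_sqrt_le_iff real_sqrt_abs abs_of_nonneg)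
qed

section \<open>Sums of rank one operators\<close>

definition nuclear_sum ::
    "'i set \<Rightarrow> ('i \<Rightarrow> complex) \<Rightarrow> ('i \<Rightarrow> 'a::complex_inner) \<Rightarrow> ('i \<Rightarrow> 'a) \<Rightarrow> 'a \<Rightarrow> 'a"
  where "nuclear_sum I c a b x = (\<Sum>\<^sub>\<infinity>i\<in>I. (c i * cinner (b i) x) *\<^sub>C a i)"

text \<open>The sum of these coefficients is an upper bound for the trace norm of
  \<open>nuclear_sum\<close>. It is used through two consequences of Bessel's inequality: a bound on
  the Hilbert-Schmidt norm and a bound on traces over finite orthonormal families.\<close>

locale nuclear =
  fixes I :: "'i set" and c :: "'i \<Rightarrow> complex" and a b :: "'i \<Rightarrow> 'a::complex_hilbert"
  assumes summable_coeff: "(\<lambda>i. cmod (c i) * norm (a i) * norm (b i)) summable_on I"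
begin

lemma term_bound: "norm ((c i * cinner (b i) x) *\<^sub>C a i) \<le> cmod (c i) * norm (a i) * norm (b i) * norm x"
  using mult_left_mono[OF cmod_cinner_le[of "b i" x], of "cmod (c i) * norm (a i)"]
  by (simp add: norm_scaleC norm_mult mult_ac)

lemma abs_summable: "(\<lambda>i. norm ((c i * cinner (b i) x) *\<^sub>C a i)) summable_on I"
  by (rule summable_on_comparison_test[OF summable_on_cmult_left[OF summable_coeff, of "norm x"]])
    (use term_bound in auto)

lemma summable: "(\<lambda>i. (c i * cinner (b i) x) *\<^sub>C a i) summable_on I"
  by (rule abs_summable_summable[OF abs_summable])

lemma norm_nuclear_sum_le:
  "norm (nuclear_sum I c a b x) \<le> (\<Sum>\<^sub>\<infinity>i\<in>I. cmod (c i) * norm (a i) * norm (b i)) * norm x"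
proof -
  have "norm (nuclear_sum I c a b x) \<le> (\<Sum>\<^sub>\<infinity>i\<in>I. cmod (c i) * norm (a i) * norm (b i) * norm x)"
    unfolding nuclear_sum_def
    by (rule norm_infsum_le[OF has_sum_infsum[OF summable]
          has_sum_infsum[OF summable_on_cmult_left[OF summable_coeff, of "norm x"]] term_bound])
  then show ?thesis by (simp only: infsum_cmult_left')
qed

lemma bounded_clinear: "bounded_clinear (nuclear_sum I c a b)"
proof (rule bounded_clinearI[OF _ _ norm_nuclear_sum_le])
  show "nuclear_sum I c a b (x + y) = nuclear_sum I c a b x + nuclear_sum I c a b y" for x y
    unfolding nuclear_sum_def infsum_add[OF summable summable, symmetric]
    by (simp add: cinner_add_right scaleC_add_left distrib_left)
  show "nuclear_sum I c a b (k *\<^sub>C x) = k *\<^sub>C nuclear_sum I c a b x" for k x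
    unfolding nuclear_sum_def
    by (subst infsum_bounded_linear[OF bounded_linear_scaleC_right summable, symmetric])
      (simp add: cinner_scaleC_right scaleC_scaleC mult_ac)
qed

lemma has_sum_cinner:
  "((\<lambda>i. c i * cinner (b i) x * cinner y (a i)) has_sum cinner y (nuclear_sum I c a b x)) I"
proof -
  have "((\<lambda>i. cinner y ((c i * cinner (b i) x) *\<^sub>C a i)) has_sum cinner y (nuclear_sum I c a b x)) I"
    unfolding nuclear_sum_def
    by (rule has_sum_bounded_linear[OF bounded_clinearD(1)[OF cinner_bounded_clinear] has_sum_infsum[OF summable]])
  then show ?thesis by (simp add: cinner_scaleC_right)
qed

text \<open>Duality: the left side \<open>X\<close> is the sum over \<open>i\<close> of
  \<open>c i\<close> times the sum over \<open>e\<close> of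
  \<open>cinner (b i) e * cinner (?T e) (a i)\<close>. Cauchy-Schwarz over \<open>F\<close> and
  Bessel for \<open>b i\<close> bound this by the coefficient sum times \<open>sqrt X\<close>, and
  one factor \<open>sqrt X\<close> cancels.\<close>

lemma square_sum_le:
  assumes F: "finite F" "orthonormal F"
  shows "(\<Sum>e\<in>F. (norm (nuclear_sum I c a b e))\<^sup>2) \<le> (\<Sum>\<^sub>\<infinity>i\<in>I. cmod (c i) * norm (a i) * norm (b i))\<^sup>2"
proof -
  let ?T = "nuclear_sum I c a b" and ?K = "\<Sum>\<^sub>\<infinity>i\<in>I. cmod (c i) * norm (a i) * norm (b i)"
  define X where "X = (\<Sum>e\<in>F. (norm (?T e))\<^sup>2)"
  have X: "0 \<le> X" unfolding X_def by (intro sum_nonneg) auto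
  have K: "0 \<le> ?K" by (intro infsum_nonneg) auto
  have "((\<lambda>i. \<Sum>e\<in>F. c i * cinner (b i) e * cinner (?T e) (a i)) has_sum (\<Sum>e\<in>F. cinner (?T e) (?T e))) I"
    by (intro has_sum_sum has_sum_cinner)
  also have "(\<Sum>e\<in>F. cinner (?T e) (?T e)) = complex_of_real X"
    unfolding X_def cinner_self by simp
  finally have hs: "((\<lambda>i. \<Sum>e\<in>F. c i * cinner (b i) e * cinner (?T e) (a i)) has_sum complex_of_real X) I" .
  have "cmod (\<Sum>e\<in>F. c i * cinner (b i) e * cinner (?T e) (a i)) \<le> cmod (c i) * norm (a i) * norm (b i) * sqrt X" for i
  proof -
    have "cmod (\<Sum>e\<in>F. c i * cinner (b i) e * cinner (?T e) (a i))
        \<le> (\<Sum>e\<in>F. (cmod (c i) * norm (a i)) * (cmod (cinner (b i) e) * norm (?T e)))"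
    proof (rule sum_norm_le)
      fix e
      have "cmod (cinner (?T e) (a i)) \<le> norm (?T e) * norm (a i)" by (rule cmod_cinner_le)
      then have "(cmod (c i) * cmod (cinner (b i) e)) * cmod (cinner (?T e) (a i))
          \<le> (cmod (c i) * cmod (cinner (b i) e)) * (norm (?T e) * norm (a i))"
        by (intro mult_left_mono) auto
      then show "cmod (c i * cinner (b i) e * cinner (?T e) (a i))
          \<le> (cmod (c i) * norm (a i)) * (cmod (cinner (b i) e) * norm (?T e))"
        by (simp add: norm_mult mult_ac)
    qed
    also have "\<dots> = (cmod (c i) * norm (a i)) * (\<Sum>e\<in>F. cmod (cinner (b i) e) * norm (?T e))"
      by (simp add: sum_distrib_left)
    also have "(\<Sum>e\<in>F. cmod (cinner (b i) e) * norm (?T e)) \<le> norm (b i) * sqrt X"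
    proof -
      have "(\<Sum>e\<in>F. cmod (cinner (b i) e) * norm (?T e))
          \<le> L2_set (\<lambda>e. cmod (cinner (b i) e)) F * L2_set (\<lambda>e. norm (?T e)) F"
        using L2_set_mult_ineq[of "\<lambda>e. cmod (cinner (b i) e)" "\<lambda>e. norm (?T e)" F] by simp
      also have "L2_set (\<lambda>e. cmod (cinner (b i) e)) F \<le> norm (b i)"
        unfolding L2_set_def cmod_cinner_commute[of "b i"]
        by (intro real_le_lsqrt bessel_inequality[OF F] sum_nonneg) auto
      also have "L2_set (\<lambda>e. norm (?T e)) F = sqrt X" by (simp add: L2_set_def X_def)
      finally show ?thesis using X by (simp add: mult_right_mono)
    qed
    finally show ?thesis by (simp add: mult.assoc mult_left_mono)
  qed
  then have "cmod (complex_of_real X) \<le> ?K * sqrt X"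
    by (rule norm_infsum_le[OF hs has_sum_cmult_left[OF has_sum_infsum[OF summable_coeff]]])
  then have "sqrt X * sqrt X \<le> ?K * sqrt X" using X by simp
  then have "sqrt X \<le> ?K" 
  proof (cases "X = 0")
    case False
    then have "0 < sqrt X" using X by simp
    with \<open>sqrt X * sqrt X \<le> ?K * sqrt X\<close> show ?thesis by (rule mult_right_le_imp_le)
  qed (use K in simp)
  then show ?thesis unfolding X_def[symmetric] by (rule sqrt_le_D)
qed

text \<open>For a single rank one term, Cauchy-Schwarz over \<open>F\<close> and Bessel for both
  \<open>a i\<close> and \<open>b i\<close> bound the partial trace by the coefficient of that term,
  whatever \<open>F\<close> is.\<close>

lemma trace_le:
  assumes F: "finite F" "orthonormal F"
  shows "cmod (\<Sum>x\<in>F. cinner x (nuclear_sum I c a b x)) \<le> (\<Sum>\<^sub>\<infinity>i\<in>I. cmod (c i) * norm (a i) * norm (b i))"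
proof -
  have "((\<lambda>i. \<Sum>x\<in>F. c i * cinner (b i) x * cinner x (a i)) has_sum (\<Sum>x\<in>F. cinner x (nuclear_sum I c a b x))) I"
    by (intro has_sum_sum has_sum_cinner)
  moreover have "cmod (\<Sum>x\<in>F. c i * cinner (b i) x * cinner x (a i)) \<le> cmod (c i) * norm (a i) * norm (b i)" for i
  proof -
    have "cmod (\<Sum>x\<in>F. c i * cinner (b i) x * cinner x (a i))
        \<le> (\<Sum>x\<in>F. cmod (c i) * (cmod (cinner x (a i)) * cmod (cinner x (b i))))"
      by (rule sum_norm_le) (simp add: norm_mult cmod_cinner_commute[of "b i"] mult_ac)
    also have "\<dots> = cmod (c i) * (\<Sum>x\<in>F. cmod (cinner x (a i)) * cmod (cinner x (b i)))"
      by (simp add: sum_distrib_left)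
    also have "(\<Sum>x\<in>F. cmod (cinner x (a i)) * cmod (cinner x (b i)))
        \<le> L2_set (\<lambda>x. cmod (cinner x (a i))) F * L2_set (\<lambda>x. cmod (cinner x (b i))) F"
      using L2_set_mult_ineq[of "\<lambda>x. cmod (cinner x (a i))" "\<lambda>x. cmod (cinner x (b i))" F] by simp
    also have "\<dots> \<le> norm (a i) * norm (b i)"
      unfolding L2_set_def
      by (intro mult_mono real_le_lsqrt bessel_inequality[OF F] sum_nonneg real_sqrt_ge_zero) auto
    finally show ?thesis by (simp add: mult.assoc mult_left_mono)
  qed
  ultimately show ?thesis by (rule norm_infsum_le[OF _ has_sum_infsum[OF summable_coeff]])
qed

lemma hilbert_schmidt:
  assumes "orthonormal_basis (E :: 'a set)"
  shows "hilbert_schmidt (nuclear_sum I c a b)"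
    and "hs_norm (nuclear_sum I c a b) \<le> (\<Sum>\<^sub>\<infinity>i\<in>I. cmod (c i) * norm (a i) * norm (b i))"
proof -
  have "0 \<le> (\<Sum>\<^sub>\<infinity>i\<in>I. cmod (c i) * norm (a i) * norm (b i))" by (intro infsum_nonneg) auto
  note hs = hilbert_schmidtI[OF bounded_clinear assms this]
  show "hilbert_schmidt (nuclear_sum I c a b)" by (rule hs(1)[OF square_sum_le])
  show "hs_norm (nuclear_sum I c a b) \<le> (\<Sum>\<^sub>\<infinity>i\<in>I. cmod (c i) * norm (a i) * norm (b i))"
    by (rule hs(2)[OF square_sum_le])
qed

end

lemma nuclear_sum_diff:
  assumes "nuclear I c a b" "nuclear I d a b"
  shows "nuclear_sum I c a b x - nuclear_sum I d a b x = nuclear_sum I (\<lambda>i. c i - d i) a b x"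
proof -
  note has_sum_add[OF has_sum_infsum[OF nuclear.summable[OF assms(1)]]
      has_sum_bounded_linear[OF bounded_linear_minus[OF bounded_linear_ident] has_sum_infsum[OF nuclear.summable[OF assms(2)]]], of x x]
  from infsumI[OF this] show ?thesis
    unfolding nuclear_sum_def by (simp add: left_diff_distrib complex_vector.scale_left_diff_distrib)
qed

section \<open>Counting eigenvalues\<close>

lemma eigenvectors_orthogonal:
  assumes S: "selfadjoint S" and e: "e \<in> eigenspace S \<mu>" and x: "x \<in> eigenspace S \<nu>" and "\<mu> \<noteq> \<nu>"
  shows "cinner e x = 0"
proof -
  have "cinner (S e) x = cinner e (S x)" using S by (simp add: selfadjoint_def)
  then show ?thesis using assms by (simp add: eigenspace_def cinner_scaleC_left cinner_scaleC_right)
qed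

text \<open>In the Fourier sum of an eigenvector \<open>x\<close>, members of \<open>C\<close> with
  another eigenvalue drop out by orthogonality, so the residual stays in the eigenspace of
  \<open>x\<close> and \<open>maximal_orthonormal\<close> applies. The cardinality bound takes the
  place of compactness.\<close>

lemma orthonormal_eigenvectors:
  fixes S :: "'a::complex_inner \<Rightarrow> 'a"
  assumes S: "selfadjoint S"
    and bound: "\<And>C. finite C \<Longrightarrow> orthonormal C \<Longrightarrow> C \<subseteq> (\<Union>\<mu>\<in>I. eigenspace S \<mu>) \<Longrightarrow> card C \<le> N"
  obtains C where "finite C" "orthonormal C" "C \<subseteq> (\<Union>\<mu>\<in>I. eigenspace S \<mu>)" "card C \<le> N"
    "(\<Union>\<mu>\<in>I. eigenspace S \<mu>) \<subseteq> complex_vector.span C"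
proof (rule maximal_orthonormal[OF bound])
  note lin = bounded_clinearD[of S]
  have bS: "bounded_clinear S" using S by (simp add: selfadjoint_def)
  show "x - fourier_sum C x \<in> (\<Union>\<mu>\<in>I. eigenspace S \<mu>)"
    if C: "finite C" "orthonormal C" "C \<subseteq> (\<Union>\<mu>\<in>I. eigenspace S \<mu>)" and x: "x \<in> (\<Union>\<mu>\<in>I. eigenspace S \<mu>)" for C x
  proof -
    obtain \<mu> where \<mu>: "\<mu> \<in> I" "x \<in> eigenspace S \<mu>" using x by blast
    have "cinner e x *\<^sub>C S e = complex_of_real \<mu> *\<^sub>C cinner e x *\<^sub>C e" if "e \<in> C" for e
    proof -
      obtain \<nu> where \<nu>: "e \<in> eigenspace S \<nu>" using C(3) \<open>e \<in> C\<close> by blast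
      show ?thesis
      proof (cases "\<nu> = \<mu>")
        case True
        then show ?thesis using \<nu> by (simp add: eigenspace_def scaleC_scaleC mult.commute)
      next
        case False
        then show ?thesis using eigenvectors_orthogonal[OF S \<nu> \<mu>(2)] by simp
      qed
    qed
    then have "S (fourier_sum C x) = complex_of_real \<mu> *\<^sub>C fourier_sum C x"
      unfolding fourier_sum_def lin(7)[OF bS] lin(2)[OF bS] complex_vector.scale_sum_right by simp
    then show ?thesis using \<mu>
      by (auto simp: eigenspace_def lin(4)[OF bS] complex_vector.scale_right_diff_distrib)
  qed
  show "a *\<^sub>C x \<in> (\<Union>\<mu>\<in>I. eigenspace S \<mu>)" if "x \<in> (\<Union>\<mu>\<in>I. eigenspace S \<mu>)" for a x
    using that by (auto simp: eigenspace_def lin(2)[OF bS] scaleC_scaleC mult.commute)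
qed (auto intro: that)

lemma quadratic_form_ge_on_eigenvectors:
  fixes S :: "'a::complex_inner \<Rightarrow> 'a"
  assumes S: "bounded_clinear S" and C: "finite C" "orthonormal C" "C \<subseteq> (\<Union>\<mu>\<in>{r<..}. eigenspace S \<mu>)"
    and x: "x \<in> complex_vector.span C"
  shows "r * (norm x)\<^sup>2 \<le> Re (cinner x (S x))"
proof -
  have "\<forall>e\<in>C. \<exists>\<mu>>r. S e = complex_of_real \<mu> *\<^sub>C e" using C(3) by (auto simp: eigenspace_def)
  then obtain \<mu> where \<mu>: "\<And>e. e \<in> C \<Longrightarrow> \<mu> e > r" "\<And>e. e \<in> C \<Longrightarrow> S e = complex_of_real (\<mu> e) *\<^sub>C e"
    by metis
  have fs: "fourier_sum C x = x" by (rule fourier_sum_eq_self[OF C(1,2) x])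
  have "(norm x)\<^sup>2 = (\<Sum>e\<in>C. (cmod (cinner e x))\<^sup>2)"
    using norm_sum_orthonormal[OF C(1,2), of "\<lambda>e. cinner e x"] fs by (simp add: fourier_sum_def)
  moreover have "cinner x (S x) = (\<Sum>e\<in>C. complex_of_real (\<mu> e * (cmod (cinner e x))\<^sup>2))"
  proof -
    have "cinner x (S x) = cinner x (S (fourier_sum C x))" by (simp only: fs)
    also have "\<dots> = (\<Sum>e\<in>C. cinner e x * (complex_of_real (\<mu> e) * cinner x e))"
      unfolding fourier_sum_def bounded_clinearD(7)[OF S] bounded_clinearD(2)[OF S] cinner_sum_right cinner_scaleC_right
      by (intro sum.cong) (auto simp: \<mu> cinner_scaleC_right)
    also have "\<dots> = (\<Sum>e\<in>C. complex_of_real (\<mu> e * (cmod (cinner e x))\<^sup>2))"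
      by (intro sum.cong refl, subst cinner_commute[of x])
        (simp add: complex_norm_square mult_ac del: of_real_power)
    finally show ?thesis .
  qed
  moreover have "(\<Sum>e\<in>C. r * (cmod (cinner e x))\<^sup>2) \<le> (\<Sum>e\<in>C. \<mu> e * (cmod (cinner e x))\<^sup>2)"
    using less_imp_le[OF \<mu>(1)] by (intro sum_mono mult_right_mono) auto
  ultimately show ?thesis
    by (simp only: sum_distrib_left Re_sum Re_complex_of_real)
qed

text \<open>The span of a finite orthonormal set is closed, since the Fourier residual is no longer
  than the distance to any point of the span. Hence the definite description in
  \<open>orthogonal_projection\<close> evaluates to \<open>fourier_sum C\<close>.\<close>

lemma rank_spectral_projection_le:
  fixes S :: "'a::complex_inner \<Rightarrow> 'a"
  assumes C: "finite C" "orthonormal C" "C \<subseteq> (\<Union>\<mu>\<in>I. eigenspace S \<mu>)"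
    "(\<Union>\<mu>\<in>I. eigenspace S \<mu>) \<subseteq> complex_vector.span C"
  shows "rank_op (spectral_projection S I) \<le> enat (card C)"
proof -
  let ?X = "\<Union>\<mu>\<in>I. eigenspace S \<mu>"
  have span: "complex_vector.span ?X = complex_vector.span C"
    by (rule subset_antisym[OF complex_vector.span_minimal[OF C(4) complex_vector.subspace_span]
          complex_vector.span_mono[OF C(3)]])
  have closed: "closure (complex_vector.span C) = complex_vector.span C"
  proof (intro subset_antisym closure_subset subsetI)
    fix x assume x: "x \<in> closure (complex_vector.span C)"
    have "norm (x - fourier_sum C x) \<le> 0"
    proof (rule field_le_epsilon)
      fix \<epsilon> :: real assume "0 < \<epsilon>"
      then obtain w where w: "w \<in> complex_vector.span C" "dist w x < \<epsilon>"
        using x unfolding closure_approachable by blast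
      have "(norm (x - fourier_sum C x))\<^sup>2 \<le> (norm (x - w))\<^sup>2"
        using norm_fourier_decomposition[OF C(1,2) w(1), of x] by simp
      then have "norm (x - fourier_sum C x) \<le> norm (x - w)" by (rule power2_le_imp_le) simp
      then show "norm (x - fourier_sum C x) \<le> 0 + \<epsilon>" using w(2) by (simp add: dist_norm norm_minus_commute)
    qed
    then show "x \<in> complex_vector.span C" using fourier_sum_in_span[of C x] by simp
  qed
  have proj: "spectral_projection S I = fourier_sum C"
  proof
    fix x
    note orth = fourier_residual_orthogonal(2)[OF C(1,2)]
    show "spectral_projection S I x = fourier_sum C x"
      unfolding spectral_projection_def orthogonal_projection_def span closed
    proof (rule the_equality)
      fix p assume p: "p \<in> complex_vector.span C \<and> (\<forall>w\<in>complex_vector.span C. cinner w (x - p) = 0)"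
      let ?d = "p - fourier_sum C x"
      have "?d \<in> complex_vector.span C"
        using p by (intro complex_vector.span_diff fourier_sum_in_span) auto
      then have "cinner ?d (x - fourier_sum C x) = 0" "cinner ?d (x - p) = 0"
        using p by (blast intro: orth)+
      then have "cinner ?d ?d = 0" by (simp add: cinner_diff_right)
      then show "p = fourier_sum C x" by simp
    qed (blast intro: orth fourier_sum_in_span)
  qed
  have range: "range (spectral_projection S I) \<subseteq> complex_vector.span C"
    unfolding proj using fourier_sum_in_span by auto
  then have "\<exists>B. finite B \<and> range (spectral_projection S I) \<subseteq> complex_vector.span B" using C(1) by blast
  then have "rank_op (spectral_projection S I) = enat (complex_vector.dim (range (spectral_projection S I)))"
    unfolding rank_op_def by (rule if_P)
  then show ?thesis using complex_vector.dim_le_card[OF range C(1)] by simp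
qed

text \<open>Given orthonormal eigenvectors with eigenvalues above 1, their span contains an
  orthonormal family in the common kernel that is smaller by at most \<open>card I\<close>. The form
  of \<open>S\<close> is at least 1 on each member of that family, so its size is at most its trace,
  hence at most \<open>D\<close>.\<close>

lemma N_plus_le:
  fixes S :: "'a::complex_inner \<Rightarrow> 'a" and l :: "'i \<Rightarrow> 'a \<Rightarrow> complex"
  assumes S: "selfadjoint S"
    and l: "finite I" "\<And>i x y. i \<in> I \<Longrightarrow> l i (x + y) = l i x + l i y" "\<And>i a x. i \<in> I \<Longrightarrow> l i (a *\<^sub>C x) = a * l i x"
    and trace: "\<And>C. finite C \<Longrightarrow> orthonormal C \<Longrightarrow> (\<And>x i. x \<in> C \<Longrightarrow> i \<in> I \<Longrightarrow> l i x = 0) \<Longrightarrow>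
      (\<Sum>x\<in>C. Re (cinner x (S x))) \<le> D"
  shows "N_plus 1 S \<le> enat (card I + nat \<lfloor>D\<rfloor>)"
proof -
  have bS: "bounded_clinear S" using S by (simp add: selfadjoint_def)
  have bound: "card B \<le> card I + nat \<lfloor>D\<rfloor>"
    if B: "finite B" "orthonormal B" "B \<subseteq> (\<Union>\<mu>\<in>{1<..}. eigenspace S \<mu>)" for B
  proof -
    obtain C where C: "finite C" "orthonormal C" "C \<subseteq> complex_vector.span B"
      "\<forall>x\<in>C. \<forall>i\<in>I. l i x = 0" "card B \<le> card C + card I"
      by (rule orthonormal_in_kernel[of B I l, OF B(1,2) l])
    have "real (card C) = (\<Sum>x\<in>C. 1 * (norm x)\<^sup>2)"
      using orthonormal_norm[OF C(2)] by simp
    also have "\<dots> \<le> (\<Sum>x\<in>C. Re (cinner x (S x)))"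
      using C(3) by (intro sum_mono quadratic_form_ge_on_eigenvectors[OF bS B]) auto
    also have "\<dots> \<le> D" using C(1,2,4) by (intro trace) auto
    finally have "card C \<le> nat \<lfloor>D\<rfloor>" by (simp add: le_nat_floor)
    with C(5) show ?thesis by simp
  qed
  obtain C where C: "finite C" "orthonormal C" "C \<subseteq> (\<Union>\<mu>\<in>{1<..}. eigenspace S \<mu>)"
    "card C \<le> card I + nat \<lfloor>D\<rfloor>" "(\<Union>\<mu>\<in>{1<..}. eigenspace S \<mu>) \<subseteq> complex_vector.span C"
    by (rule orthonormal_eigenvectors[OF S bound])
  show ?thesis unfolding N_plus_def
    using rank_spectral_projection_le[OF C(1,2,3,5)] C(4) by (meson enat_ord_simps(1) order_trans)
qed

section \<open>The square root of a positive operator\<close>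

lemma positive_op_cinner:
  assumes "positive_op T"
  shows "Im (cinner x (T x)) = 0" "0 \<le> Re (cinner x (T x))"
  using assms unfolding positive_op_def by (auto simp: complex_nonneg_Reals_iff)

text \<open>Polarisation: the form is real on the diagonal, and expanding it at \<open>x + y\<close>
  and at \<open>x + \<i> *\<^sub>C y\<close> yields the imaginary and the real part of the
  symmetry.\<close>

lemma positive_op_symmetric:
  fixes T :: "'a::complex_inner \<Rightarrow> 'a"
  assumes T: "positive_op T"
  shows "cinner (T y) x = cinner y (T x)"
proof -
  note pos = positive_op_cinner[OF T]
  have lin: "bounded_clinear T" using T by (simp add: positive_op_def)
  note lin = bounded_clinearD[OF lin]
  have 1: "Im (cinner x (T y)) + Im (cinner y (T x)) = 0" for x y
    using pos(1)[of "x + y"] pos(1)[of x] pos(1)[of y]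
    by (simp add: lin cinner_add_left cinner_add_right)
  have 2: "Re (cinner x (T y)) = Re (cinner y (T x))" for x y
    using 1[of x "\<i> *\<^sub>C y"] by (simp add: lin cinner_scaleC_left cinner_scaleC_right)
  show ?thesis
    using 1[of x y] 2[of x y] by (subst cinner_commute) (simp add: complex_eq_iff)
qed

lemma positive_op_cauchy_schwarz:
  fixes T :: "'a::complex_inner \<Rightarrow> 'a"
  assumes T: "positive_op T"
  shows "(cmod (cinner y (T x)))\<^sup>2 \<le> Re (cinner x (T x)) * Re (cinner y (T y))"
proof -
  note pos = positive_op_cinner[OF T]
  have lin: "bounded_clinear T" using T by (simp add: positive_op_def)
  note lin = bounded_clinearD[OF lin]
  define a where "a = cinner y (T x)"
  define p q where "p = Re (cinner x (T x))" and "q = Re (cinner y (T y))"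
  have "cinner x (T y) = cnj a"
    unfolding a_def by (subst cinner_commute) (simp add: positive_op_symmetric[OF T])
  then have quad: "0 \<le> t\<^sup>2 * p + 2 * t * (cmod a)\<^sup>2 + (cmod a)\<^sup>2 * q" for t :: real
  proof -
    \<comment> \<open>The coefficient \<open>a\<close> aligns the phases: both cross terms become
      \<open>t\<close> times the squared modulus of \<open>a\<close>, so the form is a real
      quadratic in \<open>t\<close>.\<close>
    let ?z = "complex_of_real t *\<^sub>C x + a *\<^sub>C y"
    have "cinner ?z (T ?z) = complex_of_real (t\<^sup>2) * cinner x (T x) + complex_of_real t * (a * cinner x (T y))
       + complex_of_real t * (cnj a * cinner y (T x)) + (cnj a * a) * cinner y (T y)"
      by (simp add: lin cinner_add_left cinner_add_right cinner_scaleC_left cinner_scaleC_right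
          algebra_simps power2_eq_square)
    then have "Re (cinner ?z (T ?z)) = t\<^sup>2 * p + 2 * t * (cmod a)\<^sup>2 + (cmod a)\<^sup>2 * q"
      using \<open>cinner x (T y) = cnj a\<close>
      by (simp add: a_def[symmetric] complex_norm_square[symmetric] p_def q_def mult.commute[of "cnj a"] del: of_real_power)
    with pos(2)[of ?z] show ?thesis by simp
  qed
  have p: "0 \<le> p" and q: "0 \<le> q" unfolding p_def q_def by (rule pos)+
  have "(cmod a)\<^sup>2 \<le> p * q"
  proof (cases "p = 0")
    case True
    \<comment> \<open>With \<open>p = 0\<close> the quadratic is affine in \<open>t\<close>; this
      \<open>t\<close> turns it into minus the squared modulus of \<open>a\<close>, which forces
      \<open>a = 0\<close>.\<close>
    have "0 \<le> (cmod a)\<^sup>2 * (2 * (- (q + 1) / 2) + q)" 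
      using quad[of "- (q + 1) / 2"] True by (simp add: algebra_simps)
    then have "(cmod a)\<^sup>2 * 1 \<le> 0" by (simp add: field_simps)
    then show ?thesis using p q by simp
  next
    case False
    then have "0 < p" using p by simp
    have "0 \<le> (cmod a)\<^sup>2 * q - (cmod a)\<^sup>2 * (cmod a)\<^sup>2 / p"
      using quad[of "- (cmod a)\<^sup>2 / p"] \<open>0 < p\<close> by (simp add: power2_eq_square field_simps)
    then have "(cmod a)\<^sup>2 * (cmod a)\<^sup>2 \<le> (p * q) * (cmod a)\<^sup>2"
      using \<open>0 < p\<close> by (simp add: field_simps)
    then show ?thesis
      using p q by (cases "a = 0") (simp, rule mult_right_le_imp_le[of _ "(cmod a)\<^sup>2"], simp_all)
  qed
  then show ?thesis unfolding a_def p_def q_def .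
qed

text \<open>The Cauchy-Schwarz inequality of the form, at the pair \<open>T x\<close> and
  \<open>x\<close>, bounds the fourth power of \<open>norm (T x)\<close> by the product of the
  squares of \<open>norm x\<close> and \<open>norm (T x)\<close>.\<close>

lemma norm_positive_op_le:
  fixes T :: "'a::complex_inner \<Rightarrow> 'a"
  assumes T: "positive_op T" and le: "\<And>x. Re (cinner x (T x)) \<le> (norm x)\<^sup>2"
  shows "norm (T x) \<le> norm x"
proof -
  have "(norm (T x))\<^sup>2 * (norm (T x))\<^sup>2 = (cmod (cinner (T x) (T x)))\<^sup>2"
    unfolding cinner_self norm_of_real by (simp add: power2_eq_square)
  also have "\<dots> \<le> Re (cinner x (T x)) * Re (cinner (T x) (T (T x)))"
    by (rule positive_op_cauchy_schwarz[OF T])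
  also have "\<dots> \<le> (norm x)\<^sup>2 * (norm (T x))\<^sup>2"
    by (intro mult_mono le positive_op_cinner[OF T]) simp
  finally have "(norm (T x))\<^sup>2 \<le> (norm x)\<^sup>2"
    by (cases "T x = 0") (simp, rule mult_right_le_imp_le[of _ "(norm (T x))\<^sup>2"], simp_all)
  then show ?thesis by (rule power2_le_imp_le) simp
qed

lemma positive_op_eq_0:
  fixes T :: "'a::complex_inner \<Rightarrow> 'a"
  assumes T: "positive_op T" and "Re (cinner x (T x)) = 0"
  shows "T x = 0"
  using positive_op_cauchy_schwarz[OF T, of "T x" x] assms(2) by (simp add: cinner_self)

text \<open>The square root of \<open>1 - B\<close> is \<open>1 - Y\<close>, where \<open>Y\<close> is the limit of the iterates
  \<open>Y \<mapsto> (B + Y\<^sup>2) / 2\<close>.  These are polynomials in \<open>B\<close> with nonnegative coefficients, so for a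
  contraction \<open>B\<close> their increments are dominated by those of the iterates for \<open>B = 1\<close>.\<close>

fun sqrt_iter :: "('a::complex_inner \<Rightarrow> 'a) \<Rightarrow> nat \<Rightarrow> 'a \<Rightarrow> 'a"
  where "sqrt_iter B 0 = (\<lambda>x. 0)"
  | "sqrt_iter B (Suc n) = (\<lambda>x. (1 / 2) *\<^sub>C (B x + sqrt_iter B n (sqrt_iter B n x)))"

fun sqrt_scalar_iter :: "nat \<Rightarrow> real"
  where "sqrt_scalar_iter 0 = 0"
  | "sqrt_scalar_iter (Suc n) = (1 + (sqrt_scalar_iter n)\<^sup>2) / 2"

lemma sqrt_scalar_iter_bounds:
  "0 \<le> sqrt_scalar_iter n" "sqrt_scalar_iter n \<le> 1" "sqrt_scalar_iter n \<le> sqrt_scalar_iter (Suc n)"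
proof -
  show 0: "0 \<le> sqrt_scalar_iter n" by (cases n) auto
  show "sqrt_scalar_iter n \<le> 1"
  proof (induction n)
    case (Suc n)
    moreover have "0 \<le> sqrt_scalar_iter n" by (cases n) auto
    ultimately show ?case by (simp add: power_le_one)
  qed simp
  have "0 \<le> (sqrt_scalar_iter n - 1)\<^sup>2" by simp
  then show "sqrt_scalar_iter n \<le> sqrt_scalar_iter (Suc n)" by (simp add: power2_diff field_simps)
qed

lemma incseq_sqrt_scalar_iter: "incseq sqrt_scalar_iter"
  by (rule incseq_SucI) (rule sqrt_scalar_iter_bounds)

text \<open>The iterates are polynomials in \<open>B\<close>. In the limit this becomes the
  commutation clause from which the uniqueness of the square root follows.\<close>

lemma sqrt_iter_commute:
  assumes B: "bounded_clinear B" and S: "bounded_clinear S" and comm: "\<And>x. S (B x) = B (S x)"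
  shows "S (sqrt_iter B n x) = sqrt_iter B n (S x)"
  by (induction n arbitrary: x) (simp_all add: bounded_clinearD[OF S] comm)

lemma bounded_clinear_sqrt_iter: "bounded_clinear B \<Longrightarrow> bounded_clinear (sqrt_iter B n)"
proof (induction n)
  case 0
  show ?case by (auto intro: bounded_clinearI[where C = 0])
next
  case (Suc n)
  then have "bounded_clinear (\<lambda>x. sqrt_iter B n (sqrt_iter B n x))"
    using bounded_clinear_compose[of "sqrt_iter B n" "sqrt_iter B n"] by (simp add: o_def)
  then show ?case using Suc.prems by (simp add: bounded_clinear_scaleC bounded_clinear_add)
qed

lemma sqrt_iter_symmetric:
  fixes B :: "'a::complex_inner \<Rightarrow> 'a"
  assumes "\<And>x y. cinner (B y) x = cinner y (B x)"
  shows "cinner (sqrt_iter B n y) x = cinner y (sqrt_iter B n x)"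
  by (induction n arbitrary: x y)
    (simp_all add: assms cinner_scaleC_left cinner_scaleC_right cinner_add_left cinner_add_right)

text \<open>The iterates commute, so a difference of squares factors as
  \<open>(p + q) (p - q)\<close>. The scalar iterates satisfy the same factorisation with equality,
  and induction transfers their increments as majorants.\<close>

lemma sqrt_iter_bounds:
  fixes B :: "'a::complex_inner \<Rightarrow> 'a"
  assumes B: "bounded_clinear B" and contr: "\<And>x. norm (B x) \<le> norm x"
  shows "norm (sqrt_iter B n x) \<le> sqrt_scalar_iter n * norm x"
    and "norm (sqrt_iter B (Suc n) x - sqrt_iter B n x) \<le> (sqrt_scalar_iter (Suc n) - sqrt_scalar_iter n) * norm x"
proof -
  let ?Y = "sqrt_iter B" and ?y = sqrt_scalar_iter
  note lin = bounded_clinearD[OF bounded_clinear_sqrt_iter[OF B]]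
  show le: "norm (?Y n x) \<le> ?y n * norm x" for n x
  proof (induction n arbitrary: x)
    case (Suc n)
    have "norm (?Y n (?Y n x)) \<le> ?y n * (?y n * norm x)"
      using order_trans[OF Suc mult_left_mono[OF Suc sqrt_scalar_iter_bounds(1)]] .
    then have "norm (B x + ?Y n (?Y n x)) \<le> norm x + ?y n * (?y n * norm x)"
      by (intro norm_triangle_le add_mono contr)
    then show ?case
      by (simp only: sqrt_iter.simps norm_scaleC) (simp add: power2_eq_square field_simps)
  qed simp
  show "norm (?Y (Suc n) x - ?Y n x) \<le> (?y (Suc n) - ?y n) * norm x"
  proof (induction n arbitrary: x)
    case 0
    then show ?case using contr[of x] by (simp add: norm_scaleC)
  next
    case (Suc n)
    let ?p = "?Y (Suc n)" and ?q = "?Y n"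
    define D where "D x = ?p x - ?q x" for x
    have Dle: "norm (D x) \<le> (?y (Suc n) - ?y n) * norm x" for x unfolding D_def by (rule Suc)
    have BY: "B (?Y n x) = ?Y n (B x)" for n x by (rule sqrt_iter_commute[OF B B refl])
    have comm: "?q (?p x) = ?p (?q x)"
      by (rule sqrt_iter_commute[where S = "?Y n" and n = "Suc n",
            OF B bounded_clinear_sqrt_iter[OF B] BY[of n, symmetric]])
    have iter: "?Y (Suc m) x = (1 / 2) *\<^sub>C (B x + ?Y m (?Y m x))" for m by simp
    have "?Y (Suc (Suc n)) x - ?Y (Suc n) x
        = (1 / 2) *\<^sub>C (B x + ?p (?p x)) - (1 / 2) *\<^sub>C (B x + ?q (?q x))"
      by (rule arg_cong2[where f = minus, OF iter iter])
    then have "?Y (Suc (Suc n)) x - ?Y (Suc n) x = (1 / 2) *\<^sub>C (?p (?p x) - ?q (?q x))"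
      by (simp only: complex_vector.scale_right_diff_distrib[symmetric] add_diff_cancel_left)
    also have "?p (?p x) - ?q (?q x) = ?p (D x) + ?q (D x)"
      unfolding D_def lin comm by simp
    finally have eq: "norm (?Y (Suc (Suc n)) x - ?Y (Suc n) x) = norm (?p (D x) + ?q (D x)) / 2"
      by (simp only: norm_scaleC) (simp del: sqrt_iter.simps)
    have "norm (?p (D x) + ?q (D x)) \<le> ?y (Suc n) * norm (D x) + ?y n * norm (D x)"
      by (intro norm_triangle_le add_mono le)
    also have "\<dots> = (?y (Suc n) + ?y n) * norm (D x)" by (simp add: distrib_right)
    also have "\<dots> \<le> (?y (Suc n) + ?y n) * ((?y (Suc n) - ?y n) * norm x)"
      using sqrt_scalar_iter_bounds(1)[of "Suc n"] sqrt_scalar_iter_bounds(1)[of n]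
      by (intro mult_left_mono Dle) simp
    finally have le: "norm (?p (D x) + ?q (D x)) \<le> (?y (Suc n) + ?y n) * ((?y (Suc n) - ?y n) * norm x)" .
    have "(?y (Suc n) + ?y n) * ((?y (Suc n) - ?y n) * norm x) / 2 = (?y (Suc (Suc n)) - ?y (Suc n)) * norm x"
    proof -
      have sq: "(1 + a\<^sup>2) / 2 - (1 + b\<^sup>2) / 2 = (a + b) * (a - b) / 2" for a b :: real
        by (simp add: power2_eq_square field_simps)
      have iter: "?y (Suc m) = (1 + (?y m)\<^sup>2) / 2" for m by simp
      have "?y (Suc (Suc n)) - ?y (Suc n) = (1 + (?y (Suc n))\<^sup>2) / 2 - (1 + (?y n)\<^sup>2) / 2"
        by (rule arg_cong2[where f = minus, OF iter iter])
      also have "\<dots> = (?y (Suc n) + ?y n) * (?y (Suc n) - ?y n) / 2"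
        by (rule sq)
      finally show ?thesis by (simp only: mult.assoc times_divide_eq_left)
    qed
    with eq divide_right_mono[OF le, of 2] show ?case by (simp only: zero_le_numeral)
  qed
qed

lemma ex_sqrt_contraction:
  fixes A :: "'a::complex_hilbert \<Rightarrow> 'a"
  assumes A: "positive_op A" and le: "\<And>x. Re (cinner x (A x)) \<le> (norm x)\<^sup>2"
  obtains S where "positive_op S" "\<forall>x. S (S x) = A x"
    "\<forall>U. bounded_clinear U \<longrightarrow> (\<forall>x. U (A x) = A (U x)) \<longrightarrow> (\<forall>x. U (S x) = S (U x))"
proof -
  have bA: "bounded_clinear A" using A by (simp add: positive_op_def)
  define B where "B x = x - A x" for x
  have bB: "bounded_clinear B" unfolding B_def by (intro bounded_clinear_diff bounded_clinear_id bA)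
  have "cinner x (B x) \<in> \<real>\<^sub>\<ge>\<^sub>0" for x
    using positive_op_cinner[OF A, of x] le[of x]
    by (simp add: B_def cinner_diff_right cinner_self complex_nonneg_Reals_iff)
  then have posB: "positive_op B" using bB by (simp add: positive_op_def)
  have contr: "norm (B x) \<le> norm x" for x
    using positive_op_cinner(2)[OF A]
    by (intro norm_positive_op_le[OF posB]) (simp add: B_def cinner_diff_right cinner_self)
  let ?Y = "sqrt_iter B" and ?y = sqrt_scalar_iter
  note bounds = sqrt_iter_bounds[OF bB contr]
  note bY = bounded_clinear_sqrt_iter[OF bB]
  have step: "norm (?Y (n + k) x - ?Y n x) \<le> (?y (n + k) - ?y n) * norm x" for n k x
  proof (induction k)
    case (Suc k)
    have "norm (?Y (n + Suc k) x - ?Y n x) \<le> norm (?Y (Suc (n + k)) x - ?Y (n + k) x) + norm (?Y (n + k) x - ?Y n x)"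
      using norm_triangle_ineq[of "?Y (Suc (n + k)) x - ?Y (n + k) x" "?Y (n + k) x - ?Y n x"]
      by (simp del: sqrt_iter.simps)
    also have "\<dots> \<le> (?y (Suc (n + k)) - ?y (n + k)) * norm x + (?y (n + k) - ?y n) * norm x"
      by (intro add_mono bounds Suc)
    finally show ?case by (simp add: algebra_simps del: sqrt_iter.simps sqrt_scalar_iter.simps)
  qed simp
  have cy: "Cauchy ?y"
  proof -
    obtain L where "?y \<longlonglongrightarrow> L"
      by (rule incseq_convergent[OF incseq_sqrt_scalar_iter, of 1]) (use sqrt_scalar_iter_bounds(2) in auto)
    then show ?thesis by (rule LIMSEQ_imp_Cauchy)
  qed
  \<comment> \<open>The scalar iterates increase and are bounded, hence Cauchy, and by
    \<open>step\<close> they majorise the operator increments.\<close>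
  have conv: "convergent (\<lambda>n. ?Y n x)" for x
  proof (rule Cauchy_convergent, rule CauchyI')
    fix e :: real assume e: "0 < e"
    then obtain N where N: "\<And>m n. m \<ge> N \<Longrightarrow> n \<ge> N \<Longrightarrow> dist (?y m) (?y n) < e / (norm x + 1)"
      using cy unfolding Cauchy_def by (metis add_nonneg_pos divide_pos_pos norm_ge_zero zero_less_one)
    show "\<exists>M. \<forall>m\<ge>M. \<forall>n>m. dist (?Y m x) (?Y n x) < e"
    proof (intro exI[of _ N] allI impI)
      fix m n assume mn: "N \<le> m" "m < n"
      have "dist (?Y m x) (?Y n x) \<le> (?y n - ?y m) * norm x"
        using step[of m "n - m" x] mn by (simp add: dist_norm norm_minus_commute)
      also have "\<dots> \<le> dist (?y m) (?y n) * (norm x + 1)"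
        by (intro mult_mono) (auto simp: dist_real_def)
      also have "\<dots> < e" using N[of m n] mn
        by (simp add: pos_less_divide_eq add_nonneg_pos)
      finally show "dist (?Y m x) (?Y n x) < e" .
    qed
  qed
  define Y where "Y x = lim (\<lambda>n. ?Y n x)" for x
  have Y: "(\<lambda>n. ?Y n x) \<longlonglongrightarrow> Y x" for x
    unfolding Y_def using conv convergent_LIMSEQ_iff by blast
  have Yle: "norm (?Y n x) \<le> norm x" for n x
    using bounds(1)[of n x] mult_right_mono[OF sqrt_scalar_iter_bounds(2)[of n], of "norm x"] by simp
  have nY: "norm (Y x) \<le> norm x" for x
    by (rule tendsto_upperbound[OF tendsto_norm[OF Y]]) (auto simp: Yle)
  have bY': "bounded_clinear Y"
  proof (rule bounded_clinearI)
    show "Y (x + y) = Y x + Y y" for x y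
      by (rule LIMSEQ_unique[OF Y]) (simp only: bounded_clinearD(3)[OF bY] tendsto_add[OF Y Y])
    show "Y (a *\<^sub>C x) = a *\<^sub>C Y x" for a x
      by (rule LIMSEQ_unique[OF Y])
        (simp only: bounded_clinearD(2)[OF bY] bounded_linear.tendsto[OF bounded_linear_scaleC_right Y])
    show "norm (Y x) \<le> 1 * norm x" for x using nY by simp
  qed
  have YY: "(\<lambda>n. ?Y n (?Y n x)) \<longlonglongrightarrow> Y (Y x)" for x
  proof -
    have "(\<lambda>n. ?Y n (?Y n x - Y x)) \<longlonglongrightarrow> 0"
    proof (rule Lim_null_comparison)
      show "\<forall>\<^sub>F n in sequentially. norm (?Y n (?Y n x - Y x)) \<le> norm (?Y n x - Y x)" by (simp add: Yle)
      show "(\<lambda>n. norm (?Y n x - Y x)) \<longlonglongrightarrow> 0"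
        using tendsto_norm[OF tendsto_diff[OF Y[of x] tendsto_const[of "Y x"]]] by simp
    qed
    from tendsto_add[OF this Y[of "Y x"]] show ?thesis by (simp add: bounded_clinearD(4)[OF bY])
  qed
  \<comment> \<open>The equation \<open>Y = (B + Y^2) / 2\<close> says that the square of
    \<open>1 - Y\<close> is \<open>1 - B\<close>, which is \<open>A\<close>.\<close>
  have fixpoint: "Y x = (1 / 2) *\<^sub>C (B x + Y (Y x))" for x
  proof (rule LIMSEQ_unique)
    show "(\<lambda>n. ?Y (Suc n) x) \<longlonglongrightarrow> Y x" by (rule LIMSEQ_Suc[OF Y])
    show "(\<lambda>n. ?Y (Suc n) x) \<longlonglongrightarrow> (1 / 2) *\<^sub>C (B x + Y (Y x))"
      unfolding sqrt_iter.simps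
      by (intro bounded_linear.tendsto[OF bounded_linear_scaleC_right] tendsto_add tendsto_const YY)
  qed
  have symY: "cinner (Y y) x = cinner y (Y x)" for x y
  proof (rule LIMSEQ_unique)
    show "(\<lambda>n. cinner (?Y n y) x) \<longlonglongrightarrow> cinner (Y y) x"
      by (rule bounded_linear.tendsto[OF bounded_linear_cinner_left Y])
    show "(\<lambda>n. cinner (?Y n y) x) \<longlonglongrightarrow> cinner y (Y x)"
      unfolding sqrt_iter_symmetric[OF positive_op_symmetric[OF posB]]
      by (rule bounded_linear.tendsto[OF bounded_clinearD(1)[OF cinner_bounded_clinear] Y])
  qed
  define S where "S x = x - Y x" for x
  show ?thesis
  proof (rule that)
    have "cinner x (S x) \<in> \<real>\<^sub>\<ge>\<^sub>0" for x
    proof -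
      have "cinner x (Y x) = cnj (cinner x (Y x))" using cinner_commute[of x "Y x"] symY[of x x] by simp
      then have "Im (cinner x (Y x)) = 0" by (metis Reals_cnj_iff complex_is_Real_iff)
      moreover have "Re (cinner x (Y x)) \<le> norm x * norm x"
        using order_trans[OF complex_Re_le_cmod cmod_cinner_le[of x "Y x"]] mult_left_mono[OF nY[of x], of "norm x"] by simp
      ultimately show ?thesis
        by (simp add: S_def cinner_diff_right cinner_self complex_nonneg_Reals_iff power2_eq_square)
    qed
    then show "positive_op S"
      unfolding positive_op_def S_def[abs_def] using bounded_clinear_diff[OF bounded_clinear_id bY'] by simp
    have Y2: "Y x + Y x = B x + Y (Y x)" for x
      unfolding scaleR_2[symmetric] scaleC_2[symmetric] by (subst fixpoint) (simp add: scaleC_scaleC)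
    have "S (S x) = x - (Y x + Y x) + Y (Y x)" for x by (simp add: S_def bounded_clinearD[OF bY'])
    then show "\<forall>x. S (S x) = A x" unfolding Y2 by (simp add: B_def)
    show "\<forall>U. bounded_clinear U \<longrightarrow> (\<forall>x. U (A x) = A (U x)) \<longrightarrow> (\<forall>x. U (S x) = S (U x))"
    proof (intro allI impI)
      fix U :: "'a \<Rightarrow> 'a" and x
      assume U: "bounded_clinear U" and comm: "\<forall>x. U (A x) = A (U x)"
      have "U (B x) = B (U x)" for x using comm by (simp add: B_def bounded_clinearD[OF U])
      from sqrt_iter_commute[OF bB U this] have eq: "U (?Y n x) = ?Y n (U x)" for n .
      have "U (Y x) = Y (U x)"
        by (rule LIMSEQ_unique[OF bounded_linear.tendsto[OF bounded_clinearD(1)[OF U] Y]])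
          (simp only: eq Y)
      then show "U (S x) = S (U x)" by (simp add: S_def bounded_clinearD[OF U])
    qed
  qed
qed

lemma positive_op_scale:
  assumes "positive_op T" "0 \<le> c"
  shows "positive_op (\<lambda>x. complex_of_real c *\<^sub>C T x)"
  unfolding positive_op_def
proof (intro conjI allI)
  show "bounded_clinear (\<lambda>x. complex_of_real c *\<^sub>C T x)"
    using assms by (intro bounded_clinear_scaleC) (simp add: positive_op_def)
  show "cinner x (complex_of_real c *\<^sub>C T x) \<in> \<real>\<^sub>\<ge>\<^sub>0" for x
    using positive_op_cinner[OF assms(1), of x] assms(2)
    by (simp add: cinner_scaleC_right complex_nonneg_Reals_iff)
qed

lemma ex_sqrt_commuting:
  fixes A :: "'a::complex_hilbert \<Rightarrow> 'a"
  assumes A: "positive_op A"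
  obtains S where "positive_op S" "S \<circ> S = A"
    "\<forall>U. bounded_clinear U \<longrightarrow> (\<forall>x. U (A x) = A (U x)) \<longrightarrow> (\<forall>x. U (S x) = S (U x))"
proof -
  have bA: "bounded_clinear A" using A by (simp add: positive_op_def)
  obtain C where C: "C > 0" "\<And>x. norm (A x) \<le> C * norm x" using bounded_clinear_bound[OF bA] by blast
  let ?A = "\<lambda>x. complex_of_real (1 / C) *\<^sub>C A x"
  have "positive_op ?A" using A C by (intro positive_op_scale) auto
  moreover have "Re (cinner x (?A x)) \<le> (norm x)\<^sup>2" for x
  proof -
    have "Re (cinner x (A x)) \<le> norm x * (C * norm x)"
      using order_trans[OF complex_Re_le_cmod cmod_cinner_le[of x "A x"]] mult_left_mono[OF C(2)[of x], of "norm x"] by simp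
    then show ?thesis using C(1) by (simp add: cinner_scaleC_right power2_eq_square field_simps)
  qed
  ultimately obtain S where S: "positive_op S" "\<forall>x. S (S x) = ?A x"
    "\<forall>U. bounded_clinear U \<longrightarrow> (\<forall>x. U (?A x) = ?A (U x)) \<longrightarrow> (\<forall>x. U (S x) = S (U x))"
    by (rule ex_sqrt_contraction)
  have bS: "bounded_clinear S" using S by (simp add: positive_op_def)
  show ?thesis
  proof (rule that)
    show "positive_op (\<lambda>x. complex_of_real (sqrt C) *\<^sub>C S x)" using S C by (intro positive_op_scale) auto
    show "(\<lambda>x. complex_of_real (sqrt C) *\<^sub>C S x) \<circ> (\<lambda>x. complex_of_real (sqrt C) *\<^sub>C S x) = A"
      using C(1) by (simp add: fun_eq_iff bounded_clinearD[OF bS] S scaleC_scaleC flip: of_real_mult)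
    show "\<forall>U. bounded_clinear U \<longrightarrow> (\<forall>x. U (A x) = A (U x)) \<longrightarrow>
        (\<forall>x. U (complex_of_real (sqrt C) *\<^sub>C S x) = complex_of_real (sqrt C) *\<^sub>C S (U x))"
    proof (intro allI impI)
      fix U :: "'a \<Rightarrow> 'a" and x
      assume U: "bounded_clinear U" and comm: "\<forall>x. U (A x) = A (U x)"
      then have "U (S x) = S (U x)"
        using S(3)[THEN spec, of U] by (simp add: bounded_clinearD[OF U])
      then show "U (complex_of_real (sqrt C) *\<^sub>C S x) = complex_of_real (sqrt C) *\<^sub>C S (U x)"
        by (simp add: bounded_clinearD[OF U])
    qed
  qed
qed

text \<open>Uniqueness: a positive root \<open>T\<close> commutes with its square \<open>A\<close>,
  hence with the constructed \<open>S\<close>. For \<open>y = T x - S x\<close> this gives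
  \<open>T y + S y = 0\<close>; positivity annihilates both terms, and then \<open>y\<close>
  itself.\<close>

lemma sqrt_op_properties:
  fixes A :: "'a::complex_hilbert \<Rightarrow> 'a"
  assumes A: "positive_op A"
  shows positive_op_sqrt_op: "positive_op (sqrt_op A)" and sqrt_op_square: "sqrt_op A \<circ> sqrt_op A = A"
proof -
  obtain S where S: "positive_op S" "S \<circ> S = A"
    "\<forall>U. bounded_clinear U \<longrightarrow> (\<forall>x. U (A x) = A (U x)) \<longrightarrow> (\<forall>x. U (S x) = S (U x))"
    by (rule ex_sqrt_commuting[OF A])
  have "sqrt_op A = S"
    unfolding sqrt_op_def
  proof (rule the_equality)
    fix T assume T: "positive_op T \<and> T \<circ> T = A"
    then have pT: "positive_op T" and bT: "bounded_clinear T" by (auto simp: positive_op_def)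
    have bS: "bounded_clinear S" using S by (simp add: positive_op_def)
    have SS: "S (S x) = A x" and TT: "T (T x) = A x" for x using S(2) T by (auto simp: fun_eq_iff)
    have comm: "T (S x) = S (T x)" for x
      using S(3)[THEN spec, of T] bT by (simp flip: TT)
    show "T = S"
    proof
      fix x
      define y where "y = T x - S x"
      have "T y + S y = 0"
        by (simp add: y_def bounded_clinearD[OF bT] bounded_clinearD[OF bS] comm SS TT)
      then have "cinner y (T y) + cinner y (S y) = 0" by (metis cinner_add_right cinner_zero_right)
      then have "Re (cinner y (T y)) + Re (cinner y (S y)) = 0" by (metis plus_complex.sel(1) zero_complex.sel(1))
      then have "Re (cinner y (T y)) = 0" "Re (cinner y (S y)) = 0"
        using positive_op_cinner(2)[OF pT, of y] positive_op_cinner(2)[OF S(1), of y] by linarith+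
      then have 0: "T y = 0" "S y = 0" using positive_op_eq_0[OF pT] positive_op_eq_0[OF S(1)] by auto
      have "cinner y y = cinner x (T y - S y)"
        by (simp add: y_def cinner_diff_left cinner_diff_right positive_op_symmetric[OF pT] positive_op_symmetric[OF S(1)]
            bounded_clinearD[OF bT] bounded_clinearD[OF bS])
      then show "T x = S x" using 0 by (simp add: y_def)
    qed
  qed (use S in auto)
  with S show "positive_op (sqrt_op A)" "sqrt_op A \<circ> sqrt_op A = A" by auto
qed

section \<open>The scalar Green function\<close>

text \<open>With \<open>u + 1 / u = 2 - h\<^sup>2 w\<close> and \<open>\<bar>u\<bar> < 1\<close>, this is the convolution kernel of the resolvent
  of the discrete Laplacian at \<open>w\<close>; its boundary values are the kernels with \<open>\<bar>u\<bar> = 1\<close>.\<close>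

definition green :: "real \<Rightarrow> complex \<Rightarrow> int \<Rightarrow> complex"
  where "green h u k = complex_of_real (h\<^sup>2) * u / (1 - u\<^sup>2) * u ^ nat \<bar>k\<bar>"

text \<open>The product of the weights at \<open>n\<close> and \<open>m\<close> dominates both the
  smaller of \<open>\<bar>n\<bar>\<close> and \<open>\<bar>m\<bar>\<close>, as the Dirichlet kernel
  requires, and the square root of \<open>\<bar>n - m\<bar>\<close>, as the difference of two Green
  kernels requires.\<close>

definition lattice_weight :: "int \<Rightarrow> real"
  where "lattice_weight n = sqrt (1 + \<bar>real_of_int n\<bar>)"

lemma lattice_weight_nonneg: "0 \<le> lattice_weight n"
  by (simp add: lattice_weight_def)

lemma lattice_weight_ge_1: "1 \<le> lattice_weight n"
  by (simp add: lattice_weight_def)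

lemma sqrt_le_lattice_weights:
  assumes "x \<le> (1 + \<bar>real_of_int n\<bar>) * (1 + \<bar>real_of_int m\<bar>)"
  shows "sqrt x \<le> lattice_weight n * lattice_weight m"
  using assms by (simp add: lattice_weight_def flip: real_sqrt_mult)

lemma sqrt_abs_diff_le_lattice_weights: "sqrt (real (nat \<bar>n - m\<bar>)) \<le> lattice_weight n * lattice_weight m"
proof (rule sqrt_le_lattice_weights)
  have "real (nat \<bar>n - m\<bar>) \<le> \<bar>real_of_int n\<bar> + \<bar>real_of_int m\<bar>" by linarith
  also have "\<dots> \<le> (1 + \<bar>real_of_int n\<bar>) * (1 + \<bar>real_of_int m\<bar>)" by (simp add: algebra_simps)
  finally show "real (nat \<bar>n - m\<bar>) \<le> \<dots>" .
qed

lemma green_even: "green h u (- k) = green h u k"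
  by (simp add: green_def)

section \<open>Roots of \<open>u + 1 / u = a\<close> in the unit disc and their boundary
  values\<close>

lemma Im_add_inverse: "Im (u + 1 / u) = Im u * (1 - 1 / (cmod u)\<^sup>2)"
  by (simp add: Im_divide cmod_power2 algebra_simps)

text \<open>The two roots \<open>x\<close> and \<open>a - x\<close> have product 1, so one of them
  lies in the closed unit disc.\<close>

lemma ex_joukowski_root: "\<exists>u. u \<noteq> 0 \<and> cmod u \<le> 1 \<and> u + 1 / u = a"
proof -
  define x where "x = (a + csqrt (a\<^sup>2 - 4)) / 2"
  have "x * (a - x) = 1"
  proof -
    have "4 * (x * (a - x)) = a\<^sup>2 - (csqrt (a\<^sup>2 - 4))\<^sup>2"
      by (simp add: x_def field_simps power2_eq_square)
    then show ?thesis by simp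
  qed
  then have x: "x \<noteq> 0" "a - x = 1 / x" by (auto simp: eq_divide_eq mult.commute)
  show ?thesis
  proof (cases "cmod x \<le> 1")
    case True
    then show ?thesis using x by (intro exI[of _ x]) (simp add: algebra_simps)
  next
    case False
    then show ?thesis using x by (intro exI[of _ "1 / x"]) (auto simp: norm_divide field_simps)
  qed
qed

lemma ex_joukowski_root_interior:
  assumes "Im a \<noteq> 0"
  shows "\<exists>u. u \<noteq> 0 \<and> cmod u < 1 \<and> u + 1 / u = a"
proof -
  obtain u where u: "u \<noteq> 0" "cmod u \<le> 1" "u + 1 / u = a" using ex_joukowski_root by blast
  have "cmod u \<noteq> 1" using Im_add_inverse[of u] u(3) assms by auto
  with u show ?thesis by (intro exI[of _ u]) auto
qed

text \<open>The identity \<open>(u - w) (u - 1 / w) = u ((u + 1 / u) - (w + 1 / w))\<close> gives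
  convergence to \<open>w\<close> at a linear rate once \<open>u\<close> stays away from the other
  root \<open>1 / w\<close>. For \<open>cmod w < 1\<close> that root lies outside the disc; for
  \<open>cmod w = 1\<close> the signs of the imaginary parts keep it apart. The excluded values 2
  and -2 have the double roots 1 and -1.\<close>

lemma joukowski_boundary_value:
  fixes a :: real
  assumes a: "a \<noteq> 2" "a \<noteq> - 2"
  obtains u0 C where "u0 \<noteq> 0" "cmod u0 \<le> 1" "u0\<^sup>2 \<noteq> 1" "u0 \<in> \<real> \<or> cmod u0 = 1"
    "\<forall>u \<delta>. 0 < \<delta> \<longrightarrow> u \<noteq> 0 \<longrightarrow> cmod u < 1 \<longrightarrow> u + 1 / u = complex_of_real a - \<i> * complex_of_real \<delta> \<longrightarrow>
      cmod (u - u0) \<le> C * \<delta>"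
proof -
  obtain v where v: "v \<noteq> 0" "cmod v \<le> 1" "v + 1 / v = complex_of_real a" using ex_joukowski_root by blast
  have sq: "v\<^sup>2 \<noteq> 1"
  proof
    assume "v\<^sup>2 = 1"
    then have "complex_of_real a = complex_of_real 2 \<or> complex_of_real a = complex_of_real (- 2)"
      using v(3) by (auto simp: power2_eq_1_iff)
    with a show False unfolding of_real_eq_iff by simp
  qed
  have product: "cmod (u - w) * cmod (u - 1 / w) \<le> \<delta>"
    if w: "w \<noteq> 0" "w + 1 / w = complex_of_real a"
      and u: "0 < \<delta>" "u \<noteq> 0" "cmod u < 1" "u + 1 / u = complex_of_real a - \<i> * complex_of_real \<delta>" for u w \<delta>
  proof -
    have "(u - w) * (u - 1 / w) = u * ((u + 1 / u) - (w + 1 / w))" 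
      using w(1) u(2) by (simp add: field_simps)
    also have "\<dots> = - (u * (\<i> * complex_of_real \<delta>))" unfolding w u by (simp add: algebra_simps)
    finally have "cmod (u - w) * cmod (u - 1 / w) = cmod u * \<delta>"
      using u by (simp add: norm_mult[symmetric]) (simp add: norm_mult)
    also have "\<dots> \<le> 1 * \<delta>" using u by (intro mult_right_mono) auto
    finally show ?thesis by simp
  qed
  have bound: "cmod (u - w) \<le> (1 / d) * \<delta>"
    if "cmod (u - w) * cmod (u - 1 / w) \<le> \<delta>" "0 < d" "d \<le> cmod (u - 1 / w)" for u w :: complex and d \<delta> :: real
  proof -
    have "cmod (u - w) * d \<le> \<delta>" using that mult_left_mono[OF that(3), of "cmod (u - w)"] by simp
    then show ?thesis using that(2) by (simp add: field_simps)
  qed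
  show ?thesis
  proof (cases "cmod v < 1")
    case True
    have "Im v * (1 - 1 / (cmod v)\<^sup>2) = 0" using Im_add_inverse[of v] v(3) by simp
    moreover have "(cmod v)\<^sup>2 \<noteq> 1" using True power_less_one_iff[of "cmod v" 2] by auto
    ultimately have "Im v = 0" using v(1) by auto
    then have "v \<in> \<real>" by (simp add: complex_is_Real_iff)
    define d where "d = 1 / cmod v - 1"
    have d: "0 < d" using True v(1) by (simp add: d_def field_simps)
    have "cmod (u - v) \<le> (1 / d) * \<delta>"
      if u: "0 < \<delta>" "u \<noteq> 0" "cmod u < 1" "u + 1 / u = complex_of_real a - \<i> * complex_of_real \<delta>" for u \<delta>
    proof (rule bound[OF product[OF v(1,3) u] d])
      have "cmod (1 / v) - cmod u \<le> cmod (1 / v - u)" by (rule norm_triangle_ineq2)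
      then show "d \<le> cmod (u - 1 / v)" using u(3) by (simp add: d_def norm_divide norm_minus_commute)
    qed
    with v sq \<open>v \<in> \<real>\<close> show ?thesis by (intro that[of v "1 / d"]) auto
  next
    case False
    then have 1: "cmod v = 1" using v by simp
    have "Im v \<noteq> 0"
    proof
      assume "Im v = 0"
      then have "v = complex_of_real (Re v)" by (simp add: complex_eq_iff)
      with 1 have "\<bar>Re v\<bar> = 1" by (metis norm_of_real)
      with \<open>v = _\<close> sq show False by (metis of_real_1 of_real_power power2_abs power_one)
    qed
    \<comment> \<open>For \<open>u\<close> in the disc the imaginary parts of \<open>u\<close> and
      \<open>u + 1 / u\<close> have opposite signs, and here the latter is
      \<open>- \<delta>\<close>; so the limit must be the root in the upper half plane.\<close>
    define w where "w = (if Im v > 0 then v else cnj v)"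
    have inv: "1 / v = cnj v" using 1 v(1) complex_norm_square[of v] by (simp add: field_simps)
    have w: "Im w > 0" "cmod w = 1" "w \<noteq> 0" "w\<^sup>2 \<noteq> 1" "1 / w = cnj w" "w + 1 / w = complex_of_real a"
    proof -
      show "Im w > 0" "cmod w = 1" "w \<noteq> 0" using \<open>Im v \<noteq> 0\<close> 1 v(1) by (auto simp: w_def)
      show "w\<^sup>2 \<noteq> 1" using sq by (auto simp: w_def simp flip: complex_cnj_power)
      have inv': "1 / cnj v = v" using arg_cong[OF inv, of cnj] by simp
      show "1 / w = cnj w" using inv inv' by (auto simp: w_def)
      show "w + 1 / w = complex_of_real a" using inv inv' v(3) by (auto simp: w_def add.commute)
    qed
    have "cmod (u - w) \<le> (1 / Im w) * \<delta>"
      if u: "0 < \<delta>" "u \<noteq> 0" "cmod u < 1" "u + 1 / u = complex_of_real a - \<i> * complex_of_real \<delta>" for u \<delta>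
    proof (rule bound[OF product[OF w(3,6) u] w(1)])
      have "Im u * (1 - 1 / (cmod u)\<^sup>2) = - \<delta>" using Im_add_inverse[of u] u(4) by simp
      moreover have "1 - 1 / (cmod u)\<^sup>2 < 0" using u(2,3) power_less_one_iff[of "cmod u" 2] by (simp add: field_simps)
      ultimately have "0 < Im u" using u(1) mult_less_0_iff[of "Im u" "1 - 1 / (cmod u)\<^sup>2"] by auto
      then have "Im w \<le> Im (u - cnj w)" by simp
      also have "\<dots> \<le> cmod (u - cnj w)" using abs_Im_le_cmod[of "u - cnj w"] by linarith
      finally show "Im w \<le> cmod (u - 1 / w)" by (simp add: w)
    qed
    with w show ?thesis by (intro that[of w "1 / Im w"]) auto
  qed
qed

text \<open>Off the origin, with \<open>\<bar>k\<bar> = p + 1\<close>, this is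
  \<open>(u + 1 / u) u^(p + 1) = u^(p + 2) + u^p\<close>; the prefactor of \<open>green\<close>
  normalises the jump at \<open>k = 0\<close>. The resolvent equation appears multiplied by
  \<open>h\<^sup>2\<close>.\<close>

lemma green_difference_equation:
  assumes u: "u \<noteq> 0" "u\<^sup>2 \<noteq> 1" "u + 1 / u = 2 - complex_of_real (h\<^sup>2) * w" and h: "h \<noteq> 0"
  shows "(2 - complex_of_real (h\<^sup>2) * w) * green h u k - green h u (k + 1) - green h u (k - 1)
    = (if k = 0 then complex_of_real (h\<^sup>2) else 0)"
proof -
  define c where "c = complex_of_real (h\<^sup>2) * u / (1 - u\<^sup>2)"
  have green: "green h u j = c * u ^ nat \<bar>j\<bar>" for j by (simp add: green_def c_def)
  show ?thesis
  proof (cases "k = 0")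
    case True
    have "(u + 1 / u) * c - c * u - c * u = c * (1 - u\<^sup>2) / u"
      using u(1) by (simp add: field_simps power2_eq_square)
    also have "\<dots> = complex_of_real (h\<^sup>2)" using u(1,2) by (simp add: c_def)
    finally show ?thesis unfolding True u(3)[symmetric] by (simp add: green del: of_real_power)
  next
    case False
    define p where "p = nat \<bar>k\<bar> - 1"
    have p: "nat \<bar>k\<bar> = Suc p" using False by (simp add: p_def)
    have sum: "green h u (k + 1) + green h u (k - 1) = c * u ^ Suc (Suc p) + c * u ^ p"
    proof (cases "k > 0")
      case True
      then have "nat \<bar>k + 1\<bar> = Suc (Suc p)" "nat \<bar>k - 1\<bar> = p" using p by linarith+
      then show ?thesis by (simp only: green)
    next
      case False
      then have "nat \<bar>k - 1\<bar> = Suc (Suc p)" "nat \<bar>k + 1\<bar> = p" using \<open>k \<noteq> 0\<close> p by linarith+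
      then show ?thesis by (simp only: green) (rule add.commute)
    qed
    have "(u + 1 / u) * green h u k = c * u ^ Suc (Suc p) + c * u ^ p"
      using u(1) by (simp add: green p field_simps)
    also note sum[symmetric]
    finally have eq: "(u + 1 / u) * green h u k = green h u (k + 1) + green h u (k - 1)" .
    have "(2 - complex_of_real (h\<^sup>2) * w) * green h u k - green h u (k + 1) - green h u (k - 1) = 0"
      unfolding u(3)[symmetric] eq by (simp only: add_diff_cancel_left' diff_self)
    then show ?thesis unfolding if_not_P[OF False] .
  qed
qed

lemma norm_green_le:
  assumes "cmod u \<le> 1"
  shows "cmod (green h u k) \<le> cmod (complex_of_real (h\<^sup>2) * u / (1 - u\<^sup>2))"
  unfolding green_def norm_mult[of _ "u ^ _"] norm_power
  using assms by (intro mult_left_le power_le_one) auto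

text \<open>Subtracting the rank one kernel \<open>c u^\<bar>n\<bar> u^\<bar>m\<bar>\<close> imposes a Dirichlet condition at the
  origin; the result is a geometric sum with \<open>min \<bar>n\<bar> \<bar>m\<bar>\<close> terms, so it stays bounded as \<open>u\<^sup>2 \<rightarrow> 1\<close>.\<close>

lemma green_dirichlet_bound:
  assumes u: "cmod u \<le> 1" "u\<^sup>2 \<noteq> 1"
  shows "cmod (green h u (n - m) - complex_of_real (h\<^sup>2) * u / (1 - u\<^sup>2) * u ^ nat \<bar>n\<bar> * u ^ nat \<bar>m\<bar>)
    \<le> h\<^sup>2 * (lattice_weight n * lattice_weight m)"
proof -
  define c where "c = complex_of_real (h\<^sup>2) * u / (1 - u\<^sup>2)"
  \<comment> \<open>On one side of the origin the difference is
    \<open>c u^(p - q) (1 - u^(2 q))\<close>, and the geometric sum cancels the denominator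
    \<open>1 - u\<^sup>2\<close> of \<open>c\<close>.\<close>
  have aux: "cmod (c * u ^ (p - q) - c * u ^ p * u ^ q) \<le> h\<^sup>2 * real q" if "q \<le> p" for p q :: nat
  proof -
    have "u ^ p = u ^ (p - q) * u ^ q" using that by (simp flip: power_add)
    then have "c * u ^ (p - q) - c * u ^ p * u ^ q = c * u ^ (p - q) * (1 - (u\<^sup>2) ^ q)"
      by (simp add: algebra_simps power2_eq_square power_mult_distrib)
    also have "\<dots> = (c * (1 - u\<^sup>2)) * u ^ (p - q) * (\<Sum>i<q. (u\<^sup>2) ^ i)"
      by (simp only: one_diff_power_eq[of "u\<^sup>2" q] mult_ac)
    also have "c * (1 - u\<^sup>2) = complex_of_real (h\<^sup>2) * u" using u(2) by (simp add: c_def)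
    also have "complex_of_real (h\<^sup>2) * u * u ^ (p - q) * (\<Sum>i<q. (u\<^sup>2) ^ i)
        = complex_of_real (h\<^sup>2) * (u * u ^ (p - q) * (\<Sum>i<q. (u\<^sup>2) ^ i))"
      by (simp only: mult.assoc)
    finally have "cmod (c * u ^ (p - q) - c * u ^ p * u ^ q)
        = h\<^sup>2 * (cmod (u * u ^ (p - q)) * cmod (\<Sum>i<q. (u\<^sup>2) ^ i))"
      by (simp add: norm_mult norm_power)
    also have "\<dots> \<le> h\<^sup>2 * (1 * real q)"
    proof (intro mult_left_mono mult_mono)
      show "cmod (u * u ^ (p - q)) \<le> 1"
        using u(1) by (simp add: norm_mult norm_power mult_le_one power_le_one)
      have "cmod (\<Sum>i<q. (u\<^sup>2) ^ i) \<le> (\<Sum>i<q. 1)"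
        using u(1) by (intro sum_norm_le) (simp add: norm_power power_le_one)
      then show "cmod (\<Sum>i<q. (u\<^sup>2) ^ i) \<le> real q" by simp
    qed auto
    finally show ?thesis by simp
  qed
  have bound: "cmod (c * u ^ nat \<bar>n - m\<bar> - c * u ^ nat \<bar>n\<bar> * u ^ nat \<bar>m\<bar>) \<le> h\<^sup>2 * real (nat \<bar>m\<bar>)"
    if "\<bar>m\<bar> \<le> \<bar>n\<bar>" for n m
  proof (cases "(0 \<le> n \<and> 0 \<le> m) \<or> (n \<le> 0 \<and> m \<le> 0)")
    case True
    then have "\<bar>n - m\<bar> = \<bar>n\<bar> - \<bar>m\<bar>" using that by (elim disjE) auto
    then have "nat \<bar>n - m\<bar> = nat \<bar>n\<bar> - nat \<bar>m\<bar>" by (simp only: nat_diff_distrib abs_ge_zero)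
    then show ?thesis using aux[of "nat \<bar>m\<bar>" "nat \<bar>n\<bar>"] that by (simp only: nat_mono)
  next
    \<comment> \<open>The origin separates \<open>n\<close> and \<open>m\<close>, so their distance
      is the sum of the moduli and the two kernels coincide.\<close>
    case False
    then have "(0 \<le> n \<and> m \<le> 0) \<or> (n \<le> 0 \<and> 0 \<le> m)" by auto
    then have "\<bar>n - m\<bar> = \<bar>n\<bar> + \<bar>m\<bar>" by (elim disjE) auto
    then have "nat \<bar>n - m\<bar> = nat \<bar>n\<bar> + nat \<bar>m\<bar>" by (simp only: nat_add_distrib abs_ge_zero)
    then show ?thesis by (simp only: power_add mult.assoc) simp
  qed
  have weights: "real (nat \<bar>m\<bar>) \<le> lattice_weight n * lattice_weight m" if "\<bar>m\<bar> \<le> \<bar>n\<bar>" for n m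
  proof -
    have "real (nat \<bar>m\<bar>) = sqrt (\<bar>real_of_int m\<bar> * \<bar>real_of_int m\<bar>)" by simp
    also have "\<dots> \<le> lattice_weight n * lattice_weight m"
      using that by (intro sqrt_le_lattice_weights mult_mono) auto
    finally show ?thesis .
  qed
  show ?thesis
  proof (cases "\<bar>m\<bar> \<le> \<bar>n\<bar>")
    case True
    have "cmod (green h u (n - m) - c * u ^ nat \<bar>n\<bar> * u ^ nat \<bar>m\<bar>) \<le> h\<^sup>2 * real (nat \<bar>m\<bar>)"
      using bound[OF True] by (simp add: green_def c_def)
    also have "\<dots> \<le> h\<^sup>2 * (lattice_weight n * lattice_weight m)"
      by (intro mult_left_mono weights True) auto
    finally show ?thesis by (simp add: c_def)
  next
    case False
    then have nm: "\<bar>n\<bar> \<le> \<bar>m\<bar>" by simp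
    have "green h u (n - m) = c * u ^ nat \<bar>m - n\<bar>"
      by (simp add: green_def c_def abs_minus_commute)
    then have "cmod (green h u (n - m) - c * u ^ nat \<bar>n\<bar> * u ^ nat \<bar>m\<bar>) \<le> h\<^sup>2 * real (nat \<bar>n\<bar>)"
      using bound[OF nm] by (simp add: mult_ac)
    also have "\<dots> \<le> h\<^sup>2 * (lattice_weight m * lattice_weight n)"
      by (intro mult_left_mono weights nm) auto
    finally show ?thesis by (simp add: c_def mult.commute)
  qed
qed

text \<open>Interpolation: \<open>cmod (u ^ k - v ^ k)\<close> is at most 2 and at most
  \<open>k * cmod (u - v)\<close>, hence at most the geometric mean. The resulting
  \<open>sqrt k\<close> fits the lattice weights, whereas the Lipschitz factor \<open>k\<close>
  would call for faster decay of \<open>\<psi>\<close> in these sums.\<close>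

lemma green_diff_bound:
  fixes h :: real
  assumes u: "cmod u \<le> 1" and v: "cmod v \<le> 1"
  defines "c \<equiv> \<lambda>u. complex_of_real (h\<^sup>2) * u / (1 - u\<^sup>2)"
  shows "cmod (green h u (n - m) - green h v (n - m))
    \<le> (cmod (c u - c v) + cmod (c v) * sqrt (2 * cmod (u - v))) * (lattice_weight n * lattice_weight m)"
proof -
  define k where "k = nat \<bar>n - m\<bar>"
  have "(cmod (u ^ k - v ^ k))\<^sup>2 \<le> 2 * (real k * cmod (u - v))"
  proof -
    have "cmod (u ^ k - v ^ k) \<le> cmod (u ^ k) + cmod (v ^ k)" by (rule norm_triangle_ineq4)
    also have "\<dots> \<le> 1 + 1" using u v by (intro add_mono) (simp_all add: norm_power power_le_one)
    finally show ?thesis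
      unfolding power2_eq_square by (intro mult_mono norm_power_diff u v) auto
  qed
  then have "cmod (u ^ k - v ^ k) \<le> sqrt (2 * cmod (u - v) * real k)"
    by (intro real_le_rsqrt) (simp add: mult_ac)
  also have "\<dots> = sqrt (2 * cmod (u - v)) * sqrt (real k)" by (rule real_sqrt_mult)
  also have "\<dots> \<le> sqrt (2 * cmod (u - v)) * (lattice_weight n * lattice_weight m)"
    unfolding k_def by (intro mult_left_mono sqrt_abs_diff_le_lattice_weights) auto
  finally have 1: "cmod (u ^ k - v ^ k) \<le> sqrt (2 * cmod (u - v)) * (lattice_weight n * lattice_weight m)" .
  have w1: "1 \<le> lattice_weight n * lattice_weight m"
    using mult_mono[OF lattice_weight_ge_1 lattice_weight_ge_1, of n m] lattice_weight_ge_1[of n] by simp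
  have green: "green h u (n - m) = c u * u ^ k" for u by (simp add: green_def c_def k_def)
  have "green h u (n - m) - green h v (n - m) = (c u - c v) * u ^ k + c v * (u ^ k - v ^ k)"
    unfolding green by (simp add: algebra_simps)
  then have "cmod (green h u (n - m) - green h v (n - m))
      \<le> cmod (c u - c v) * cmod (u ^ k) + cmod (c v) * cmod (u ^ k - v ^ k)"
    by (metis norm_mult norm_triangle_ineq)
  also have "\<dots> \<le> cmod (c u - c v) * (lattice_weight n * lattice_weight m)
      + cmod (c v) * (sqrt (2 * cmod (u - v)) * (lattice_weight n * lattice_weight m))"
    using u by (intro add_mono mult_left_mono 1 order_trans[OF _ w1]) (auto simp: norm_power power_le_one)
  finally show ?thesis by (simp add: algebra_simps)
qed

text \<open>On the unit circle this is the integer power \<open>u powi n\<close>. Negative powers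
  are written with the conjugate so that the modulus stays at most 1 for interior \<open>u\<close>
  as well.\<close>

definition plane_wave :: "complex \<Rightarrow> int \<Rightarrow> complex"
  where "plane_wave u n = (if 0 \<le> n then u ^ nat n else cnj u ^ nat (- n))"

lemma norm_plane_wave_le: "cmod u \<le> 1 \<Longrightarrow> cmod (plane_wave u n) \<le> 1"
  by (simp add: plane_wave_def norm_power power_le_one)

lemma plane_wave_powi:
  assumes "cmod u = 1"
  shows "plane_wave u n = u powi n" "cnj (plane_wave u n) = u powi (- n)"
proof -
  have "u * cnj u = 1" using assms complex_norm_square[of u] by simp
  then have u: "u \<noteq> 0" "cnj u = inverse u" using inverse_unique[of u "cnj u"] by auto
  show *: "plane_wave u n = u powi n" for n
    by (auto simp: plane_wave_def power_int_def u)
  show "cnj (plane_wave u n) = u powi (- n)"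
    unfolding * using u by (auto simp: power_int_def)
qed

text \<open>For real \<open>u\<close> the kernel is real. On the unit circle the prefactor of
  \<open>green\<close> is purely imaginary, so the difference is that prefactor times
  \<open>u^k + u^(-k)\<close> with \<open>k = n - m\<close>; each power splits into a factor in
  \<open>n\<close> and one in \<open>m\<close>, whence two ranks.\<close>

lemma green_imaginary_part:
  assumes u: "u \<noteq> 0" "u\<^sup>2 \<noteq> 1" "u \<in> \<real> \<or> cmod u = 1"
  obtains c where "\<forall>n m. green h u (n - m) - cnj (green h u (n - m))
    = c * (plane_wave u n * cnj (plane_wave u m) + cnj (plane_wave u n) * plane_wave u m)"
proof (cases "u \<in> \<real>")
  case True
  then have "cnj u = u" by (simp add: Reals_cnj_iff)
  then show ?thesis by (intro that[of 0]) (simp add: green_def)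
next
  case False
  then have 1: "cmod u = 1" using u by simp
  define c where "c = complex_of_real (h\<^sup>2) * u / (1 - u\<^sup>2)"
  have inv: "cnj u = inverse u" using 1 complex_norm_square[of u] u(1) by (simp add: field_simps)
  have "1 - u\<^sup>2 \<noteq> 0" using u(2) by simp
  then have "cnj c = - c"
    using u(1,2) by (simp add: c_def inv field_simps power2_eq_square)
  have "c * u ^ nat \<bar>k\<bar> - cnj (c * u ^ nat \<bar>k\<bar>) = c * (u powi k + u powi (- k))" for k
    using u(1) by (cases "0 \<le> k") (auto simp: \<open>cnj c = - c\<close> inv power_int_def algebra_simps)
  then have "green h u (n - m) - cnj (green h u (n - m)) = c * (u powi (n - m) + u powi (- (n - m)))" for n m
    by (simp only: green_def c_def)
  moreover have pw: "plane_wave u n * cnj (plane_wave u m) = u powi (n - m)" for n m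
    using u(1) by (simp only: plane_wave_powi(1)[OF 1, of n] plane_wave_powi(2)[OF 1, of m])
      (metis diff_conv_add_uminus power_int_add)
  ultimately show ?thesis
    by (intro that[of c]) (simp add: mult.commute[of "cnj (plane_wave u _)"])
qed

section \<open>Summability of the weights\<close>

lemma summable_on_int_powr:
  assumes "s > 1"
  shows "(\<lambda>n :: int. (1 + \<bar>real_of_int n\<bar>) powr (- s)) summable_on UNIV"
proof -
  have "summable (\<lambda>n. real (Suc n) powr (- s))"
    using assms by (subst summable_Suc_iff) (simp add: summable_real_powr_iff)
  then have nat: "(\<lambda>n. (1 + real n) powr (- s)) summable_on UNIV"
    by (intro summable_nonneg_imp_summable_on) (simp_all add: add.commute)
  have 1: "(\<lambda>n :: int. (1 + \<bar>real_of_int n\<bar>) powr (- s)) summable_on (int ` UNIV)"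
    by (subst summable_on_reindex) (use nat in \<open>simp_all add: o_def\<close>)
  have 2: "(\<lambda>n :: int. (1 + \<bar>real_of_int n\<bar>) powr (- s)) summable_on ((\<lambda>n. - int n) ` UNIV)"
    by (subst summable_on_reindex) (use nat in \<open>simp_all add: o_def inj_on_def\<close>)
  have "UNIV = int ` UNIV \<union> (\<lambda>n. - int n) ` UNIV"
    by (auto simp: image_iff) (metis int_cases2)
  then show ?thesis using summable_on_union[OF 1 2] by simp
qed

text \<open>The decay exponent \<open>\<nu> / 2\<close> of \<open>\<psi>\<close> minus the growth
  exponent 1/2 of the weight is \<open>(\<nu> - 1) / 2\<close>, which exceeds 1. The constant
  \<open>2 powr (\<nu> / 4)\<close> comes from
  \<open>(1 + \<bar>n\<bar>)^2 \<le> 2 (1 + n^2)\<close>.\<close>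

lemma summable_on_weighted_psi:
  assumes "\<nu> > 3"
  shows "(\<lambda>n. japanese_bracket n powr (- \<nu> / 2) * lattice_weight n) summable_on UNIV"
proof (rule summable_on_comparison_test)
  show "(\<lambda>n. 2 powr (\<nu> / 4) * (1 + \<bar>real_of_int n\<bar>) powr (- ((\<nu> - 1) / 2))) summable_on UNIV"
    using assms by (intro summable_on_cmult_right summable_on_int_powr) simp
  fix n :: int
  define x where "x = 1 + \<bar>real_of_int n\<bar>"
  have x: "x \<ge> 1" by (simp add: x_def)
  have "x\<^sup>2 / 2 \<le> 1 + (real_of_int n)\<^sup>2"
  proof -
    have "0 \<le> (\<bar>real_of_int n\<bar> - 1)\<^sup>2" by simp
    then show ?thesis by (simp add: x_def power2_sum power2_diff)
  qed
  then have "(1 + (real_of_int n)\<^sup>2) powr (- \<nu> / 4) \<le> (x\<^sup>2 / 2) powr (- \<nu> / 4)"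
    using x assms by (intro powr_mono2') auto
  moreover have "japanese_bracket n powr (- \<nu> / 2) = (1 + (real_of_int n)\<^sup>2) powr (- \<nu> / 4)"
    by (simp add: japanese_bracket_def powr_powr)
  moreover have "(x\<^sup>2 / 2) powr (- \<nu> / 4) = 2 powr (\<nu> / 4) * x powr (- \<nu> / 2)"
    using x by (simp add: powr_divide powr_powr powr_minus field_simps flip: powr_numeral)
  moreover have "lattice_weight n = x powr (1 / 2)"
    using x by (simp add: lattice_weight_def x_def powr_half_sqrt)
  ultimately have "japanese_bracket n powr (- \<nu> / 2) * lattice_weight n
      \<le> 2 powr (\<nu> / 4) * x powr (- \<nu> / 2) * x powr (1 / 2)"
    by (simp add: mult_right_mono)
  also have "\<dots> = 2 powr (\<nu> / 4) * x powr (- ((\<nu> - 1) / 2))"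
  proof -
    have "- \<nu> / 2 + 1 / 2 = - ((\<nu> - 1) / 2)" by (simp add: field_simps)
    then show ?thesis by (simp only: mult.assoc powr_add[symmetric])
  qed
  finally show "japanese_bracket n powr (- \<nu> / 2) * lattice_weight n
      \<le> 2 powr (\<nu> / 4) * (1 + \<bar>real_of_int n\<bar>) powr (- ((\<nu> - 1) / 2))" by (simp add: x_def)
qed (auto simp: lattice_weight_def)

section \<open>The free resolvent\<close>

lemma bounded_linear_l2_apply: "bounded_linear (\<lambda>f :: 'a::complex_inner l2. l2_apply f n)"
  by (rule bounded_linear_intro[where K = 1]) (auto simp: plus_l2.rep_eq scaleR_l2.rep_eq norm_l2_apply_le)

lemma norm_l2_shift: "norm (l2_shift k f) = norm f"
proof -
  have "bij_betw (\<lambda>n. n + k) UNIV UNIV"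
    by (rule bij_betwI[where g = "\<lambda>n. n - k"]) auto
  from infsum_reindex_bij_betw[OF this, of "\<lambda>n. (norm (l2_apply f n))\<^sup>2"]
  have "(norm (l2_shift k f))\<^sup>2 = (norm f)\<^sup>2" by (simp add: norm_l2_squared l2_shift.rep_eq)
  then show ?thesis by (simp add: power2_eq_iff_nonneg)
qed

lift_definition coordinate :: "'g::complex_inner \<Rightarrow> 'g l2 \<Rightarrow> complex l2"
  is "\<lambda>e f n. cinner e (f n)"
proof -
  fix e :: 'g and f :: "int \<Rightarrow> 'g"
  assume "(\<lambda>n. (norm (f n))\<^sup>2) summable_on UNIV"
  then have "(\<lambda>n. (norm e)\<^sup>2 * (norm (f n))\<^sup>2) summable_on UNIV" by (rule summable_on_cmult_right)
  then show "(\<lambda>n. (norm (cinner e (f n)))\<^sup>2) summable_on UNIV"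
    by (rule summable_on_comparison_test)
      (auto simp: power_mult_distrib[symmetric] intro!: power_mono cmod_cinner_le)
qed

text \<open>At \<open>n\<close> this sums \<open>r k\<close> against the value of \<open>g\<close>
  at \<open>n + k\<close>; for an even kernel such as \<open>green h u\<close> it is convolution
  proper.\<close>

definition convolution :: "(int \<Rightarrow> complex) \<Rightarrow> complex l2 \<Rightarrow> complex l2"
  where "convolution r g = (\<Sum>\<^sub>\<infinity>k. r k *\<^sub>C l2_shift k g)"

lemma has_sum_convolution:
  assumes r: "(\<lambda>k. cmod (r k)) summable_on UNIV"
  shows "((\<lambda>k. r k * l2_apply g (n + k)) has_sum l2_apply (convolution r g) n) UNIV"
proof -
  have "(\<lambda>k. norm (r k *\<^sub>C l2_shift k g)) summable_on UNIV"
    unfolding norm_scaleC norm_l2_shift by (rule summable_on_cmult_left[OF r])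
  from has_sum_bounded_linear[OF bounded_linear_l2_apply has_sum_infsum[OF abs_summable_summable[OF this]], of n]
  show ?thesis unfolding convolution_def by (simp add: scaleC_l2.rep_eq l2_shift.rep_eq scaleC_complex_def)
qed

lemma abs_summable_green:
  assumes "cmod u < 1"
  shows "(\<lambda>k. cmod (green h u k)) summable_on UNIV"
proof -
  have nat: "(\<lambda>n. cmod u ^ n) summable_on UNIV"
    using assms by (intro summable_nonneg_imp_summable_on summable_geometric) auto
  have 1: "(\<lambda>k. cmod u ^ nat \<bar>k\<bar>) summable_on (int ` UNIV)"
    by (subst summable_on_reindex) (use nat in \<open>simp_all add: o_def\<close>)
  have 2: "(\<lambda>k. cmod u ^ nat \<bar>k\<bar>) summable_on ((\<lambda>n. - int n) ` UNIV)"
    by (subst summable_on_reindex) (use nat in \<open>simp_all add: o_def inj_on_def\<close>)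
  have "UNIV = int ` UNIV \<union> (\<lambda>n. - int n) ` UNIV"
    by (auto simp: image_iff) (metis int_cases2)
  then have "(\<lambda>k. cmod u ^ nat \<bar>k\<bar>) summable_on UNIV" using summable_on_union[OF 1 2] by simp
  then show ?thesis
    unfolding green_def norm_mult[of _ "u ^ _"] norm_power by (rule summable_on_cmult_right)
qed

context
  fixes h :: real and u w :: complex
  assumes u: "u \<noteq> 0" "cmod u < 1" "u + 1 / u = 2 - complex_of_real (h\<^sup>2) * w" and h: "h \<noteq> 0"
begin

text \<open>After reindexing, the translations of the convolution fall on the kernel, and
  \<open>green_difference_equation\<close> leaves only the term \<open>k = 0\<close>.\<close>

lemma convolution_green_solves:
  "(2 - complex_of_real (h\<^sup>2) * w) * l2_apply (convolution (green h u) g) n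
    - l2_apply (convolution (green h u) g) (n + 1) - l2_apply (convolution (green h u) g) (n - 1)
    = complex_of_real (h\<^sup>2) * l2_apply g n"
proof -
  let ?r = "green h u" and ?a = "2 - complex_of_real (h\<^sup>2) * w"
  let ?f = "convolution ?r g"
  have "cmod (u\<^sup>2) < 1" using u by (simp add: norm_power power_less_one_iff)
  then have u2: "u\<^sup>2 \<noteq> 1" by auto
  note hs = has_sum_convolution[OF abs_summable_green[OF u(2), of h], of g]
  have bij: "bij_betw (\<lambda>k. k + j) UNIV UNIV" for j :: int
    by (rule bij_betwI[where g = "\<lambda>k. k - j"]) auto
  have shift: "((\<lambda>k. ?r (k - j) * l2_apply g (n + k)) has_sum l2_apply ?f (n + j)) UNIV" for j
    using hs[of "n + j"] has_sum_reindex_bij_betw[OF bij[of j], of "\<lambda>k. ?r (k - j) * l2_apply g (n + k)"]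
    by (simp add: add.assoc add.commute[of j])
  have "((\<lambda>k. ?a * (?r k * l2_apply g (n + k)) + (- (?r (k - 1) * l2_apply g (n + k)) + - (?r (k - - 1) * l2_apply g (n + k))))
      has_sum (?a * l2_apply ?f n + (- l2_apply ?f (n + 1) + - l2_apply ?f (n + - 1)))) UNIV"
    by (intro has_sum_add has_sum_cmult_right hs shift has_sum_uminusI)
  also have "(\<lambda>k. ?a * (?r k * l2_apply g (n + k)) + (- (?r (k - 1) * l2_apply g (n + k)) + - (?r (k - - 1) * l2_apply g (n + k))))
      = (\<lambda>k. (if k = 0 then complex_of_real (h\<^sup>2) else 0) * l2_apply g (n + k))"
    by (subst green_difference_equation[OF u(1) u2 u(3) h, symmetric]) (simp add: algebra_simps)
  also have "?a * l2_apply ?f n + (- l2_apply ?f (n + 1) + - l2_apply ?f (n + - 1))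
      = ?a * l2_apply ?f n - l2_apply ?f (n + 1) - l2_apply ?f (n - 1)"
    by (simp only: diff_conv_add_uminus add.assoc)
  finally have "((\<lambda>k. (if k = 0 then complex_of_real (h\<^sup>2) else 0) * l2_apply g (n + k))
      has_sum (?a * l2_apply ?f n - l2_apply ?f (n + 1) - l2_apply ?f (n - 1))) UNIV" .
  moreover have "((\<lambda>k. (if k = 0 then complex_of_real (h\<^sup>2) else 0) * l2_apply g (n + k))
      has_sum complex_of_real (h\<^sup>2) * l2_apply g n) UNIV"
  proof -
    have "((\<lambda>k. (if k = 0 then complex_of_real (h\<^sup>2) else 0) * l2_apply g (n + k))
      has_sum complex_of_real (h\<^sup>2) * l2_apply g n) {0}" by (rule has_sum_finiteI) auto
    then show ?thesis by (rule has_sum_cong_neutral[THEN iffD1, rotated -1]) auto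
  qed
  ultimately show ?thesis by (rule has_sum_unique)
qed

text \<open>Convolution commutes with translations. Convolving the equation for \<open>g\<close>
  gives \<open>h\<^sup>2\<close> times the convolution of \<open>y\<close>, while
  \<open>convolution_green_solves\<close> evaluates the same left side as \<open>h\<^sup>2\<close>
  times \<open>g\<close>.\<close>

lemma convolution_green_unique:
  assumes eq: "\<And>n. (2 - complex_of_real (h\<^sup>2) * w) * l2_apply g n - l2_apply g (n + 1) - l2_apply g (n - 1)
    = complex_of_real (h\<^sup>2) * l2_apply y n"
  shows "g = convolution (green h u) y"
proof (rule l2_eqI)
  fix n
  let ?r = "green h u" and ?a = "2 - complex_of_real (h\<^sup>2) * w"
  let ?f = "convolution ?r g"
  note hs = has_sum_convolution[OF abs_summable_green[OF u(2), of h]]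
  have "((\<lambda>k. ?a * (?r k * l2_apply g (n + k)) + (- (?r k * l2_apply g (n + 1 + k)) + - (?r k * l2_apply g (n - 1 + k))))
      has_sum (?a * l2_apply ?f n + (- l2_apply ?f (n + 1) + - l2_apply ?f (n - 1)))) UNIV"
    by (intro has_sum_add has_sum_cmult_right hs has_sum_uminusI)
  also have "(\<lambda>k. ?a * (?r k * l2_apply g (n + k)) + (- (?r k * l2_apply g (n + 1 + k)) + - (?r k * l2_apply g (n - 1 + k))))
      = (\<lambda>k. complex_of_real (h\<^sup>2) * (?r k * l2_apply y (n + k)))"
  proof
    fix k
    have "?a * l2_apply g (n + k) - l2_apply g (n + 1 + k) - l2_apply g (n - 1 + k)
        = complex_of_real (h\<^sup>2) * l2_apply y (n + k)"
      using eq[of "n + k"] by (simp only: add.assoc add.commute[of k] diff_conv_add_uminus)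
    from arg_cong[OF this, of "\<lambda>x. ?r k * x"]
    show "?a * (?r k * l2_apply g (n + k)) + (- (?r k * l2_apply g (n + 1 + k)) + - (?r k * l2_apply g (n - 1 + k)))
      = complex_of_real (h\<^sup>2) * (?r k * l2_apply y (n + k))"
      by (simp add: algebra_simps del: of_real_power)
  qed
  also have "?a * l2_apply ?f n + (- l2_apply ?f (n + 1) + - l2_apply ?f (n - 1)) = complex_of_real (h\<^sup>2) * l2_apply g n"
    using convolution_green_solves[of g n] by (simp only: diff_conv_add_uminus add.assoc)
  finally have "((\<lambda>k. complex_of_real (h\<^sup>2) * (?r k * l2_apply y (n + k))) has_sum complex_of_real (h\<^sup>2) * l2_apply g n) UNIV" .
  from has_sum_unique[OF this has_sum_cmult_right[OF hs]] h
  show "l2_apply g n = l2_apply (convolution ?r y) n" by simp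
qed

end

section \<open>Decoupling of the channels in an eigenbasis of \<open>Q\<close>\<close>

lemma l2_apply_sum: "l2_apply (\<Sum>i\<in>F. f i) n = (\<Sum>i\<in>F. l2_apply (f i) n)"
  by (induction F rule: infinite_finite_induct) (auto simp: plus_l2.rep_eq zero_l2.rep_eq)

text \<open>The basis vectors index themselves, so a repeated eigenvalue is carried with its
  multiplicity and \<open>card J\<close> is the dimension.\<close>

locale eigenbasis =
  fixes Q :: "'g::complex_hilbert \<Rightarrow> 'g" and J :: "'g set" and \<mu> :: "'g \<Rightarrow> real"
  assumes Q: "bounded_clinear Q" and J: "finite J" "orthonormal J" "complex_vector.span J = UNIV"
    and eigen: "\<And>e. e \<in> J \<Longrightarrow> Q e = complex_of_real (\<mu> e) *\<^sub>C e"
begin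

lemma expansion: "(\<Sum>e\<in>J. cinner e x *\<^sub>C e) = x"
  using fourier_sum_eq_self[OF J(1,2), of x] J(3) by (simp add: fourier_sum_def)

lemma coordinates_eqI: "(\<And>e. e \<in> J \<Longrightarrow> cinner e x = cinner e y) \<Longrightarrow> x = y"
  by (subst (1 2) expansion[symmetric]) simp

lemma l2_coordinates_eqI: "(\<And>e. e \<in> J \<Longrightarrow> coordinate e f = coordinate e g) \<Longrightarrow> f = g"
  by (intro l2_eqI coordinates_eqI) (metis coordinate.rep_eq)

lemma cinner_expansion: "cinner x y = (\<Sum>e\<in>J. cnj (cinner e x) * cinner e y)"
  by (subst (1) expansion[of y, symmetric], subst cinner_sum_right)
    (simp add: cinner_scaleC_right mult.commute, metis cinner_commute)

lemma cinner_eigen: "e \<in> J \<Longrightarrow> cinner e (Q x) = complex_of_real (\<mu> e) * cinner e x"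
proof -
  assume e: "e \<in> J"
  have "Q x = Q (\<Sum>f\<in>J. cinner f x *\<^sub>C f)" by (simp only: expansion)
  also have "\<dots> = (\<Sum>f\<in>J. (complex_of_real (\<mu> f) * cinner f x) *\<^sub>C f)"
    unfolding bounded_clinearD(7)[OF Q] bounded_clinearD(2)[OF Q]
    by (intro sum.cong refl) (simp add: eigen scaleC_scaleC mult.commute)
  finally show ?thesis by (simp only: cinner_fourier_sum_orthonormal[OF J(1,2) e])
qed

lemma coordinate_shifted_H_Q:
  assumes e: "e \<in> J" and h: "h \<noteq> 0"
  shows "complex_of_real (h\<^sup>2) * l2_apply (coordinate e (H_Q h Q f - z *\<^sub>C f)) n
    = (2 - complex_of_real (h\<^sup>2) * (z - complex_of_real (\<mu> e))) * l2_apply (coordinate e f) n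
      - l2_apply (coordinate e f) (n + 1) - l2_apply (coordinate e f) (n - 1)"
proof -
  define p q r where "p = cinner e (l2_apply f n)" and "q = cinner e (l2_apply f (n + 1))"
    and "r = cinner e (l2_apply f (n - 1))"
  have "l2_apply (coordinate e (H_Q h Q f - z *\<^sub>C f)) n
      = complex_of_real (1 / h\<^sup>2) * (2 * p - q - r) + complex_of_real (\<mu> e) * p - z * p"
    unfolding coordinate.rep_eq minus_l2.rep_eq H_Q_apply[OF Q] scaleC_l2.rep_eq p_def q_def r_def
    by (simp only: cinner_diff_right cinner_add_right cinner_scaleR_right cinner_scaleC_right cinner_eigen[OF e] of_real_numeral)
  then have "complex_of_real (h\<^sup>2) * l2_apply (coordinate e (H_Q h Q f - z *\<^sub>C f)) n
      = (complex_of_real (h\<^sup>2) * complex_of_real (1 / h\<^sup>2)) * (2 * p - q - r)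
        + complex_of_real (h\<^sup>2) * (complex_of_real (\<mu> e) * p - z * p)"
    by (simp only: distrib_left mult.assoc add_diff_eq[symmetric])
  also have "complex_of_real (h\<^sup>2) * complex_of_real (1 / h\<^sup>2) = 1"
    using h by (simp flip: of_real_mult)
  finally show ?thesis
    unfolding coordinate.rep_eq p_def[symmetric] q_def[symmetric] r_def[symmetric]
    by (simp add: algebra_simps del: of_real_power)
qed

text \<open>\<open>resolvent\<close> is an \<open>inv\<close>, so it is pinned down by injectivity,
  which is uniqueness in every channel, and by an explicit preimage assembled from the channel
  solutions.\<close>

lemma coordinate_resolvent:
  assumes h: "h \<noteq> 0" and e: "e \<in> J"
    and u: "\<And>e. e \<in> J \<Longrightarrow> u e \<noteq> 0" "\<And>e. e \<in> J \<Longrightarrow> cmod (u e) < 1"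
      "\<And>e. e \<in> J \<Longrightarrow> u e + 1 / u e = 2 - complex_of_real (h\<^sup>2) * (z - complex_of_real (\<mu> e))"
  shows "coordinate e (resolvent (H_Q h Q) z x) = convolution (green h (u e)) (coordinate e x)"
proof -
  let ?F = "\<lambda>f. H_Q h Q f - z *\<^sub>C f"
  have sol: "coordinate e f = convolution (green h (u e)) (coordinate e (?F f))" if e: "e \<in> J" for e f
    by (rule convolution_green_unique[OF u(1-3)[OF e] h]) (rule coordinate_shifted_H_Q[OF e h, symmetric])
  have inj: "inj ?F"
  proof (rule injI)
    fix f g assume "?F f = ?F g"
    then show "f = g" using sol[of _ f] sol[of _ g] by (intro l2_coordinates_eqI) simp
  qed
  define f where "f = (\<Sum>e\<in>J. convolution (green h (u e)) (coordinate e x) \<otimes>\<^sub>v e)"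
  have f: "coordinate e f = convolution (green h (u e)) (coordinate e x)" if "e \<in> J" for e
  proof (rule l2_eqI)
    fix n
    show "l2_apply (coordinate e f) n = l2_apply (convolution (green h (u e)) (coordinate e x)) n"
      unfolding coordinate.rep_eq f_def l2_apply_sum tensor_l2.rep_eq
      by (rule cinner_fourier_sum_orthonormal[OF J(1,2) that])
  qed
  have "?F f = x"
  proof (intro l2_coordinates_eqI l2_eqI)
    fix e n assume e: "e \<in> J"
    have "complex_of_real (h\<^sup>2) * l2_apply (coordinate e (?F f)) n = complex_of_real (h\<^sup>2) * l2_apply (coordinate e x) n"
      unfolding coordinate_shifted_H_Q[OF e h] f[OF e] by (rule convolution_green_solves[OF u(1-3)[OF e] h])
    then show "l2_apply (coordinate e (?F f)) n = l2_apply (coordinate e x) n" using h by simp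
  qed
  then have "resolvent (H_Q h Q) z x = f" unfolding resolvent_def by (rule inv_f_eq[OF inj])
  then show ?thesis using f[OF e] by simp
qed

end

section \<open>The lattice basis\<close>

lift_definition l2_delta :: "int \<Rightarrow> complex l2" is "\<lambda>n m. if m = n then 1 else 0"
  by (rule finite_nonzero_values_imp_summable_on) (auto intro: finite_subset[of _ "{_}"])

lemma l2_delta_tensor_apply: "l2_apply (l2_delta n \<otimes>\<^sub>v x) m = (if m = n then x else 0)"
  by (simp add: tensor_l2.rep_eq l2_delta.rep_eq)

lemma norm_l2_delta_tensor: "norm (l2_delta n \<otimes>\<^sub>v x) = norm x"
proof -
  have "(norm (l2_delta n \<otimes>\<^sub>v x))\<^sup>2 = (norm x)\<^sup>2"
    unfolding norm_l2_squared l2_delta_tensor_apply by (subst infsum_single[of n]) auto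
  then show ?thesis by (simp add: power2_eq_iff_nonneg)
qed

lemma cinner_l2_delta_tensor: "cinner (l2_delta n \<otimes>\<^sub>v x) f = cinner x (l2_apply f n)"
  unfolding cinner_l2.rep_eq l2_delta_tensor_apply by (subst infsum_single[of n]) auto

text \<open>\<open>hilbert_schmidt\<close> asks for an orthonormal basis to exist. Density comes
  from truncating to finitely many sites and expanding each value in \<open>J\<close>.\<close>

lemma (in eigenbasis) orthonormal_basis_l2:
  "orthonormal_basis {l2_delta n \<otimes>\<^sub>v e | n e. e \<in> J}"
proof -
  let ?E = "{l2_delta n \<otimes>\<^sub>v e | n e. e \<in> J}"
  have "cinner a b = (if a = b then 1 else 0)" if ab: "a \<in> ?E" "b \<in> ?E" for a b
  proof -
    obtain n e where a: "a = l2_delta n \<otimes>\<^sub>v e" "e \<in> J" using ab(1) by blast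
    obtain m f where b: "b = l2_delta m \<otimes>\<^sub>v f" "f \<in> J" using ab(2) by blast
    have ef: "cinner e e = 1" "e \<noteq> f \<Longrightarrow> cinner e f = 0"
      using J(2) a(2) b(2) by (auto simp: orthonormal_def)
    then have "e \<noteq> 0" by auto
    have "a = b \<longleftrightarrow> n = m \<and> e = f"
    proof
      assume "a = b"
      then have "l2_apply (l2_delta n \<otimes>\<^sub>v e) n = l2_apply (l2_delta m \<otimes>\<^sub>v f) n" using a b by simp
      with \<open>e \<noteq> 0\<close> show "n = m \<and> e = f" by (simp add: l2_delta_tensor_apply split: if_splits)
    qed (simp add: a b)
    then show ?thesis
      using ef unfolding a(1) b(1) cinner_l2_delta_tensor l2_delta_tensor_apply by auto
  qed
  moreover have "closure (complex_vector.span ?E) = UNIV"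
  proof (intro equalityI subset_UNIV subsetI)
    fix f :: "'g l2"
    show "f \<in> closure (complex_vector.span ?E)"
      unfolding closure_approachable
    proof (intro allI impI)
      fix \<epsilon> :: real assume \<epsilon>: "0 < \<epsilon>"
      obtain F where F: "finite F" and
        Fe: "dist (\<Sum>n\<in>F. (norm (l2_apply f n))\<^sup>2) (\<Sum>\<^sub>\<infinity>n. (norm (l2_apply f n))\<^sup>2) \<le> (\<epsilon> / 2)\<^sup>2"
        using infsum_finite_approximation[of "\<lambda>n. (norm (l2_apply f n))\<^sup>2" UNIV "(\<epsilon> / 2)\<^sup>2"] l2_apply[of f] \<epsilon>
        by auto
      define R where "R = (\<Sum>n\<in>F. l2_delta n \<otimes>\<^sub>v l2_apply f n)"
      have R: "l2_apply R m = (if m \<in> F then l2_apply f m else 0)" for m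
        unfolding R_def l2_apply_sum l2_delta_tensor_apply using F by simp
      have "R = (\<Sum>n\<in>F. \<Sum>e\<in>J. cinner e (l2_apply f n) *\<^sub>C (l2_delta n \<otimes>\<^sub>v e))"
      proof (rule l2_eqI)
        fix m
        have "(\<Sum>e\<in>J. cinner e (l2_apply f n) *\<^sub>C (if m = n then e else 0)) = (if m = n then l2_apply f n else 0)" for n
          by (cases "m = n") (simp_all add: expansion)
        then show "l2_apply R m = l2_apply (\<Sum>n\<in>F. \<Sum>e\<in>J. cinner e (l2_apply f n) *\<^sub>C (l2_delta n \<otimes>\<^sub>v e)) m"
          unfolding R l2_apply_sum scaleC_l2.rep_eq l2_delta_tensor_apply using F by simp
      qed
      also have "\<dots> \<in> complex_vector.span ?E"
        by (intro complex_vector.span_sum complex_vector.span_scale complex_vector.span_base) blast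
      finally have span: "R \<in> complex_vector.span ?E" .
      have "((\<lambda>n. (norm (l2_apply f n))\<^sup>2 + - (if n \<in> F then (norm (l2_apply f n))\<^sup>2 else 0))
          has_sum ((\<Sum>\<^sub>\<infinity>n. (norm (l2_apply f n))\<^sup>2) + - (\<Sum>n\<in>F. (norm (l2_apply f n))\<^sup>2))) UNIV"
      proof (intro has_sum_add has_sum_uminusI)
        show "((\<lambda>n. (norm (l2_apply f n))\<^sup>2) has_sum (\<Sum>\<^sub>\<infinity>n. (norm (l2_apply f n))\<^sup>2)) UNIV"
          using l2_apply[of f] by (intro has_sum_infsum) simp
        have "((\<lambda>n. if n \<in> F then (norm (l2_apply f n))\<^sup>2 else 0) has_sum (\<Sum>n\<in>F. (norm (l2_apply f n))\<^sup>2)) F"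
          by (rule has_sum_finiteI[OF F]) simp
        then show "((\<lambda>n. if n \<in> F then (norm (l2_apply f n))\<^sup>2 else 0) has_sum (\<Sum>n\<in>F. (norm (l2_apply f n))\<^sup>2)) UNIV"
          by (rule has_sum_cong_neutral[THEN iffD1, rotated -1]) auto
      qed
      also have "(\<lambda>n. (norm (l2_apply f n))\<^sup>2 + - (if n \<in> F then (norm (l2_apply f n))\<^sup>2 else 0))
          = (\<lambda>n. (norm (l2_apply (f - R) n))\<^sup>2)"
        by (auto simp: minus_l2.rep_eq R)
      finally have "(norm (f - R))\<^sup>2 = (\<Sum>\<^sub>\<infinity>n. (norm (l2_apply f n))\<^sup>2) + - (\<Sum>n\<in>F. (norm (l2_apply f n))\<^sup>2)"
        unfolding norm_l2_squared by (rule infsumI)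
      also have "\<dots> \<le> (\<epsilon> / 2)\<^sup>2" using Fe by (simp add: dist_real_def)
      finally have "norm (f - R) \<le> \<epsilon> / 2" by (rule power2_le_imp_le) (use \<epsilon> in simp)
      then show "\<exists>y\<in>complex_vector.span ?E. dist y f < \<epsilon>"
        using span \<epsilon> by (intro bexI[of _ R]) (auto simp: dist_norm norm_minus_commute)
    qed
  qed
  ultimately show ?thesis unfolding orthonormal_basis_def by blast
qed

section \<open>The weighted resolvent and its boundary values\<close>

text \<open>\<open>M\<close> enters the estimates through the decay \<open>\<beta>\<close> of its
  columns; the extra lattice weight in the summability condition leaves room for kernels that grow
  like the product of the weights.\<close>

locale weighted_lattice = eigenbasis Q J \<mu> for Q :: "'g::complex_hilbert \<Rightarrow> 'g" and J \<mu> +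
  fixes M :: "'g l2 \<Rightarrow> 'g l2" and \<beta> :: "int \<Rightarrow> real" and h :: real
  assumes M: "bounded_clinear M" and h: "h > 0"
    and norm_M_le: "\<And>n e. e \<in> J \<Longrightarrow> norm (M (l2_delta n \<otimes>\<^sub>v e)) \<le> \<beta> n"
    and summable_\<beta>: "(\<lambda>n. \<beta> n * lattice_weight n) summable_on UNIV"
    and \<beta>_nonneg: "\<And>n. 0 \<le> \<beta> n"
begin

definition site :: "int \<Rightarrow> 'g \<Rightarrow> 'g l2"
  where "site n e = M (l2_delta n \<otimes>\<^sub>v e)"

abbreviation sites :: "(int \<times> 'g \<times> int) set"
  where "sites \<equiv> UNIV \<times> J \<times> UNIV"

text \<open>This is \<open>M R\<close> composed with the adjoint of \<open>M\<close>, where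
  \<open>R\<close> acts in channel \<open>e\<close> with the matrix \<open>r e n m\<close>, written
  as a sum of rank one operators so that a trace norm bound can be read off.\<close>

definition kernel_op :: "('g \<Rightarrow> int \<Rightarrow> int \<Rightarrow> complex) \<Rightarrow> 'g l2 \<Rightarrow> 'g l2"
  where "kernel_op r = nuclear_sum sites (\<lambda>(n, e, m). r e n m) (\<lambda>(n, e, m). site n e) (\<lambda>(n, e, m). site m e)"

definition kernel_bound :: "real \<Rightarrow> ('g \<Rightarrow> int \<Rightarrow> int \<Rightarrow> complex) \<Rightarrow> bool"
  where "kernel_bound D r \<longleftrightarrow> 0 \<le> D \<and> (\<forall>e\<in>J. \<forall>n m. cmod (r e n m) \<le> D * (lattice_weight n * lattice_weight m))"

text \<open>The total over \<open>sites\<close> of the products of \<open>\<beta>\<close> and the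
  weights at both points. Under \<open>kernel_bound D r\<close> the nuclear coefficients sum to at
  most \<open>D * mass\<close>, and \<open>mass\<close> does not involve the energy.\<close>

definition mass :: real
  where "mass = (\<Sum>\<^sub>\<infinity>n. \<beta> n * lattice_weight n) * (real (card J) * (\<Sum>\<^sub>\<infinity>n. \<beta> n * lattice_weight n))"

lemma has_sum_mass:
  "((\<lambda>(n, e, m). (\<beta> n * lattice_weight n) * (1 * (\<beta> m * lattice_weight m))) has_sum mass) sites"
proof -
  have nn: "0 \<le> \<beta> n * lattice_weight n" for n
    by (intro mult_nonneg_nonneg \<beta>_nonneg lattice_weight_nonneg)
  have 1: "((\<lambda>e. 1) has_sum real (card J)) J" by (rule has_sum_finiteI[OF J(1)]) simp
  note hs = has_sum_infsum[OF summable_\<beta>]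
  have "((\<lambda>(e, m). 1 * (\<beta> m * lattice_weight m)) has_sum (real (card J) * (\<Sum>\<^sub>\<infinity>n. \<beta> n * lattice_weight n))) (J \<times> UNIV)"
    by (rule has_sum_nonneg_product[OF 1 _ hs nn]) simp
  from has_sum_nonneg_product[OF hs nn this] nn show ?thesis
    unfolding mass_def by (simp add: case_prod_unfold)
qed

lemma kernel_nuclear:
  assumes r: "kernel_bound D r"
  shows "nuclear sites (\<lambda>(n, e, m). r e n m) (\<lambda>(n, e, m). site n e) (\<lambda>(n, e, m). site m e)"
    and "(\<Sum>\<^sub>\<infinity>i\<in>sites. cmod (case i of (n, e, m) \<Rightarrow> r e n m) * norm (case i of (n, e, m) \<Rightarrow> site n e)
      * norm (case i of (n, e, m) \<Rightarrow> site m e)) \<le> D * mass"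
proof -
  let ?f = "\<lambda>i. cmod (case i of (n, e, m) \<Rightarrow> r e n m) * norm (case i of (n, e, m) \<Rightarrow> site n e)
      * norm (case i of (n, e, m) \<Rightarrow> site m e)"
  let ?g = "\<lambda>i. D * (case i of (n, e, m) \<Rightarrow> (\<beta> n * lattice_weight n) * (1 * (\<beta> m * lattice_weight m)))"
  have hs: "(?g has_sum D * mass) sites" by (rule has_sum_cmult_right[OF has_sum_mass])
  have le: "?f i \<le> ?g i" if i: "i \<in> sites" for i
  proof -
    obtain n e m where i: "i = (n, e, m)" "e \<in> J" using i by auto
    have "cmod (r e n m) * norm (site n e) * norm (site m e) \<le> (D * (lattice_weight n * lattice_weight m)) * \<beta> n * \<beta> m"
      unfolding site_def using r i(2) \<beta>_nonneg norm_M_le[OF i(2)] lattice_weight_nonneg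
      by (intro mult_mono mult_nonneg_nonneg) (auto simp: kernel_bound_def)
    then show ?thesis by (simp add: i mult_ac)
  qed
  show sm: "nuclear sites (\<lambda>(n, e, m). r e n m) (\<lambda>(n, e, m). site n e) (\<lambda>(n, e, m). site m e)"
    by unfold_locales (rule summable_on_comparison_test[OF has_sum_imp_summable[OF hs] le], auto)
  show "infsum ?f sites \<le> D * mass"
    by (rule has_sum_mono[OF has_sum_infsum[OF nuclear.summable_coeff[OF sm]] hs le])
qed

lemma bounded_clinear_kernel_op: "kernel_bound D r \<Longrightarrow> bounded_clinear (kernel_op r)"
  unfolding kernel_op_def by (rule nuclear.bounded_clinear[OF kernel_nuclear(1)])

lemma kernel_op_diff:
  assumes "kernel_bound D r" "kernel_bound D' s"
  shows "kernel_op r x - kernel_op s x = kernel_op (\<lambda>e n m. r e n m - s e n m) x"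
proof -
  have eq: "(\<lambda>(n, e, m). r e n m - s e n m) = (\<lambda>i. (case i of (n, e, m) \<Rightarrow> r e n m) - (case i of (n, e, m) \<Rightarrow> s e n m))"
    by auto
  show ?thesis unfolding kernel_op_def eq
    by (rule nuclear_sum_diff[OF kernel_nuclear(1)[OF assms(1)] kernel_nuclear(1)[OF assms(2)]])
qed

lemma kernel_op_hilbert_schmidt:
  assumes "kernel_bound D r"
  shows "hilbert_schmidt (kernel_op r)" "hs_norm (kernel_op r) \<le> D * mass"
  unfolding kernel_op_def
  using nuclear.hilbert_schmidt[OF kernel_nuclear(1)[OF assms] orthonormal_basis_l2] kernel_nuclear(2)[OF assms]
  by (blast intro: order_trans)+

lemma kernel_op_trace_le:
  assumes "kernel_bound D r" "finite F" "orthonormal F"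
  shows "cmod (\<Sum>x\<in>F. cinner x (kernel_op r x)) \<le> D * mass"
  unfolding kernel_op_def
  using nuclear.trace_le[OF kernel_nuclear(1)[OF assms(1)] assms(2,3)] kernel_nuclear(2)[OF assms(1)]
  by (rule order_trans)

lemma has_sum_kernel_form:
  assumes "kernel_bound D r"
  shows "((\<lambda>(n, e, m). r e n m * cinner (site m e) x * cinner y (site n e)) has_sum cinner y (kernel_op r x)) sites"
  using nuclear.has_sum_cinner[OF kernel_nuclear(1)[OF assms], of x y]
  unfolding kernel_op_def by (simp add: case_prod_unfold)

text \<open>Fubini with \<open>m\<close> innermost, channels next and \<open>n\<close> last: in this
  order the inner sum is either a value of the free resolvent or a functional that vanishes.\<close>

lemma kernel_form_iterated:
  assumes r: "kernel_bound D r"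
    and inner: "\<And>e n. e \<in> J \<Longrightarrow> ((\<lambda>m. r e n m * cinner (site m e) x) has_sum s e n) UNIV"
  shows "((\<lambda>n. \<Sum>e\<in>J. cinner y (site n e) * s e n) has_sum cinner y (kernel_op r x)) UNIV"
proof (rule has_sum_SigmaD)
  show hs: "((\<lambda>(n, e, m). r e n m * cinner (site m e) x * cinner y (site n e)) has_sum cinner y (kernel_op r x)) (UNIV \<times> J \<times> UNIV)"
    by (rule has_sum_kernel_form[OF r])
  fix n
  let ?F = "\<lambda>(e, m). r e n m * cinner (site m e) x * cinner y (site n e)"
  have sm: "?F summable_on (J \<times> UNIV)"
    by (rule summable_on_SigmaD1[where f = "\<lambda>n (e, m). r e n m * cinner (site m e) x * cinner y (site n e)",
          OF has_sum_imp_summable[OF hs]]) simp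
  have inner': "((\<lambda>m. ?F (e, m)) has_sum cinner y (site n e) * s e n) UNIV" if "e \<in> J" for e
    using has_sum_cmult_left[OF inner[OF that], of n "cinner y (site n e)"] by (simp add: mult.commute)
  have "((\<lambda>e. cinner y (site n e) * s e n) has_sum (\<Sum>e\<in>J. cinner y (site n e) * s e n)) J"
    by (rule has_sum_finiteI[OF J(1) refl])
  from has_sum_SigmaI[OF inner' this sm]
  show "((\<lambda>p. case (n, p) of (n, e, m) \<Rightarrow> r e n m * cinner (site m e) x * cinner y (site n e))
      has_sum (\<Sum>e\<in>J. cinner y (site n e) * s e n)) (J \<times> UNIV)"
    by simp
qed

lemma cinner_kernel_op_adjoint:
  assumes r: "kernel_bound D r"
  shows "cinner (kernel_op r x) y = cinner x (kernel_op (\<lambda>e n m. cnj (r e m n)) y)"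
proof -
  have r': "kernel_bound D (\<lambda>e n m. cnj (r e m n))"
    using r unfolding kernel_bound_def by (metis complex_mod_cnj mult.commute)
  have "((\<lambda>i. cnj (case i of (n, e, m) \<Rightarrow> r e n m * cinner (site m e) x * cinner y (site n e)))
      has_sum cnj (cinner y (kernel_op r x))) sites"
    unfolding has_sum_cnj_iff by (rule has_sum_kernel_form[OF r])
  also have "(\<lambda>i. cnj (case i of (n, e, m) \<Rightarrow> r e n m * cinner (site m e) x * cinner y (site n e)))
      = (\<lambda>(n, e, m). cnj (r e n m) * cinner (site n e) y * cinner x (site m e))"
    by (auto simp: fun_eq_iff mult_ac cinner_commute[symmetric])
  also have "cnj (cinner y (kernel_op r x)) = cinner (kernel_op r x) y" by (rule cinner_commute[symmetric])
  finally have "((\<lambda>(n, e, m). cnj (r e n m) * cinner (site n e) y * cinner x (site m e))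
      has_sum cinner (kernel_op r x) y) sites" .
  moreover have bij: "bij_betw (\<lambda>(n, e, m). (m, e, n)) sites sites"
    by (rule bij_betwI[where g = "\<lambda>(n, e, m). (m, e, n)"]) auto
  ultimately have "((\<lambda>(n, e, m). cnj (r e m n) * cinner (site m e) y * cinner x (site n e))
      has_sum cinner (kernel_op r x) y) sites"
    using has_sum_reindex_bij_betw[OF bij, of "\<lambda>(n, e, m). cnj (r e n m) * cinner (site n e) y * cinner x (site m e)"]
    by (simp add: case_prod_unfold)
  from has_sum_unique[OF this has_sum_kernel_form[OF r']] show ?thesis .
qed

lemma cinner_site: "cinner (site n e) x = l2_apply (coordinate e (cadjoint M x)) n"
  unfolding site_def coordinate.rep_eq cinner_cadjoint_right[OF M, symmetric] by (rule cinner_l2_delta_tensor)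

text \<open>The scalar product with \<open>y\<close> is that of \<open>cadjoint M y\<close> with the
  free resolvent applied to \<open>cadjoint M x\<close>. Expanded over sites and channels, each
  channel is a convolution with its Green kernel.\<close>

lemma weighted_resolvent_eq_kernel_op:
  assumes u: "\<And>e. e \<in> J \<Longrightarrow> u e \<noteq> 0" "\<And>e. e \<in> J \<Longrightarrow> cmod (u e) < 1"
      "\<And>e. e \<in> J \<Longrightarrow> u e + 1 / u e = 2 - complex_of_real (h\<^sup>2) * (z - complex_of_real (\<mu> e))"
    and bound: "kernel_bound D (\<lambda>e n m. green h (u e) (n - m))"
  shows "weighted_resolvent (H_Q h Q) M z = kernel_op (\<lambda>e n m. green h (u e) (n - m))"
proof
  fix x
  show "weighted_resolvent (H_Q h Q) M z x = kernel_op (\<lambda>e n m. green h (u e) (n - m)) x"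
  proof (rule cinner_eqI)
    fix y
    let ?f = "resolvent (H_Q h Q) z (cadjoint M x)"
    have "((\<lambda>m. green h (u e) (n - m) * cinner (site m e) x) has_sum l2_apply (coordinate e ?f) n) UNIV"
      if e: "e \<in> J" for e n
    proof -
      have bij: "bij_betw (\<lambda>k. n + k) UNIV UNIV" by (rule bij_betwI[where g = "\<lambda>k. k - n"]) auto
      have "((\<lambda>k. green h (u e) (n - (n + k)) * cinner (site (n + k) e) x) has_sum l2_apply (coordinate e ?f) n) UNIV"
        using has_sum_convolution[OF abs_summable_green[OF u(2)[OF e], of h], of "coordinate e (cadjoint M x)" n] h
        by (simp add: coordinate_resolvent[OF _ e u] cinner_site green_even)
      then show ?thesis
        using has_sum_reindex_bij_betw[OF bij, of "\<lambda>m. green h (u e) (n - m) * cinner (site m e) x"] by blast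
    qed
    from kernel_form_iterated[OF bound this]
    have "((\<lambda>n. \<Sum>e\<in>J. cinner y (site n e) * l2_apply (coordinate e ?f) n)
        has_sum cinner y (kernel_op (\<lambda>e n m. green h (u e) (n - m)) x)) UNIV" .
    moreover have "(\<Sum>e\<in>J. cinner y (site n e) * l2_apply (coordinate e ?f) n) = cinner (l2_apply (cadjoint M y) n) (l2_apply ?f n)" for n
      unfolding cinner_expansion[of "l2_apply (cadjoint M y) n"]
      by (intro sum.cong refl) (subst cinner_commute, simp add: cinner_site coordinate.rep_eq)
    ultimately have "cinner (cadjoint M y) ?f = cinner y (kernel_op (\<lambda>e n m. green h (u e) (n - m)) x)"
      unfolding cinner_l2.rep_eq by (simp only: infsumI)
    then show "cinner y (weighted_resolvent (H_Q h Q) M z x) = cinner y (kernel_op (\<lambda>e n m. green h (u e) (n - m)) x)"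
      by (simp add: weighted_resolvent_def cinner_cadjoint_left[OF M])
  qed
qed

section \<open>Boundary values at real energies\<close>

lemma kernel_boundI:
  assumes "\<And>e n m. e \<in> J \<Longrightarrow> cmod (r e n m) \<le> d e * (lattice_weight n * lattice_weight m)"
    and "\<And>e. e \<in> J \<Longrightarrow> 0 \<le> d e"
  shows "kernel_bound (\<Sum>e\<in>J. d e) r"
  unfolding kernel_bound_def
proof (intro conjI ballI allI)
  show "0 \<le> (\<Sum>e\<in>J. d e)" by (intro sum_nonneg assms)
  fix e n m assume e: "e \<in> J"
  have "d e \<le> (\<Sum>e\<in>J. d e)" using e J(1) assms(2) by (intro member_le_sum) auto
  then have "d e * (lattice_weight n * lattice_weight m) \<le> (\<Sum>e\<in>J. d e) * (lattice_weight n * lattice_weight m)"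
    by (intro mult_right_mono mult_nonneg_nonneg lattice_weight_nonneg)
  with assms(1)[OF e] show "cmod (r e n m) \<le> (\<Sum>e\<in>J. d e) * (lattice_weight n * lattice_weight m)"
    by (rule order_trans)
qed

lemma kernel_boundI_bounded:
  assumes "\<And>e n m. e \<in> J \<Longrightarrow> cmod (r e n m) \<le> d e"
  shows "kernel_bound (\<Sum>e\<in>J. d e) r"
proof (rule kernel_boundI)
  show d: "0 \<le> d e" if "e \<in> J" for e using order_trans[OF norm_ge_zero assms[OF that]] .
  fix e n m assume e: "e \<in> J"
  have "1 * 1 \<le> lattice_weight n * lattice_weight m"
    by (intro mult_mono lattice_weight_ge_1 lattice_weight_nonneg) auto
  then have "d e * 1 \<le> d e * (lattice_weight n * lattice_weight m)"
    by (intro mult_left_mono d e) simp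
  with assms[OF e, of n m] show "cmod (r e n m) \<le> d e * (lattice_weight n * lattice_weight m)" by simp
qed

lemma kernel_bound_green:
  assumes "\<And>e. e \<in> J \<Longrightarrow> cmod (u e) \<le> 1"
  shows "kernel_bound (\<Sum>e\<in>J. cmod (complex_of_real (h\<^sup>2) * u e / (1 - (u e)\<^sup>2))) (\<lambda>e n m. green h (u e) (n - m))"
  by (intro kernel_boundI_bounded norm_green_le assms)

text \<open>Real roots belong to energies outside the band from \<open>\<mu> e\<close> to
  \<open>\<mu> e + 4 / h\<^sup>2\<close>, roots of modulus 1 to energies inside it; 1 and -1 are the
  band edges.\<close>

definition boundary_root :: "complex \<Rightarrow> bool"
  where "boundary_root v \<longleftrightarrow> v \<noteq> 0 \<and> cmod v \<le> 1 \<and> v\<^sup>2 \<noteq> 1 \<and> (v \<in> \<real> \<or> cmod v = 1)"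

text \<open>The interior roots converge to the boundary roots, and \<open>green_diff_bound\<close>
  times \<open>mass\<close> turns this into Hilbert-Schmidt convergence. The rate may depend on
  \<open>E\<close>, which does no harm: uniformity comes later from the Dirichlet bound.\<close>

lemma boundary_resolvent_eq_kernel_op:
  assumes E: "\<And>e. e \<in> J \<Longrightarrow> E \<noteq> \<mu> e" "\<And>e. e \<in> J \<Longrightarrow> E \<noteq> \<mu> e + 4 / h\<^sup>2"
  obtains v where "\<forall>e\<in>J. boundary_root (v e)"
    "boundary_resolvent (H_Q h Q) M E = kernel_op (\<lambda>e n m. green h (v e) (n - m))"
proof -
  define a where "a e = 2 - h\<^sup>2 * (E - \<mu> e)" for e
  define P where "P e v C \<longleftrightarrow> boundary_root v \<and> (\<forall>u \<delta>. 0 < \<delta> \<longrightarrow> u \<noteq> 0 \<longrightarrow> cmod u < 1 \<longrightarrow>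
      u + 1 / u = complex_of_real (a e) - \<i> * complex_of_real \<delta> \<longrightarrow> cmod (u - v) \<le> C * \<delta>)" for e v C
  have "\<exists>v C. P e v C" if e: "e \<in> J" for e
  proof -
    \<comment> \<open>The lower band edge \<open>\<mu> e\<close> corresponds to 2 and the upper one
      to -2.\<close>
    have "a e \<noteq> 2" "a e \<noteq> - 2" using E[OF e] h by (auto simp: a_def field_simps)
    from joukowski_boundary_value[OF this] show ?thesis unfolding P_def boundary_root_def by metis
  qed
  then obtain v C where vC: "\<And>e. e \<in> J \<Longrightarrow> P e (v e) (C e)" by metis
  define z where "z e \<epsilon> = 2 - complex_of_real (h\<^sup>2) * (Complex E \<epsilon> - complex_of_real (\<mu> e))" for e \<epsilon>
  have z: "z e \<epsilon> = complex_of_real (a e) - \<i> * complex_of_real (h\<^sup>2 * \<epsilon>)" for e \<epsilon>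
    by (simp add: z_def a_def complex_eq_iff power2_eq_square)
  define U where "U \<epsilon> e = (SOME u. u \<noteq> 0 \<and> cmod u < 1 \<and> u + 1 / u = z e \<epsilon>)" for \<epsilon> e
  have U: "U \<epsilon> e \<noteq> 0" "cmod (U \<epsilon> e) < 1" "U \<epsilon> e + 1 / U \<epsilon> e = z e \<epsilon>" if "0 < \<epsilon>" for \<epsilon> e
  proof -
    have "Im (z e \<epsilon>) \<noteq> 0" using that h by (simp add: z)
    from someI_ex[OF ex_joukowski_root_interior[OF this]]
    show "U \<epsilon> e \<noteq> 0" "cmod (U \<epsilon> e) < 1" "U \<epsilon> e + 1 / U \<epsilon> e = z e \<epsilon>" unfolding U_def by auto
  qed
  have root: "boundary_root (v e)" if "e \<in> J" for e using vC[OF that] by (simp add: P_def)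
  then have v: "cmod (v e) \<le> 1" "(v e)\<^sup>2 \<noteq> 1" if "e \<in> J" for e using that by (auto simp: boundary_root_def)
  have pos: "\<forall>\<^sub>F \<epsilon> :: real in at_right 0. 0 < \<epsilon>" by (rule eventually_at_right_less)
  have U_lim: "((\<lambda>\<epsilon>. U \<epsilon> e) \<longlongrightarrow> v e) (at_right 0)" if e: "e \<in> J" for e
  proof -
    have "((\<lambda>\<epsilon>. U \<epsilon> e - v e) \<longlongrightarrow> 0) (at_right 0)"
    proof (rule Lim_null_comparison)
      show "\<forall>\<^sub>F \<epsilon> in at_right 0. norm (U \<epsilon> e - v e) \<le> C e * (h\<^sup>2 * \<epsilon>)"
        using pos
      proof eventually_elim
        case (elim \<epsilon>)
        then have "0 < h\<^sup>2 * \<epsilon>" using h by simp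
        with vC[OF e, unfolded P_def, THEN conjunct2, rule_format] U[OF elim, of e, unfolded z]
        show ?case by simp
      qed
      have "((\<lambda>\<epsilon>. C e * (h\<^sup>2 * \<epsilon>)) \<longlongrightarrow> C e * (h\<^sup>2 * 0)) (at_right 0)" by (intro tendsto_intros)
      then show "((\<lambda>\<epsilon>. C e * (h\<^sup>2 * \<epsilon>)) \<longlongrightarrow> 0) (at_right 0)" by simp
    qed
    then show ?thesis by (simp add: LIM_zero_iff)
  qed
  define c where "c u = complex_of_real (h\<^sup>2) * u / (1 - u\<^sup>2)" for u
  define d where "d \<epsilon> e = cmod (c (U \<epsilon> e) - c (v e)) + cmod (c (v e)) * sqrt (2 * cmod (U \<epsilon> e - v e))" for \<epsilon> e
  have "((\<lambda>\<epsilon>. d \<epsilon> e) \<longlongrightarrow> cmod (c (v e) - c (v e)) + cmod (c (v e)) * sqrt (2 * cmod (v e - v e))) (at_right 0)"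
    if e: "e \<in> J" for e
    unfolding d_def c_def using v(2)[OF e] by (intro tendsto_intros U_lim[OF e]) simp
  then have "((\<lambda>\<epsilon>. (\<Sum>e\<in>J. d \<epsilon> e) * mass) \<longlongrightarrow> (\<Sum>e\<in>J. 0) * mass) (at_right 0)"
    by (intro tendsto_intros) simp
  then have d_lim: "((\<lambda>\<epsilon>. (\<Sum>e\<in>J. d \<epsilon> e) * mass) \<longlongrightarrow> 0) (at_right 0)" by simp
  let ?K = "\<lambda>u. kernel_op (\<lambda>e n m. green h (u e) (n - m))"
  note bv = kernel_bound_green[of v, OF v(1)]
  have bU: "kernel_bound (\<Sum>e\<in>J. cmod (complex_of_real (h\<^sup>2) * U \<epsilon> e / (1 - (U \<epsilon> e)\<^sup>2))) (\<lambda>e n m. green h (U \<epsilon> e) (n - m))"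
    if "0 < \<epsilon>" for \<epsilon> using U(2)[OF that] by (intro kernel_bound_green less_imp_le)
  have T: "weighted_resolvent (H_Q h Q) M (Complex E \<epsilon>) = ?K (U \<epsilon>)" if "0 < \<epsilon>" for \<epsilon>
    by (rule weighted_resolvent_eq_kernel_op[OF U(1,2)[OF that] _ bU[OF that]])
      (use U(3)[OF that] in \<open>simp add: z_def\<close>)
  have diff: "(\<lambda>x. weighted_resolvent (H_Q h Q) M (Complex E \<epsilon>) x - ?K v x)
      = kernel_op (\<lambda>e n m. green h (U \<epsilon> e) (n - m) - green h (v e) (n - m))"
    and bd: "kernel_bound (\<Sum>e\<in>J. d \<epsilon> e) (\<lambda>e n m. green h (U \<epsilon> e) (n - m) - green h (v e) (n - m))"
    if \<epsilon>: "0 < \<epsilon>" for \<epsilon>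
  proof -
    show "(\<lambda>x. weighted_resolvent (H_Q h Q) M (Complex E \<epsilon>) x - ?K v x)
      = kernel_op (\<lambda>e n m. green h (U \<epsilon> e) (n - m) - green h (v e) (n - m))"
      unfolding T[OF \<epsilon>] by (rule ext) (rule kernel_op_diff[OF bU[OF \<epsilon>] bv])
    show "kernel_bound (\<Sum>e\<in>J. d \<epsilon> e) (\<lambda>e n m. green h (U \<epsilon> e) (n - m) - green h (v e) (n - m))"
    proof (rule kernel_boundI)
      fix e n m assume e: "e \<in> J"
      show "cmod (green h (U \<epsilon> e) (n - m) - green h (v e) (n - m)) \<le> d \<epsilon> e * (lattice_weight n * lattice_weight m)"
        using green_diff_bound[OF less_imp_le[OF U(2)[OF \<epsilon>]] v(1)[OF e]] unfolding d_def c_def .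
    qed (simp add: d_def)
  qed
  have lim: "hs_tendsto (\<lambda>\<epsilon>. weighted_resolvent (H_Q h Q) M (Complex E \<epsilon>)) (?K v) (at_right 0)"
    unfolding hs_tendsto_def
  proof (intro conjI)
    show "hilbert_schmidt (?K v)" by (rule kernel_op_hilbert_schmidt(1)[OF bv])
    show "\<forall>\<^sub>F \<epsilon> in at_right 0. hilbert_schmidt (weighted_resolvent (H_Q h Q) M (Complex E \<epsilon>))"
      using pos by eventually_elim (simp only: T kernel_op_hilbert_schmidt(1)[OF bU])
    show "((\<lambda>\<epsilon>. hs_norm (\<lambda>x. weighted_resolvent (H_Q h Q) M (Complex E \<epsilon>) x - ?K v x)) \<longlongrightarrow> 0) (at_right 0)"
    proof (rule tendsto_sandwich[OF _ _ tendsto_const d_lim])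
      show "\<forall>\<^sub>F \<epsilon> in at_right 0. hs_norm (\<lambda>x. weighted_resolvent (H_Q h Q) M (Complex E \<epsilon>) x - ?K v x)
          \<le> (\<Sum>e\<in>J. d \<epsilon> e) * mass"
        using pos by eventually_elim (simp only: diff kernel_op_hilbert_schmidt(2)[OF bd])
    qed (simp add: hs_norm_nonneg)
  qed
  have "boundary_resolvent (H_Q h Q) M E = ?K v"
    unfolding boundary_resolvent_def
    using lim hs_tendsto_unique[OF _ lim trivial_limit_at_right_real] by (rule the_equality)
  with root show ?thesis using that by blast
qed

section \<open>The form of the boundary value on a subspace of finite codimension\<close>

lemma kernel_form_eq_0:
  assumes "kernel_bound D r"
    and "\<And>e n. e \<in> J \<Longrightarrow> ((\<lambda>m. r e n m * cinner (site m e) x) has_sum 0) UNIV"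
  shows "cinner y (kernel_op r x) = 0"
proof -
  have "((\<lambda>n. \<Sum>e\<in>J. cinner y (site n e) * 0) has_sum cinner y (kernel_op r x)) UNIV"
    by (rule kernel_form_iterated[where s = "\<lambda>_ _. 0", OF assms])
  then have "((\<lambda>n::int. 0) has_sum cinner y (kernel_op r x)) UNIV" by simp
  from has_sum_unique[OF this has_sum_0_simp] show ?thesis .
qed

text \<open>By \<open>cinner_site\<close> this pairs channel \<open>e\<close> of
  \<open>cadjoint M x\<close> with \<open>\<alpha>\<close>. The waves inserted for
  \<open>\<alpha>\<close> are bounded but in general not square summable; the decay of the columns
  of \<open>M\<close> makes the series converge.\<close>

definition lattice_functional :: "'g \<Rightarrow> (int \<Rightarrow> complex) \<Rightarrow> 'g l2 \<Rightarrow> complex"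
  where "lattice_functional e \<alpha> x = (\<Sum>\<^sub>\<infinity>m. \<alpha> m * cinner (site m e) x)"

lemma summable_lattice_functional:
  assumes "e \<in> J" "\<And>m. cmod (\<alpha> m) \<le> 1"
  shows "(\<lambda>m. \<alpha> m * cinner (site m e) x) summable_on UNIV"
proof (rule abs_summable_summable, rule summable_on_comparison_test)
  show "(\<lambda>m. \<beta> m * lattice_weight m * norm x) summable_on UNIV"
    by (rule summable_on_cmult_left[OF summable_\<beta>])
  fix m
  have "cmod (\<alpha> m * cinner (site m e) x) \<le> 1 * (norm (site m e) * norm x)"
    unfolding norm_mult by (intro mult_mono assms cmod_cinner_le) auto
  also have "\<dots> \<le> 1 * ((\<beta> m * lattice_weight m) * norm x)"
  proof (intro mult_left_mono mult_right_mono)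
    have "\<beta> m * 1 \<le> \<beta> m * lattice_weight m" by (intro mult_left_mono \<beta>_nonneg lattice_weight_ge_1)
    then show "norm (site m e) \<le> \<beta> m * lattice_weight m"
      using norm_M_le[OF assms(1), of m] unfolding site_def by linarith
  qed auto
  finally show "cmod (\<alpha> m * cinner (site m e) x) \<le> \<beta> m * lattice_weight m * norm x" by simp
qed auto

lemma lattice_functional_linear:
  assumes "e \<in> J" "\<And>m. cmod (\<alpha> m) \<le> 1"
  shows "lattice_functional e \<alpha> (x + y) = lattice_functional e \<alpha> x + lattice_functional e \<alpha> y"
    and "lattice_functional e \<alpha> (a *\<^sub>C x) = a * lattice_functional e \<alpha> x"
proof -
  note sm = summable_lattice_functional[of e \<alpha>, OF assms]
  show "lattice_functional e \<alpha> (x + y) = lattice_functional e \<alpha> x + lattice_functional e \<alpha> y"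
    unfolding lattice_functional_def infsum_add[OF sm sm, symmetric]
    by (simp add: cinner_add_right distrib_left)
  show "lattice_functional e \<alpha> (a *\<^sub>C x) = a * lattice_functional e \<alpha> x"
    unfolding lattice_functional_def infsum_cmult_right'[symmetric]
    by (simp add: cinner_scaleC_right mult.left_commute)
qed

lemma lattice_functional_has_sum_0:
  assumes "e \<in> J" "\<And>m. cmod (\<alpha> m) \<le> 1" "lattice_functional e \<alpha> x = 0"
  shows "((\<lambda>m. c * (\<alpha> m * cinner (site m e) x)) has_sum 0) UNIV"
proof -
  have "((\<lambda>m. \<alpha> m * cinner (site m e) x) has_sum 0) UNIV"
    using has_sum_infsum[OF summable_lattice_functional[of e \<alpha> x, OF assms(1,2)]] assms(3)
    by (simp add: lattice_functional_def)
  from has_sum_cmult_right[OF this, of c] show ?thesis by simp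
qed

text \<open>Index 0 is the wave of the Dirichlet correction; 1 and 2 are the two plane waves of the
  imaginary part. Only \<open>i < 3\<close> occurs, so the last branch stands for 2.\<close>

definition boundary_wave :: "complex \<Rightarrow> nat \<Rightarrow> int \<Rightarrow> complex"
  where "boundary_wave v i m = (if i = 0 then v ^ nat \<bar>m\<bar> else if i = 1 then plane_wave v m else cnj (plane_wave v m))"

lemma norm_boundary_wave_le: "cmod v \<le> 1 \<Longrightarrow> cmod (boundary_wave v i m) \<le> 1"
  by (simp add: boundary_wave_def norm_plane_wave_le norm_power power_le_one)

text \<open>Index 0 annihilates the Dirichlet correction, so subtracting it leaves the form
  unchanged. Indices 1 and 2 annihilate the difference between the operator and its adjoint in the
  form, which is therefore real.\<close>

lemma green_form_on_kernel:
  assumes v: "\<And>e. e \<in> J \<Longrightarrow> boundary_root (v e)"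
    and l: "\<And>e i. e \<in> J \<Longrightarrow> i < 3 \<Longrightarrow> lattice_functional e (boundary_wave (v e) i) x = 0"
  shows "cinner x (kernel_op (\<lambda>e n m. green h (v e) (n - m)) x) \<in> \<real>"
    and "cinner x (kernel_op (\<lambda>e n m. green h (v e) (n - m)) x)
      = cinner x (kernel_op (\<lambda>e n m. green h (v e) (n - m)
          - complex_of_real (h\<^sup>2) * v e / (1 - (v e)\<^sup>2) * v e ^ nat \<bar>n\<bar> * v e ^ nat \<bar>m\<bar>) x)"
proof -
  have v': "v e \<noteq> 0" "cmod (v e) \<le> 1" "(v e)\<^sup>2 \<noteq> 1" "v e \<in> \<real> \<or> cmod (v e) = 1" if "e \<in> J" for e
    using v[OF that] by (auto simp: boundary_root_def)
  have zero: "((\<lambda>m. c * (boundary_wave (v e) i m * cinner (site m e) x)) has_sum 0) UNIV"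
    if e: "e \<in> J" "i < 3" for e i c
    by (rule lattice_functional_has_sum_0[OF e(1) norm_boundary_wave_le[OF v'(2)[OF e(1)]] l[OF e]])
  let ?r = "\<lambda>e n m. green h (v e) (n - m)"
  let ?q = "cinner x (kernel_op ?r x)"
  note br = kernel_bound_green[of v, OF v'(2)]
  define c where "c e = complex_of_real (h\<^sup>2) * v e / (1 - (v e)\<^sup>2)" for e
  let ?\<rho> = "\<lambda>e n m. c e * v e ^ nat \<bar>n\<bar> * v e ^ nat \<bar>m\<bar>"
  have b\<rho>: "kernel_bound (\<Sum>e\<in>J. cmod (c e)) ?\<rho>"
  proof (rule kernel_boundI_bounded)
    fix e n m assume "e \<in> J"
    then show "cmod (?\<rho> e n m) \<le> cmod (c e)"
      using v'(2) by (simp add: norm_mult norm_power mult_left_le mult_le_one power_le_one mult.assoc)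
  qed
  have "cinner x (kernel_op ?\<rho> x) = 0"
  proof (rule kernel_form_eq_0[OF b\<rho>])
    fix e n assume e: "e \<in> J"
    show "((\<lambda>m. ?\<rho> e n m * cinner (site m e) x) has_sum 0) UNIV"
      using zero[OF e, of 0 "c e * v e ^ nat \<bar>n\<bar>"] by (simp add: boundary_wave_def mult.assoc)
  qed
  then have "?q = cinner x (kernel_op ?r x - kernel_op ?\<rho> x)" by (simp add: cinner_diff_right)
  also have "kernel_op ?r x - kernel_op ?\<rho> x = kernel_op (\<lambda>e n m. ?r e n m - ?\<rho> e n m) x"
    by (rule kernel_op_diff[OF br b\<rho>])
  finally have "?q = cinner x (kernel_op (\<lambda>e n m. ?r e n m - ?\<rho> e n m) x)" .
  then show "?q = cinner x (kernel_op (\<lambda>e n m. ?r e n m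
          - complex_of_real (h\<^sup>2) * v e / (1 - (v e)\<^sup>2) * v e ^ nat \<bar>n\<bar> * v e ^ nat \<bar>m\<bar>) x)"
    by (simp only: c_def)
  have "\<exists>k. \<forall>n m. ?r e n m - cnj (?r e n m)
      = k * (plane_wave (v e) n * cnj (plane_wave (v e) m) + cnj (plane_wave (v e) n) * plane_wave (v e) m)"
    if e: "e \<in> J" for e
    by (rule green_imaginary_part[OF v'(1,3,4)[OF e], of h]) (rule exI)
  then obtain k where k: "\<And>e n m. e \<in> J \<Longrightarrow> ?r e n m - cnj (?r e n m)
      = k e * (plane_wave (v e) n * cnj (plane_wave (v e) m) + cnj (plane_wave (v e) n) * plane_wave (v e) m)"
    by metis
  \<comment> \<open>The kernel of the adjoint is transposed and conjugated; since
    \<open>green\<close> is even, only the conjugation has an effect.\<close>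
  let ?s = "\<lambda>e n m. cnj (?r e m n)"
  have ks: "?r e n m - ?s e n m
      = k e * (plane_wave (v e) n * cnj (plane_wave (v e) m) + cnj (plane_wave (v e) n) * plane_wave (v e) m)"
    if "e \<in> J" for e n m
    using k[OF that, of n m] green_even[of h "v e" "n - m"] by simp
  have bs: "kernel_bound (\<Sum>e\<in>J. cmod (complex_of_real (h\<^sup>2) * v e / (1 - (v e)\<^sup>2))) ?s"
    by (intro kernel_boundI_bounded) (simp only: complex_mod_cnj norm_green_le[OF v'(2)])
  have bd: "kernel_bound (\<Sum>e\<in>J. cmod (k e) * 2) (\<lambda>e n m. ?r e n m - ?s e n m)"
  proof (rule kernel_boundI_bounded)
    fix e n m assume e: "e \<in> J"
    let ?p = "plane_wave (v e)"
    have "cmod (?p n * cnj (?p m) + cnj (?p n) * ?p m) \<le> 1 * 1 + 1 * 1"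
      by (intro norm_triangle_le add_mono)
        (simp_all add: norm_mult mult_le_one norm_plane_wave_le[OF v'(2)[OF e]])
    then show "cmod (?r e n m - ?s e n m) \<le> cmod (k e) * 2"
      unfolding ks[OF e] norm_mult[of "k e"] by (intro mult_left_mono) auto
  qed
  have "kernel_op ?r x - kernel_op ?s x = kernel_op (\<lambda>e n m. ?r e n m - ?s e n m) x"
    by (rule kernel_op_diff[OF br bs])
  moreover have "cinner x (kernel_op (\<lambda>e n m. ?r e n m - ?s e n m) x) = 0"
  proof (rule kernel_form_eq_0[OF bd])
    fix e n assume e: "e \<in> J"
    let ?p = "plane_wave (v e)"
    have "((\<lambda>m. k e * ?p n * (cnj (?p m) * cinner (site m e) x) + k e * cnj (?p n) * (?p m * cinner (site m e) x)) has_sum 0 + 0) UNIV"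
      using has_sum_add[OF zero[OF e, of 2 "k e * ?p n"] zero[OF e, of 1 "k e * cnj (?p n)"]]
      by (simp add: boundary_wave_def)
    then show "((\<lambda>m. (?r e n m - ?s e n m) * cinner (site m e) x) has_sum 0) UNIV"
      unfolding ks[OF e] by (simp add: algebra_simps)
  qed
  ultimately have "?q - cinner x (kernel_op ?s x) = 0" by (simp only: cinner_diff_right[symmetric])
  moreover have "cnj ?q = cinner x (kernel_op ?s x)"
    using cinner_kernel_op_adjoint[OF br, of x x] by (simp add: cinner_commute[symmetric])
  ultimately have "?q - cnj ?q = 0" by (simp only:)
  then show "?q \<in> \<real>" by (simp add: Reals_cnj_iff)
qed

text \<open>Three functionals per channel, plus the trace bound whose factor
  \<open>h\<^sup>2\<close> comes from \<open>green_dirichlet_bound\<close>.\<close>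

definition count_bound :: nat
  where "count_bound = 3 * card J + nat \<lfloor>h\<^sup>2 * mass\<rfloor>"

text \<open>Where the form of \<open>L\<close> is real, the form of its imaginary part vanishes, so
  \<open>t\<close> drops out.\<close>

lemma pencil_properties:
  fixes L :: "'g l2 \<Rightarrow> 'g l2"
  assumes L: "bounded_clinear L" "boundary_resolvent H\<^sub>0 M E = L"
  shows selfadjoint_pencil: "selfadjoint (pencil H\<^sub>0 M E t)"
    and cinner_pencil: "cinner x (L x) \<in> \<real> \<Longrightarrow> cinner x (pencil H\<^sub>0 M E t x) = cinner x (L x)"
proof -
  note L' = bounded_clinear_cadjoint[OF L(1)]
  have pencil: "pencil H\<^sub>0 M E t = (\<lambda>x. (1 / 2) *\<^sub>C (L x + cadjoint L x)
      + complex_of_real t *\<^sub>C (1 / (2 * \<i>)) *\<^sub>C (L x - cadjoint L x))" for t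
    by (simp add: fun_eq_iff pencil_def re_part_def im_part_def L(2))
  have "bounded_clinear (pencil H\<^sub>0 M E t)"
    unfolding pencil by (intro bounded_clinear_add bounded_clinear_scaleC bounded_clinear_diff L(1) L')
  moreover have "cinner (pencil H\<^sub>0 M E t y) x = cinner y (pencil H\<^sub>0 M E t x)" for x y
    unfolding pencil
    by (simp only: cinner_add_left cinner_add_right cinner_diff_left cinner_diff_right cinner_scaleC_left
        cinner_scaleC_right cinner_cadjoint_left[OF L(1)] cinner_cadjoint_right[OF L(1)])
      (simp add: field_simps)
  ultimately show "selfadjoint (pencil H\<^sub>0 M E t)" by (simp add: selfadjoint_def)
  assume "cinner x (L x) \<in> \<real>"
  then have "cinner (L x) x = cinner x (L x)" by (metis Reals_cnj_iff cinner_commute)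
  then show "cinner x (pencil H\<^sub>0 M E t x) = cinner x (L x)"
    unfolding pencil
    by (simp only: cinner_add_right cinner_diff_right cinner_scaleC_right cinner_cadjoint_right[OF L(1)]) simp
qed

text \<open>The sign \<open>\<sigma>\<close> treats \<open>N_plus\<close> and \<open>N_minus\<close>
  at once: the trace is bounded in modulus, so its sign is immaterial.\<close>

lemma N_plus_pencil_le:
  assumes E: "\<And>e. e \<in> J \<Longrightarrow> E \<noteq> \<mu> e" "\<And>e. e \<in> J \<Longrightarrow> E \<noteq> \<mu> e + 4 / h\<^sup>2" and \<sigma>: "\<bar>\<sigma>\<bar> = (1 :: real)"
  shows "N_plus 1 (\<lambda>x. complex_of_real \<sigma> *\<^sub>C pencil (H_Q h Q) M E t x) \<le> enat count_bound"
proof -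
  obtain v where v: "\<forall>e\<in>J. boundary_root (v e)"
    "boundary_resolvent (H_Q h Q) M E = kernel_op (\<lambda>e n m. green h (v e) (n - m))"
    using boundary_resolvent_eq_kernel_op[OF E] by metis
  have v': "cmod (v e) \<le> 1" "(v e)\<^sup>2 \<noteq> 1" if "e \<in> J" for e using v(1) that by (auto simp: boundary_root_def)
  let ?L = "kernel_op (\<lambda>e n m. green h (v e) (n - m))"
  let ?G = "kernel_op (\<lambda>e n m. green h (v e) (n - m)
          - complex_of_real (h\<^sup>2) * v e / (1 - (v e)\<^sup>2) * v e ^ nat \<bar>n\<bar> * v e ^ nat \<bar>m\<bar>)"
  let ?S = "\<lambda>x. complex_of_real \<sigma> *\<^sub>C pencil (H_Q h Q) M E t x"
  note L = bounded_clinear_kernel_op[OF kernel_bound_green[of v, OF v'(1)]] v(2)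
  have S: "selfadjoint ?S"
    unfolding selfadjoint_def
  proof (intro conjI allI)
    show "bounded_clinear ?S"
      using selfadjoint_pencil[OF L] unfolding selfadjoint_def by (intro bounded_clinear_scaleC) blast
    show "cinner (?S y) x = cinner y (?S x)" for x y
      using selfadjoint_pencil[OF L, of t] by (simp add: selfadjoint_def cinner_scaleC_left cinner_scaleC_right)
  qed
  have bG: "kernel_bound (h\<^sup>2) (\<lambda>e n m. green h (v e) (n - m)
          - complex_of_real (h\<^sup>2) * v e / (1 - (v e)\<^sup>2) * v e ^ nat \<bar>n\<bar> * v e ^ nat \<bar>m\<bar>)"
    unfolding kernel_bound_def by (intro conjI ballI allI green_dirichlet_bound v') auto
  have "N_plus 1 ?S \<le> enat (card (J \<times> {..<3::nat}) + nat \<lfloor>h\<^sup>2 * mass\<rfloor>)"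
  proof (rule N_plus_le[where l = "\<lambda>(e, i). lattice_functional e (boundary_wave (v e) i)", OF S])
    show "finite (J \<times> {..<3::nat})" using J(1) by simp
    fix p x y a assume "p \<in> J \<times> {..<3::nat}"
    then obtain e i where p: "p = (e, i)" "e \<in> J" by auto
    note lin = lattice_functional_linear[OF p(2) norm_boundary_wave_le[OF v'(1)[OF p(2)]]]
    show "(case p of (e, i) \<Rightarrow> lattice_functional e (boundary_wave (v e) i)) (x + y)
      = (case p of (e, i) \<Rightarrow> lattice_functional e (boundary_wave (v e) i)) x
        + (case p of (e, i) \<Rightarrow> lattice_functional e (boundary_wave (v e) i)) y"
      "(case p of (e, i) \<Rightarrow> lattice_functional e (boundary_wave (v e) i)) (a *\<^sub>C x)
      = a * (case p of (e, i) \<Rightarrow> lattice_functional e (boundary_wave (v e) i)) x"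
      by (simp_all add: p lin)
  next
    fix C :: "'g l2 set"
    assume C: "finite C" "orthonormal C"
      and l: "\<And>x p. x \<in> C \<Longrightarrow> p \<in> J \<times> {..<3::nat} \<Longrightarrow> (case p of (e, i) \<Rightarrow> lattice_functional e (boundary_wave (v e) i)) x = 0"
    have "Re (cinner x (?S x)) = \<sigma> * Re (cinner x (?G x))" if x: "x \<in> C" for x
    proof -
      have l0: "lattice_functional e (boundary_wave (v e) i) x = 0" if "e \<in> J" "i < 3" for e i
        using l[OF x, of "(e, i)"] that by simp
      note form = green_form_on_kernel[of v x, OF v(1)[rule_format] l0]
      show ?thesis
        using cinner_pencil[OF L form(1), of t] form(2) by (simp add: cinner_scaleC_right)
    qed
    then have "(\<Sum>x\<in>C. Re (cinner x (?S x))) = \<sigma> * Re (\<Sum>x\<in>C. cinner x (?G x))"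
      by (simp add: sum_distrib_left)
    also have "\<dots> \<le> \<bar>\<sigma> * Re (\<Sum>x\<in>C. cinner x (?G x))\<bar>" by (rule abs_ge_self)
    also have "\<dots> = \<bar>Re (\<Sum>x\<in>C. cinner x (?G x))\<bar>" unfolding abs_mult \<sigma> by (rule mult_1_left)
    also have "\<dots> \<le> cmod (\<Sum>x\<in>C. cinner x (?G x))" by (rule abs_Re_le_cmod)
    also have "\<dots> \<le> h\<^sup>2 * mass" by (rule kernel_op_trace_le[OF bG C])
    finally show "(\<Sum>x\<in>C. Re (cinner x (?S x))) \<le> h\<^sup>2 * mass" .
  qed
  then show ?thesis by (simp add: count_bound_def card_cartesian_product mult.commute)
qed

end

section \<open>Uniform boundedness of the spectral shift function\<close>

text \<open>Reflection reduces the integral to a half line, where \<open>arctan\<close> is a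
  primitive; the two closed half lines overlap at 0, so the pointwise comparison is an
  inequality.\<close>

lemma nn_integral_inverse_1_plus_square:
  "(\<integral>\<^sup>+t. ennreal (1 / (1 + t\<^sup>2)) \<partial>lborel) \<le> ennreal pi"
proof -
  let ?f = "\<lambda>t :: real. ennreal (1 / (1 + t\<^sup>2)) * indicator {0..} t"
  have m: "(\<lambda>t. 1 / (1 + t\<^sup>2)) \<in> borel_measurable (borel :: real measure)" by measurable
  have "(\<integral>\<^sup>+t. ?f t \<partial>lborel) = ennreal (pi / 2 - arctan 0)"
  proof (rule nn_integral_FTC_atLeast[OF m])
    show "(arctan has_real_derivative 1 / (1 + x\<^sup>2)) (at x)" for x
      using DERIV_arctan[of x] by (simp add: inverse_eq_divide)
  qed (auto intro: tendsto_arctan_at_top)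
  then have half: "(\<integral>\<^sup>+t. ?f t \<partial>lborel) = ennreal (pi / 2)" by simp
  have "(\<integral>\<^sup>+t. ?f t \<partial>lborel) = ennreal \<bar>- 1\<bar> * (\<integral>\<^sup>+t. ?f (0 + - 1 * t) \<partial>lborel)"
    by (rule nn_integral_real_affine) auto
  then have half': "(\<integral>\<^sup>+t. ?f (- t) \<partial>lborel) = ennreal (pi / 2)"
    unfolding half by (simp only: abs_minus_cancel abs_one ennreal_1 mult_1_left add_0_left mult_minus1)
  have "(\<integral>\<^sup>+t. ennreal (1 / (1 + t\<^sup>2)) \<partial>lborel) \<le> (\<integral>\<^sup>+t. ?f t + ?f (- t) \<partial>lborel)"
    by (intro nn_integral_mono) (auto split: split_indicator)
  also have "\<dots> = (\<integral>\<^sup>+t. ?f t \<partial>lborel) + (\<integral>\<^sup>+t. ?f (- t) \<partial>lborel)"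
    by (rule nn_integral_add) auto
  also have "\<dots> = ennreal (pi / 2) + ennreal (pi / 2)" by (simp only: half half')
  finally show ?thesis by (simp flip: ennreal_plus)
qed

text \<open>The factor \<open>1 / pi\<close> cancels the bound on the total mass of the weight, so a
  bound on the counts that is uniform in \<open>t\<close> passes unchanged to the mean.\<close>

lemma poisson_mean_bounds:
  assumes "\<And>t. N t \<le> enat c"
  shows "0 \<le> poisson_mean N" "poisson_mean N \<le> ereal (real c)"
proof -
  let ?I = "\<integral>\<^sup>+t. ennreal_of_enat (N t) * ennreal (1 / (1 + t\<^sup>2)) \<partial>lborel"
  show "0 \<le> poisson_mean N" unfolding poisson_mean_def by (intro ereal_0_le_mult) auto
  have "ennreal_of_enat (N t) \<le> ennreal (real c)" for t
    using assms[of t] by (cases "N t") (auto simp: ennreal_of_nat_eq_real_of_nat)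
  then have "?I \<le> (\<integral>\<^sup>+t. ennreal (real c) * ennreal (1 / (1 + t\<^sup>2)) \<partial>lborel)"
    by (intro nn_integral_mono mult_right_mono) auto
  also have "\<dots> = ennreal (real c) * (\<integral>\<^sup>+t. ennreal (1 / (1 + t\<^sup>2)) \<partial>lborel)"
    by (rule nn_integral_cmult) measurable
  also have "\<dots> \<le> ennreal (real c) * ennreal pi"
    by (intro mult_left_mono nn_integral_inverse_1_plus_square) auto
  also have "\<dots> = ennreal (real c * pi)" by (simp add: ennreal_mult)
  finally have "enn2ereal ?I \<le> ereal (real c * pi)"
    by (simp add: less_eq_ennreal.rep_eq enn2ereal_ennreal)
  then have "poisson_mean N \<le> ereal (1 / pi) * ereal (real c * pi)"
    unfolding poisson_mean_def by (intro ereal_mult_left_mono) auto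
  then show "poisson_mean N \<le> ereal (real c)" by simp
qed

lemma (in weighted_lattice) abs_ssf_le:
  assumes E: "\<And>e. e \<in> J \<Longrightarrow> E \<noteq> \<mu> e" "\<And>e. e \<in> J \<Longrightarrow> E \<noteq> \<mu> e + 4 / h\<^sup>2"
    and H: "H = (\<lambda>x. H_Q h Q x + cadjoint M (M x)) \<or> H = (\<lambda>x. H_Q h Q x - cadjoint M (M x))"
  shows "\<bar>ssf M H (H_Q h Q) E\<bar> \<le> ereal (real count_bound)"
proof -
  have "N_minus 1 (pencil (H_Q h Q) M E t) \<le> enat count_bound" for t
    using N_plus_pencil_le[OF E, of "- 1" t] by (simp add: N_minus_def N_plus_def)
  note minus = poisson_mean_bounds[OF this]
  have "N_plus 1 (pencil (H_Q h Q) M E t) \<le> enat count_bound" for t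
    using N_plus_pencil_le[OF E, of 1 t] by simp
  note plus = poisson_mean_bounds[OF this]
  show ?thesis
    unfolding ssf_def using H minus plus by (auto simp: abs_ereal_ge0)
qed

text \<open>A finite spanning set bounds the size of orthonormal sets, so
  \<open>orthonormal_eigenvectors\<close> applies with all real numbers as candidate eigenvalues;
  those that are not eigenvalues contribute only the zero vector.\<close>

lemma eigenbasis_exists:
  fixes Q :: "'g::complex_hilbert \<Rightarrow> 'g" and B :: "'g set"
  assumes Q: "selfadjoint Q" and B: "finite B" "complex_vector.span B = UNIV"
    and eigen: "complex_vector.span (\<Union>\<mu>\<in>UNIV. eigenspace Q \<mu>) = UNIV"
  obtains J \<mu> where "eigenbasis Q J \<mu>" "\<And>e. e \<in> J \<Longrightarrow> \<mu> e \<in> eigenvalues Q"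
proof -
  have bound: "card C \<le> card B" if "finite C" "orthonormal C" "C \<subseteq> (\<Union>\<mu>\<in>UNIV. eigenspace Q \<mu>)" for C
    using complex_vector.independent_span_bound[OF B(1) orthonormal_independent[OF that(2)]] B(2) by simp
  obtain J where J: "finite J" "orthonormal J" "J \<subseteq> (\<Union>\<mu>\<in>UNIV. eigenspace Q \<mu>)" "card J \<le> card B"
    "(\<Union>\<mu>\<in>UNIV. eigenspace Q \<mu>) \<subseteq> complex_vector.span J"
    by (rule orthonormal_eigenvectors[OF Q bound])
  have "complex_vector.span J = UNIV"
    using complex_vector.span_minimal[OF J(5) complex_vector.subspace_span] eigen by auto
  have "\<forall>e\<in>J. \<exists>\<mu>. e \<in> eigenspace Q \<mu>" using J(3) by blast
  then obtain \<mu> where \<mu>: "\<And>e. e \<in> J \<Longrightarrow> e \<in> eigenspace Q (\<mu> e)" by metis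
  have "eigenbasis Q J \<mu>"
  proof
    show "bounded_clinear Q" using Q by (simp add: selfadjoint_def)
    show "Q e = complex_of_real (\<mu> e) *\<^sub>C e" if "e \<in> J" for e using \<mu>[OF that] by (simp add: eigenspace_def)
  qed fact+
  moreover have "\<mu> e \<in> eigenvalues Q" if "e \<in> J" for e
  proof -
    have "e \<noteq> 0" using orthonormal_norm[OF J(2) that] by auto
    with \<mu>[OF that] show ?thesis unfolding eigenvalues_def by blast
  qed
  ultimately show ?thesis by (rule that)
qed

section \<open>The weight operators and the factorisation of the perturbation\<close>

lemma M_psi_weight_le_1: "0 \<le> \<nu> \<Longrightarrow> \<bar>japanese_bracket n powr (- \<nu> / 2)\<bar> \<le> 1"
proof -
  assume \<nu>: "0 \<le> \<nu>"
  have "1 \<le> japanese_bracket n"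
    unfolding japanese_bracket_def by (rule ge_one_powr_ge_zero) auto
  then show ?thesis using \<nu> powr_mono[of "- \<nu> / 2" 0 "japanese_bracket n"] by simp
qed

lemma bounded_clinear_M_psi_tensor:
  assumes B: "bounded_clinear B" and \<nu>: "0 \<le> \<nu>"
  shows "bounded_clinear (M_psi \<nu> \<otimes>\<^sub>o B)"
proof -
  have "(M_psi \<nu> \<otimes>\<^sub>o B) = (\<lambda>f. to_l2 (\<lambda>n. complex_of_real (japanese_bracket n powr (- \<nu> / 2)) *\<^sub>C B (l2_apply f n)))"
    (is "_ = (\<lambda>f. to_l2 (?g f))")
  proof
    fix f
    have "l2_apply ((M_psi \<nu> \<otimes>\<^sub>o B) f) = ?g f"
      by (rule ext) (simp add: M_psi_tensor_apply[OF B \<nu>] scaleR_scaleC)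
    then show "(M_psi \<nu> \<otimes>\<^sub>o B) f = to_l2 (?g f)" by (metis l2_apply_inverse)
  qed
  then show ?thesis using bounded_clinear_pointwise(2)[OF B M_psi_weight_le_1[OF \<nu>]] by simp
qed

lemma cinner_M_psi_tensor_cadjoint:
  fixes K :: "'g::complex_hilbert \<Rightarrow> 'g"
  assumes K: "bounded_clinear K" and \<nu>: "0 \<le> \<nu>"
  shows "cinner ((M_psi \<nu> \<otimes>\<^sub>o cadjoint K) g) f = cinner g ((M_psi \<nu> \<otimes>\<^sub>o K) f)"
  unfolding cinner_l2.rep_eq M_psi_tensor_apply[OF K \<nu>] M_psi_tensor_apply[OF bounded_clinear_cadjoint[OF K] \<nu>]
  by (simp add: cinner_scaleR_left cinner_scaleR_right cinner_cadjoint_left[OF K])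

theorem theorem5p9:
  fixes h \<nu>\<^sub>0 :: real
    and Q K :: "'g::{complex_hilbert, second_countable_topology} \<Rightarrow> 'g"
    and \<V> V M :: "'g l2 \<Rightarrow> 'g l2"
  assumes "h > 0"
    and "\<exists>B. finite_dimensional_vector_space (scaleC :: complex \<Rightarrow> 'g \<Rightarrow> 'g) B"
    and "selfadjoint Q"
    and "Q = (\<lambda>_. 0) \<or> finite_eigendecomposition Q"
    and "\<nu>\<^sub>0 > 3"
    and "positive_op \<V>"
    and "hilbert_schmidt K"
    and V: "V = (M_psi \<nu>\<^sub>0 \<otimes>\<^sub>o cadjoint K) \<circ> \<V> \<circ> (M_psi \<nu>\<^sub>0 \<otimes>\<^sub>o K)"
    and M: "M = sqrt_op \<V> \<circ> (M_psi \<nu>\<^sub>0 \<otimes>\<^sub>o K)"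
  shows "(SUP E\<in>UNIV - thresholds h Q. \<bar>ssf M (\<lambda>f. H_Q h Q f + V f) (H_Q h Q) E\<bar>) < \<infinity>
    \<and> (SUP E\<in>UNIV - thresholds h Q. \<bar>ssf M (\<lambda>f. H_Q h Q f - V f) (H_Q h Q) E\<bar>) < \<infinity>"
proof -
  have \<nu>: "0 \<le> \<nu>\<^sub>0" using assms(5) by simp
  have K: "bounded_clinear K" using assms(7) by (simp add: hilbert_schmidt_def)
  define S where "S = sqrt_op \<V>"
  define A where "A = (M_psi \<nu>\<^sub>0 \<otimes>\<^sub>o K)"
  define A' where "A' = (M_psi \<nu>\<^sub>0 \<otimes>\<^sub>o cadjoint K)"
  have S: "positive_op S" "S \<circ> S = \<V>" unfolding S_def by (rule positive_op_sqrt_op sqrt_op_square, fact)+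
  have bS: "bounded_clinear S" using S(1) by (simp add: positive_op_def)
  have bA: "bounded_clinear A" unfolding A_def by (rule bounded_clinear_M_psi_tensor[OF K \<nu>])
  have M': "M = S \<circ> A" by (simp add: M S_def A_def)
  have bM: "bounded_clinear M" unfolding M' by (rule bounded_clinear_compose[OF bS bA])
  \<comment> \<open>The square root is symmetric and \<open>A'\<close> is adjoint to
    \<open>A\<close>, so \<open>V\<close> becomes \<open>cadjoint M\<close> after \<open>M\<close>,
    the shape that the case distinction in \<open>ssf\<close> tests for.\<close>
  have "cadjoint M = A' \<circ> S"
    by (rule cadjoint_eqI)
      (simp add: M' A_def A'_def cinner_M_psi_tensor_cadjoint[OF K \<nu>] positive_op_symmetric[OF S(1)])
  moreover have "S (S x) = \<V> x" for x using S(2) by (simp add: fun_eq_iff)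
  ultimately have VM: "V = (\<lambda>f. cadjoint M (M f))"
    by (simp add: V M' A_def[symmetric] A'_def[symmetric] fun_eq_iff)
  obtain B where "finite_dimensional_vector_space (scaleC :: complex \<Rightarrow> 'g \<Rightarrow> 'g) B" using assms(2) by blast
  then have B: "finite B" "complex_vector.span B = UNIV"
    by (rule finite_dimensional_vector_space.finite_Basis, rule finite_dimensional_vector_space.span_Basis)
  have eigen: "complex_vector.span (\<Union>\<mu>\<in>UNIV. eigenspace Q \<mu>) = UNIV"
    using assms(4)
  proof
    assume "Q = (\<lambda>_. 0)"
    then have "eigenspace Q 0 = UNIV" by (simp add: eigenspace_def)
    then have "(\<Union>\<mu>\<in>UNIV. eigenspace Q \<mu>) = UNIV" by blast
    then show ?thesis by (simp only: complex_vector.span_UNIV)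
  next
    assume "finite_eigendecomposition Q"
    then have "complex_vector.span (\<Union>\<mu>\<in>eigenvalues Q. eigenspace Q \<mu>) = UNIV"
      by (simp add: finite_eigendecomposition_def)
    moreover have "(\<Union>\<mu>\<in>eigenvalues Q. eigenspace Q \<mu>) \<subseteq> (\<Union>\<mu>\<in>UNIV. eigenspace Q \<mu>)" by blast
    ultimately show ?thesis using complex_vector.span_mono by blast
  qed
  obtain J \<mu> where J: "eigenbasis Q J \<mu>" and \<mu>: "\<And>e. e \<in> J \<Longrightarrow> \<mu> e \<in> eigenvalues Q"
    using eigenbasis_exists[OF assms(3) B eigen] by metis
  obtain c where c: "c > 0" "\<And>x. norm (S x) \<le> c * norm x" using bounded_clinear_bound[OF bS] by blast
  obtain k where k: "k > 0" "\<And>x. norm (K x) \<le> k * norm x" using bounded_clinear_bound[OF K] by blast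
  \<comment> \<open>\<open>c\<close> and \<open>k\<close> bound the norms of the square root of
    \<open>\<V>\<close> and of \<open>K\<close>; the remaining factor is
    \<open>\<psi>\<close>.\<close>
  define \<beta> where "\<beta> n = c * k * japanese_bracket n powr (- \<nu>\<^sub>0 / 2)" for n
  interpret weighted_lattice Q J \<mu> M \<beta> h
  proof (rule weighted_lattice.intro[OF J], rule weighted_lattice_axioms.intro)
    show "bounded_clinear M" "h > 0" by fact+
    show "0 \<le> \<beta> n" for n using c(1) k(1) by (simp add: \<beta>_def)
    show "(\<lambda>n. \<beta> n * lattice_weight n) summable_on UNIV"
      unfolding \<beta>_def mult.assoc by (intro summable_on_cmult_right summable_on_weighted_psi assms(5))
    fix n e assume "e \<in> J"
    then have e: "norm e = 1" using orthonormal_norm[OF eigenbasis.J(2)[OF J]] by blast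
    let ?w = "japanese_bracket n powr (- \<nu>\<^sub>0 / 2)"
    have "A (l2_delta n \<otimes>\<^sub>v e) = l2_delta n \<otimes>\<^sub>v (?w *\<^sub>R K e)"
      by (rule l2_eqI) (simp add: A_def M_psi_tensor_apply[OF K \<nu>] l2_delta_tensor_apply bounded_clinearD(5)[OF K])
    then have "norm (A (l2_delta n \<otimes>\<^sub>v e)) \<le> ?w * k"
      using mult_left_mono[OF k(2)[of e], of ?w] by (simp add: norm_l2_delta_tensor e)
    then have "norm (M (l2_delta n \<otimes>\<^sub>v e)) \<le> c * (?w * k)"
      using order_trans[OF c(2) mult_left_mono[of _ _ c]] c(1) by (simp add: M')
    then show "norm (M (l2_delta n \<otimes>\<^sub>v e)) \<le> \<beta> n" by (simp add: \<beta>_def mult_ac)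
  qed
  \<comment> \<open>\<open>thresholds\<close> has a separate clause for \<open>Q = 0\<close>; there
    every \<open>\<mu> e\<close> is 0, so both clauses exclude the band edges of all
    channels.\<close>
  have regular: "E \<noteq> \<mu> e \<and> E \<noteq> \<mu> e + 4 / h\<^sup>2" if E: "E \<notin> thresholds h Q" and e: "e \<in> J" for E e
  proof (cases "Q = (\<lambda>_. 0)")
    case True
    then have "\<mu> e = 0" using \<mu>[OF e] by (auto simp: eigenvalues_def eigenspace_def)
    then show ?thesis using E True by (auto simp: thresholds_def)
  next
    case False
    then show ?thesis using E \<mu>[OF e] by (auto simp: thresholds_def)
  qed
  have bound: "(SUP E\<in>UNIV - thresholds h Q. \<bar>ssf M H (H_Q h Q) E\<bar>) < \<infinity>"
    if H: "H = (\<lambda>x. H_Q h Q x + cadjoint M (M x)) \<or> H = (\<lambda>x. H_Q h Q x - cadjoint M (M x))" for H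
  proof -
    have "(SUP E\<in>UNIV - thresholds h Q. \<bar>ssf M H (H_Q h Q) E\<bar>) \<le> ereal (real count_bound)"
      using regular by (intro SUP_least abs_ssf_le H) blast+
    then show ?thesis by (rule le_less_trans) simp
  qed
  show ?thesis unfolding VM by (intro conjI bound) simp_all
qed

end
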